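(* Let $s,t\geq 1$ be integers, $r,r'\in\mathbb{Z}_2$ and $\eta\in\mathbb{P}^1(k)$. The following isomorphisms of $D_4$-modules hold. (1) If $s$ is odd, then $M_t(r,\eta)\otimes\Omega^sV(r')\cong stP(r+r')\oplus M_t(r+r'+1,\eta)$. (2) If $s$ is even, then $M_t(r,\eta)\otimes\Omega^sV(r')\cong stP(r+r'+1)\oplus M_t(r+r',\eta)$.
   Context: Let $k$ be an algebraically closed field with $\mathrm{char}(k)\neq 2$. All modules are finite-dimensional left modules; $\otimes=\otimes_k$; $\mathbb{Z}_2=\mathbb{Z}/2\mathbb{Z}$; $nM$ denotes the direct sum of $n$ copies of $M$; $\mathbb{P}^1(k)$ is identified with $k\cup\{\infty\}$; $l(M)$ is the length of $M$. $D_4$ is the $k$-algebra generated by $a,b,c,d$ subject to $ba=-ab$, $db=-bd$, $ca=-ac$, $dc=-cd$, $bc=cb$, $a^2=0$, $b^2=1$, $c^2=1$, $d^2=0$, $da+ad=1-bc$. It is a $16$-dimensional Hopf algebra (isomorphic to the Drinfeld double of Sweedler's 4-dimensional Hopf algebra) with comultiplication $\Delta(a)=a\otimes b+1\otimes a$, $\Delta(b)=b\otimes b$, $\Delta(c)=c\otimes c$, $\Delta(d)=d\otimes c+1\otimes d$, counit $\varepsilon(a)=\varepsilon(d)=0$, $\varepsilon(b)=\varepsilon(c)=1$, antipode $S(a)=-ab$, $S(b)=b$, $S(c)=c$, $S(d)=-dc$. Tensor products of $D_4$-modules are $D_4$-modules via $\Delta$. For $r\in\mathbb{Z}_2$, $V(r)$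 is the one-dimensional simple module on which $a,d$ act as $0$ and $b,c$ act as $(-1)^r$, and $P(r)$ is the projective cover of $V(r)$. For a module $M$, $\Omega M$ is the kernel of a projective cover $P(M)\to M$, and $\Omega^s$ is the $s$-fold iterate of $\Omega$. For $r\in\mathbb{Z}_2$, $\eta\in\mathbb{P}^1(k)$, $M_1(r,\eta)$ is the module with basis $v_1,v_2$ where $b,c$ act on $v_1$ as $(-1)^{r+1}$ and on $v_2$ as $(-1)^r$, $av_2=dv_2=0$, and $av_1=v_2$, $dv_1=-\eta v_2$ if $\eta\in k$, while $av_1=0$, $dv_1=v_2$ if $\eta=\infty$. An indecomposable module $M$ of Loewy length $2$ is of $(s,t)$-type if $l(M/\mathrm{soc}(M))=s$ and $l(\mathrm{soc}(M))=t$. For $s\geq1$, $M_s(r,\eta)$ denotes the (known to be unique up to isomorphism) indecomposable module of $(s,s)$-type containing a submodule isomorphic to $M_1(r,\eta)$. *)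

theory Defs
  imports
    "Jordan_Normal_Form.Matrix_Kernel"
    "HOL-Library.Z2"
begin

text \<open>
  A representation of the algebra \<open>D\<^sub>4\<close> is the same thing as a vector space with four
  operators satisfying the defining relations.  All modules are finite-dimensional and are only
  considered up to isomorphism, so the underlying space is taken to be the space of column
  vectors of length \<open>mdim M\<close>.
\<close>

record 'k rep =
  mdim :: nat
  act_a :: "'k mat"
  act_b :: "'k mat"
  act_c :: "'k mat"
  act_d :: "'k mat"

definition D4_module :: "'k::field rep \<Rightarrow> bool" where
  "D4_module M \<longleftrightarrow>
     (let n = mdim M; a = act_a M; b = act_b M; c = act_c M; d = act_d M in
        a \<in> carrier_mat n n \<and> b \<in> carrier_mat n n \<and>
        c \<in> carrier_mat n n \<and> d \<in> carrier_mat n n \<and>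
        b * a = - (a * b) \<and> d * b = - (b * d) \<and>
        c * a = - (a * c) \<and> d * c = - (c * d) \<and>
        b * c = c * b \<and>
        a * a = 0\<^sub>m n n \<and> b * b = 1\<^sub>m n \<and> c * c = 1\<^sub>m n \<and> d * d = 0\<^sub>m n n \<and>
        d * a + a * d = 1\<^sub>m n - b * c)"

abbreviation space :: "'k::field rep \<Rightarrow> 'k vec set" where
  "space M \<equiv> carrier_vec (mdim M)"

definition D4_hom :: "'k::field rep \<Rightarrow> 'k rep \<Rightarrow> 'k mat set" where
  "D4_hom M N = {f \<in> carrier_mat (mdim N) (mdim M).
     f * act_a M = act_a N * f \<and> f * act_b M = act_b N * f \<and>
     f * act_c M = act_c N * f \<and> f * act_d M = act_d N * f}"

definition D4_iso :: "'k::field rep \<Rightarrow> 'k rep \<Rightarrow> bool" (infix \<open>\<cong>\<^sub>D\<close> 50) where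
  "M \<cong>\<^sub>D N \<longleftrightarrow> (\<exists>f \<in> D4_hom M N. invertible_mat f)"

definition D4_surj :: "'k::field rep \<Rightarrow> 'k rep \<Rightarrow> 'k mat set" where
  "D4_surj M N = {f \<in> D4_hom M N. (*\<^sub>v) f ` space M = space N}"

definition D4_inj :: "'k::field rep \<Rightarrow> 'k rep \<Rightarrow> 'k mat set" where
  "D4_inj M N = {f \<in> D4_hom M N. inj_on ((*\<^sub>v) f) (space M)}"

subsection \<open>Direct sums and tensor products\<close>

definition dsum :: "'k::field rep \<Rightarrow> 'k rep \<Rightarrow> 'k rep" (infixr \<open>\<oplus>\<^sub>D\<close> 65) where
  "M \<oplus>\<^sub>D N =
     \<lparr> mdim = mdim M + mdim N,
       act_a = diag_block_mat [act_a M, act_a N],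
       act_b = diag_block_mat [act_b M, act_b N],
       act_c = diag_block_mat [act_c M, act_c N],
       act_d = diag_block_mat [act_d M, act_d N] \<rparr>"

definition zero_rep :: "'k::field rep" where
  "zero_rep =
     \<lparr> mdim = 0, act_a = 0\<^sub>m 0 0, act_b = 0\<^sub>m 0 0, act_c = 0\<^sub>m 0 0, act_d = 0\<^sub>m 0 0 \<rparr>"

fun copies :: "nat \<Rightarrow> 'k::field rep \<Rightarrow> 'k rep" where
  "copies 0 M = zero_rep"
| "copies (Suc n) M = M \<oplus>\<^sub>D copies n M"

text \<open>The Kronecker product is the matrix of the tensor product of two linear maps with
  respect to the basis \<open>e\<^sub>i \<otimes> f\<^sub>j\<close>, ordered lexicographically.\<close>

definition kronecker :: "'k::field mat \<Rightarrow> 'k mat \<Rightarrow> 'k mat" (infixl \<open>\<otimes>\<^sub>K\<close> 70) where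
  "A \<otimes>\<^sub>K B = mat (dim_row A * dim_row B) (dim_col A * dim_col B)
     (\<lambda>(i, j). A $$ (i div dim_row B, j div dim_col B) * B $$ (i mod dim_row B, j mod dim_col B))"

text \<open>The action on \<open>M \<otimes> N\<close> is through the comultiplication
  \<open>\<Delta>(a) = a \<otimes> b + 1 \<otimes> a\<close>, \<open>\<Delta>(b) = b \<otimes> b\<close>, \<open>\<Delta>(c) = c \<otimes> c\<close>,
  \<open>\<Delta>(d) = d \<otimes> c + 1 \<otimes> d\<close>.\<close>

definition tensor :: "'k::field rep \<Rightarrow> 'k rep \<Rightarrow> 'k rep" (infixl \<open>\<otimes>\<^sub>D\<close> 70) where
  "M \<otimes>\<^sub>D N =
     \<lparr> mdim = mdim M * mdim N,
       act_a = act_a M \<otimes>\<^sub>K act_b N + 1\<^sub>m (mdim M) \<otimes>\<^sub>K act_a N,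
       act_b = act_b M \<otimes>\<^sub>K act_b N,
       act_c = act_c M \<otimes>\<^sub>K act_c N,
       act_d = act_d M \<otimes>\<^sub>K act_c N + 1\<^sub>m (mdim M) \<otimes>\<^sub>K act_d N \<rparr>"

subsection \<open>Submodules, quotients, length\<close>

definition D4_submodule :: "'k::field rep \<Rightarrow> 'k vec set \<Rightarrow> bool" where
  "D4_submodule M W \<longleftrightarrow>
     subspace class_ring W (module_vec TYPE('k) (mdim M)) \<and>
     (\<forall>w\<in>W. act_a M *\<^sub>v w \<in> W \<and> act_b M *\<^sub>v w \<in> W \<and> act_c M *\<^sub>v w \<in> W \<and> act_d M *\<^sub>v w \<in> W)"

abbreviation zero_sub :: "'k::field rep \<Rightarrow> 'k vec set" where
  "zero_sub M \<equiv> {0\<^sub>v (mdim M)}"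

text \<open>The module \<open>N\<close> is isomorphic to the submodule \<open>W\<close> of \<open>M\<close>, respectively to the
  quotient of \<open>M\<close> by \<open>W\<close>.\<close>

definition is_submodule_rep :: "'k::field rep \<Rightarrow> 'k vec set \<Rightarrow> 'k rep \<Rightarrow> bool" where
  "is_submodule_rep M W N \<longleftrightarrow> D4_module N \<and> (\<exists>i \<in> D4_inj N M. (*\<^sub>v) i ` space N = W)"

definition is_quotient_rep :: "'k::field rep \<Rightarrow> 'k vec set \<Rightarrow> 'k rep \<Rightarrow> bool" where
  "is_quotient_rep M W N \<longleftrightarrow> D4_module N \<and> (\<exists>p \<in> D4_surj M N. mat_kernel p = W)"

definition maximal_in :: "'k::field rep \<Rightarrow> 'k vec set \<Rightarrow> 'k vec set \<Rightarrow> bool" where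
  "maximal_in M U W \<longleftrightarrow> D4_submodule M U \<and> D4_submodule M W \<and> U \<subset> W \<and>
     (\<forall>X. D4_submodule M X \<longrightarrow> U \<subseteq> X \<longrightarrow> X \<subseteq> W \<longrightarrow> X = U \<or> X = W)"

definition simple_submodule :: "'k::field rep \<Rightarrow> 'k vec set \<Rightarrow> bool" where
  "simple_submodule M W \<longleftrightarrow> maximal_in M (zero_sub M) W"

text \<open>\<open>M\<close> has a composition series with \<open>n\<close> factors; by the Jordan--Hoelder theorem \<open>n\<close> is
  determined by \<open>M\<close>.\<close>

definition has_length :: "'k::field rep \<Rightarrow> nat \<Rightarrow> bool" where
  "has_length M n \<longleftrightarrow>
     (\<exists>W. W 0 = zero_sub M \<and> W n = space M \<and> (\<forall>i<n. maximal_in M (W i) (W (Suc i))))"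

text \<open>The sum of all simple submodules, as the least submodule containing them.\<close>

definition soc :: "'k::field rep \<Rightarrow> 'k vec set" where
  "soc M = \<Inter>{W. D4_submodule M W \<and> (\<forall>S. simple_submodule M S \<longrightarrow> S \<subseteq> W)}"

definition rad :: "'k::field rep \<Rightarrow> 'k vec set \<Rightarrow> 'k vec set" where
  "rad M W = W \<inter> \<Inter>{U. maximal_in M U W}"

definition Loewy_length :: "'k::field rep \<Rightarrow> nat" where
  "Loewy_length M = (LEAST n. (rad M ^^ n) (space M) = zero_sub M)"

definition indecomposable :: "'k::field rep \<Rightarrow> bool" where
  "indecomposable M \<longleftrightarrow> D4_module M \<and> mdim M \<noteq> 0 \<and>
     (\<forall>N N'. D4_module N \<longrightarrow> D4_module N' \<longrightarrow> M \<cong>\<^sub>D N \<oplus>\<^sub>D N' \<longrightarrow> mdim N = 0 \<or> mdim N' = 0)"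

definition has_type :: "'k::field rep \<Rightarrow> nat \<Rightarrow> nat \<Rightarrow> bool" where
  "has_type M s t \<longleftrightarrow> indecomposable M \<and> Loewy_length M = 2 \<and>
     (\<exists>Q. is_quotient_rep M (soc M) Q \<and> has_length Q s) \<and>
     (\<exists>S. is_submodule_rep M (soc M) S \<and> has_length S t)"

subsection \<open>Projective covers and syzygies\<close>

definition D4_projective :: "'k::field rep \<Rightarrow> bool" where
  "D4_projective P \<longleftrightarrow> D4_module P \<and>
     (\<forall>X Y. \<forall>g \<in> D4_surj X Y. \<forall>f \<in> D4_hom P Y. D4_module X \<longrightarrow> D4_module Y \<longrightarrow>
        (\<exists>h \<in> D4_hom P X. g * h = f))"

definition superfluous :: "'k::field rep \<Rightarrow> 'k vec set \<Rightarrow> bool" where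
  "superfluous M K \<longleftrightarrow>
     (\<forall>U. D4_submodule M U \<longrightarrow> {u + v | u v. u \<in> U \<and> v \<in> K} = space M \<longrightarrow> U = space M)"

definition projective_cover :: "'k::field rep \<Rightarrow> 'k mat \<Rightarrow> 'k rep \<Rightarrow> bool" where
  "projective_cover P f M \<longleftrightarrow>
     D4_projective P \<and> D4_module M \<and> f \<in> D4_surj P M \<and> superfluous P (mat_kernel f)"

text \<open>The iterated syzygy \<open>\<Omega>\<^sup>s M\<close> is determined up to isomorphism only;
  \<open>is_Omega s M N\<close> states that \<open>N\<close> is a representative of it.\<close>

inductive is_Omega :: "nat \<Rightarrow> 'k::field rep \<Rightarrow> 'k rep \<Rightarrow> bool" where
  zero: "D4_module M \<Longrightarrow> D4_module N \<Longrightarrow> M \<cong>\<^sub>D N \<Longrightarrow> is_Omega 0 M N"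
| Suc: "is_Omega s M N \<Longrightarrow> projective_cover P f N \<Longrightarrow> is_submodule_rep P (mat_kernel f) K
        \<Longrightarrow> is_Omega (Suc s) M K"

subsection \<open>The modules of the theorem\<close>

definition sgn2 :: "bit \<Rightarrow> 'k::field" where
  "sgn2 r = (if r = 0 then 1 else - 1)"

definition V :: "bit \<Rightarrow> 'k::field rep" where
  "V r = \<lparr> mdim = 1, act_a = 0\<^sub>m 1 1, act_b = sgn2 r \<cdot>\<^sub>m 1\<^sub>m 1, act_c = sgn2 r \<cdot>\<^sub>m 1\<^sub>m 1,
           act_d = 0\<^sub>m 1 1 \<rparr>"

definition is_P :: "bit \<Rightarrow> 'k::field rep \<Rightarrow> bool" where
  "is_P r P \<longleftrightarrow> (\<exists>f. projective_cover P f (V r))"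

datatype 'k P1 = Fin 'k | Infty

text \<open>The columns are the images of the basis vectors \<open>v\<^sub>1\<close>, \<open>v\<^sub>2\<close>.\<close>

definition M1 :: "bit \<Rightarrow> 'k::field P1 \<Rightarrow> 'k rep" where
  "M1 r \<eta> =
     (let g = mat_of_rows_list 2 [[sgn2 (r + 1), 0], [0, sgn2 r]] in
      \<lparr> mdim = 2,
        act_a = mat_of_rows_list 2 [[0, 0], [case \<eta> of Fin x \<Rightarrow> 1 | Infty \<Rightarrow> 0, 0]],
        act_b = g,
        act_c = g,
        act_d = mat_of_rows_list 2 [[0, 0], [case \<eta> of Fin x \<Rightarrow> - x | Infty \<Rightarrow> 1, 0]] \<rparr>)"

text \<open>\<open>M\<close> is a representative of the isomorphism class \<open>M\<^sub>s(r,\<eta>)\<close>.\<close>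

definition is_Ms :: "nat \<Rightarrow> bit \<Rightarrow> 'k::field P1 \<Rightarrow> 'k rep \<Rightarrow> bool" where
  "is_Ms s r \<eta> M \<longleftrightarrow>
     has_type M s s \<and> (\<exists>W. D4_submodule M W \<and> is_submodule_rep M W (M1 r \<eta>))"

end

theory Submission
  imports Defs "HOL-Library.Function_Algebras"
begin

text \<open>Since \<open>X\<close> is determined up to isomorphism by a minimal projective resolution, it may be replaced by
  an explicit model with top \<open>x\<^sub>0, \<dots>, x\<^sub>s\<close> and socle \<open>y\<^sub>1, \<dots>, y\<^sub>s\<close>, \<open>a x\<^sub>i = y\<^sub>i\<close>, \<open>d x\<^sub>i = y\<^sub>i\<^sub>+\<^sub>1\<close>.
  The module \<open>M\<close> is, on a top \<open>U\<close> and a socle \<open>W\<close>, the pencil \<open>(a, d)\<close> of maps \<open>U \<rightarrow> W\<close>; indecomposability and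
  the presence of \<open>M\<^sub>1(r, \<eta>)\<close> force it, for finite \<open>\<eta>\<close>, to be a single Jordan block: \<open>a\<close> identifies \<open>U\<close> with \<open>W\<close>
  and \<open>d\<close> becomes an operator \<open>J\<close> on \<open>U\<close> with eigenvalue \<open>-\<eta>\<close>.  This proves uniqueness of \<open>M\<^sub>t(r, \<eta>)\<close>.

  In \<open>M \<otimes> X\<close> the vectors \<open>u \<otimes> x\<^sub>i\<close> with \<open>i < s\<close> generate a free summand, and the elements
  \<open>\<Sum>\<^sub>j J\<^sup>s\<^sup>-\<^sup>j u \<otimes> x\<^sub>j\<close>, which are killed by \<open>a d\<close>, generate a copy of the pencil \<open>(1, J)\<close> again; a dimension count
  shows that nothing else is left.  The point \<open>\<eta> = \<infinity>\<close> follows from \<open>\<eta> = 0\<close> by the symmetry exchanging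
  \<open>a, b\<close> with \<open>d, c\<close>.\<close>

section \<open>Linear algebra of finitely supported functions\<close>

text \<open>The element (1 + b c)/2 is a central idempotent that fixes the generator of M_1(r,
  \<eta>), so an indecomposable M lies in the block b c = 1. There a and d anticommute, b = c acts
  as a grading, and simple factors are one-dimensional: lengths become dimensions.

  The Jordan block is found without a normal form. With B = d + \<eta> a, a longest string B u_0 =
  0, B u_(i+1) = a u_i is split off by means of a functional that witnesses that it cannot be
  prolonged. The obstacle is a string that stops because a kills its last element: a shortest such
  string would be a summand of odd dimension, whereas top and socle of equal length make dim M even.

  Weights (the common eigenvalue of b and c) explain the dependence on the parity of s. The top of M
  has weight (-1)^(r+1); that of X has weight (-1)^(r'+s), since each syzygy changes the sign; u
  \<otimes> x_i has the product of both. In the second family of elements of M \<otimes> X the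
  exponent s - j makes up for the fact that d leads from x_j to y_(j+1) while a leads from x_j to
  y_j.\<close>

text \<open>Vectors of length \<open>n\<close> are represented by functions on \<open>nat\<close> that vanish from \<open>n\<close> on; unlike the
  elements of \<^typ>\<open>'a vec\<close>, those of all lengths form one vector space.\<close>

definition sm :: "'k::field \<Rightarrow> ('i \<Rightarrow> 'k) \<Rightarrow> 'i \<Rightarrow> 'k" (infixr \<open>\<odot>\<close> 75) where
  "c \<odot> f = (\<lambda>i. c * f i)"

lemma sm_apply [simp]: "(c \<odot> f) i = c * f i"
  by (simp add: sm_def)

lemma sum_fun_apply [simp]: "(\<Sum>i\<in>I. F i) x = (\<Sum>i\<in>I. F i x :: 'k::comm_monoid_add)"
  by (induction I rule: infinite_finite_induct) auto

interpretation fv: vector_space "sm :: 'k::field \<Rightarrow> ('i \<Rightarrow> 'k) \<Rightarrow> 'i \<Rightarrow> 'k"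
  by unfold_locales (auto simp: fun_eq_iff algebra_simps)

interpretation fvp: vector_space_pair "sm :: 'k::field \<Rightarrow> ('i \<Rightarrow> 'k) \<Rightarrow> 'i \<Rightarrow> 'k"
    "sm :: 'k::field \<Rightarrow> ('j \<Rightarrow> 'k) \<Rightarrow> 'j \<Rightarrow> 'k"
  by unfold_locales

definition lin :: "(('i \<Rightarrow> 'k::field) \<Rightarrow> 'j \<Rightarrow> 'k) \<Rightarrow> bool" where
  "lin h \<longleftrightarrow> (\<forall>f g. h (f + g) = h f + h g) \<and> (\<forall>c f. h (c \<odot> f) = c \<odot> h f)"

lemma lin_iff_linear: "lin h \<longleftrightarrow> Vector_Spaces.linear sm sm h"
  by (auto simp: lin_def Vector_Spaces.linear_iff fv.vector_space_axioms)

lemma linI: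
  assumes "\<And>f g i. h (f + g) i = h f i + h g i" "\<And>c f i. h (c \<odot> f) i = c * h f i"
  shows "lin h"
  using assms by (auto simp: lin_def fun_eq_iff)

lemma lin_add: "lin h \<Longrightarrow> h (f + g) = h f + h g"
  and lin_sm: "lin h \<Longrightarrow> h (c \<odot> f) = c \<odot> h f"
  by (auto simp: lin_def)

lemma lin_zero: "lin h \<Longrightarrow> h 0 = 0"
  by (metis fv.scale_zero_left lin_sm)

lemma lin_minus: "lin h \<Longrightarrow> h (- f) = - h f"
  using lin_sm[of h "-1" f] by simp

lemma lin_diff: "lin h \<Longrightarrow> h (f - g) = h f - h g"
  using lin_add[of h f "- g"] by (simp add: lin_minus fun_eq_iff)

lemma lin_sum: "lin h \<Longrightarrow> h (\<Sum>i\<in>I. F i) = (\<Sum>i\<in>I. h (F i))"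
  by (induction I rule: infinite_finite_induct) (auto simp: lin_zero lin_add)

lemmas lin_simps = lin_add lin_sm lin_zero lin_minus lin_diff lin_sum

lemma lin_comp: "lin g \<Longrightarrow> lin h \<Longrightarrow> lin (\<lambda>f. g (h f))"
  by (auto simp: lin_def)

lemma lin_plus: "lin g \<Longrightarrow> lin h \<Longrightarrow> lin (\<lambda>f. g f + h f)"
  by (auto simp: lin_def fun_eq_iff algebra_simps)

lemma lin_minus_fun: "lin g \<Longrightarrow> lin h \<Longrightarrow> lin (\<lambda>f. g f - h f)"
  by (auto simp: lin_def fun_eq_iff algebra_simps)

lemma lin_sm_fun: "lin h \<Longrightarrow> lin (\<lambda>f. c \<odot> h f)"
  by (auto simp: lin_def fun_eq_iff algebra_simps)

lemma lin_sum_fun: "(\<And>i. i \<in> I \<Longrightarrow> lin (H i)) \<Longrightarrow> lin (\<lambda>f. \<Sum>i\<in>I. H i f)"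
  by (auto simp: lin_def fun_eq_iff sum.distrib sum_distrib_left)

lemma lin_id: "lin (\<lambda>f. f)"
  by (auto simp: lin_def)

lemma lin_zero_fun: "lin (\<lambda>f. 0)"
  by (auto simp: lin_def fun_eq_iff)

lemma lin_reindex: "lin (\<lambda>f i. if P i then f (g i) else 0)"
  by (auto simp: lin_def fun_eq_iff)

lemma lin_funpow: "lin h \<Longrightarrow> lin (h ^^ n)" for h :: "('i \<Rightarrow> 'k::field) \<Rightarrow> 'i \<Rightarrow> 'k"
  by (induction n) (auto simp: lin_def)

lemma lin_combination: "lin (\<lambda>f. \<Sum>j\<in>I. f j \<odot> v j)"
  by (intro linI) (auto simp: algebra_simps sum.distrib sum_distrib_left)

definition fsp :: "nat \<Rightarrow> (nat \<Rightarrow> 'k::zero) set" where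
  "fsp n = {f. \<forall>i\<ge>n. f i = 0}"

definition unit :: "nat \<Rightarrow> nat \<Rightarrow> 'k::field" where
  "unit j = (\<lambda>i. if i = j then 1 else 0)"

lemma unit_fsp [simp]: "j < n \<Longrightarrow> unit j \<in> fsp n"
  by (auto simp: unit_def fsp_def)

lemma subspace_fsp: "fv.subspace (fsp n)"
  by (auto simp: fv.subspace_def fsp_def)

lemma fsp_closed [simp]:
  "0 \<in> fsp n" "f \<in> fsp n \<Longrightarrow> g \<in> fsp n \<Longrightarrow> f + g \<in> fsp n"
  "f \<in> fsp n \<Longrightarrow> g \<in> fsp n \<Longrightarrow> f - g \<in> fsp n"
  "f \<in> fsp n \<Longrightarrow> c \<odot> f \<in> fsp n" "f \<in> fsp n \<Longrightarrow> - f \<in> fsp n"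
  for f :: "nat \<Rightarrow> 'k::field"
  by (auto simp: fsp_def)

lemma fsp_sum: "(\<And>i. i \<in> I \<Longrightarrow> F i \<in> fsp n) \<Longrightarrow> (\<Sum>i\<in>I. F i) \<in> fsp n" for F :: "'i \<Rightarrow> nat \<Rightarrow> 'k::field"
  by (auto simp: fsp_def)

lemma fsp_expand: "f \<in> fsp n \<Longrightarrow> f = (\<Sum>j<n. f j \<odot> unit j)"
  by (rule ext) (auto simp: fsp_def unit_def not_less if_distrib[of "\<lambda>x. _ * x"] cong: if_cong)

lemma lin_expand: "lin h \<Longrightarrow> f \<in> fsp n \<Longrightarrow> h f = (\<Sum>j<n. f j \<odot> h (unit j))"
  by (subst (1) fsp_expand[of f n]) (simp_all only: lin_sum lin_sm)

lemma combination_unit: "j < n \<Longrightarrow> (\<Sum>i<n. unit j i \<odot> v i) = (v j :: 'i \<Rightarrow> 'k::field)"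
proof -
  assume "j < n"
  then have "(\<Sum>i<n. unit j i \<odot> v i) = (\<Sum>i<n. if i = j then v j else 0)"
    by (intro sum.cong) (auto simp: unit_def fun_eq_iff)
  then show ?thesis using \<open>j < n\<close> by simp
qed

section \<open>Matrices as operators on functions\<close>

definition ap :: "'k::field mat \<Rightarrow> (nat \<Rightarrow> 'k) \<Rightarrow> nat \<Rightarrow> 'k" where
  "ap A f = (\<lambda>i. if i < dim_row A then \<Sum>j<dim_col A. A $$ (i, j) * f j else 0)"

lemma lin_ap: "lin (ap A)"
  by (intro linI) (auto simp: ap_def algebra_simps sum.distrib sum_distrib_left)

lemmas ap_simps = lin_simps[OF lin_ap]

lemma ap_fsp: "A \<in> carrier_mat n m \<Longrightarrow> ap A f \<in> fsp n"
  by (auto simp: ap_def fsp_def)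

lemma ap_mult: "A \<in> carrier_mat n m \<Longrightarrow> B \<in> carrier_mat m k \<Longrightarrow> ap (A * B) f = ap A (ap B f)"
proof
  fix i assume A: "A \<in> carrier_mat n m" and B: "B \<in> carrier_mat m k"
  have "(\<Sum>j<k. (\<Sum>l<m. A $$ (i, l) * B $$ (l, j)) * f j)
      = (\<Sum>l<m. A $$ (i, l) * (\<Sum>j<k. B $$ (l, j) * f j))"
    unfolding sum_distrib_left sum_distrib_right by (subst sum.swap) (simp add: mult.assoc)
  then show "ap (A * B) f i = ap A (ap B f) i"
    using A B by (auto simp: ap_def scalar_prod_def atLeast0LessThan)
qed

lemma ap_plus: "A \<in> carrier_mat n m \<Longrightarrow> B \<in> carrier_mat n m \<Longrightarrow> ap (A + B) f = ap A f + ap B f"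
  by (auto simp: ap_def fun_eq_iff algebra_simps sum.distrib)

lemma ap_minus: "A \<in> carrier_mat n m \<Longrightarrow> B \<in> carrier_mat n m \<Longrightarrow> ap (A - B) f = ap A f - ap B f"
  by (auto simp: ap_def fun_eq_iff algebra_simps sum_subtractf)

lemma ap_uminus: "ap (- A) f = - ap A f"
  by (auto simp: ap_def fun_eq_iff sum_negf)

lemma ap_one: "f \<in> fsp n \<Longrightarrow> ap (1\<^sub>m n) f = f"
  by (auto simp: ap_def fun_eq_iff fsp_def if_distrib[of "\<lambda>x. x * _"] cong: if_cong)

lemma ap_zero: "ap (0\<^sub>m n m) f = 0"
  by (auto simp: ap_def fun_eq_iff)

lemma ap_unit: "j < dim_col A \<Longrightarrow> ap A (unit j) i = (if i < dim_row A then A $$ (i, j) else 0)"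
  by (auto simp: ap_def unit_def if_distrib[of "\<lambda>x. _ * x"] cong: if_cong)

lemma mat_eq_ap:
  assumes "A \<in> carrier_mat n m" "B \<in> carrier_mat n m" "\<And>f. f \<in> fsp m \<Longrightarrow> ap A f = ap B f"
  shows "A = B"
proof (rule eq_matI)
  fix i j assume ij: "i < dim_row B" "j < dim_col B"
  then have "ap A (unit j) i = ap B (unit j) i" using assms by auto
  then show "A $$ (i, j) = B $$ (i, j)" using ij assms(1,2) by (auto simp: ap_unit)
qed (use assms in auto)

text \<open>The way back from linear maps to matrices: homomorphisms are handled as functions and
  turned into matrices only where \<open>D4_hom\<close> demands it.\<close>

definition mof :: "nat \<Rightarrow> nat \<Rightarrow> ((nat \<Rightarrow> 'k::field) \<Rightarrow> nat \<Rightarrow> 'k) \<Rightarrow> 'k mat" where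
  "mof n m h = mat n m (\<lambda>(i, j). h (unit j) i)"

lemma mof_carrier [simp]: "mof n m h \<in> carrier_mat n m"
  by (simp add: mof_def)

lemma ap_mof:
  assumes "lin h" "\<And>f. f \<in> fsp m \<Longrightarrow> h f \<in> fsp n" "f \<in> fsp m"
  shows "ap (mof n m h) f = h f"
proof
  fix i
  show "ap (mof n m h) f i = h f i"
  proof (cases "i < n")
    case True
    then show ?thesis
      unfolding lin_expand[OF assms(1,3)] by (simp add: ap_def mof_def mult.commute)
  next
    case False
    then show ?thesis using assms(2)[OF assms(3)] by (auto simp: ap_def mof_def fsp_def)
  qed
qed

section \<open>Translation between \<open>vec\<close> and functions\<close>

definition toF :: "'k::zero vec \<Rightarrow> nat \<Rightarrow> 'k" where
  "toF v = (\<lambda>i. if i < dim_vec v then v $ i else 0)"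

lemma toF_fsp: "v \<in> carrier_vec n \<Longrightarrow> toF v \<in> fsp n"
  by (auto simp: toF_def fsp_def)

lemma toF_vec: "f \<in> fsp n \<Longrightarrow> toF (vec n f) = f"
  by (auto simp: toF_def fsp_def fun_eq_iff)

lemma vec_toF: "v \<in> carrier_vec n \<Longrightarrow> vec n (toF v) = v"
  by (auto simp: toF_def)

lemma toF_inj: "v \<in> carrier_vec n \<Longrightarrow> w \<in> carrier_vec n \<Longrightarrow> toF v = toF w \<longleftrightarrow> v = w"
  by (metis vec_toF)

lemma toF_image: "toF ` carrier_vec n = fsp n"
proof
  show "fsp n \<subseteq> toF ` carrier_vec n"
  proof
    fix f assume "f \<in> fsp n"
    then show "f \<in> toF ` carrier_vec n" by (intro image_eqI[of _ _ "vec n f"]) (auto simp: toF_vec)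
  qed
qed (auto simp: toF_fsp)

lemma toF_mult: "A \<in> carrier_mat n m \<Longrightarrow> v \<in> carrier_vec m \<Longrightarrow> toF (A *\<^sub>v v) = ap A (toF v)"
  by (auto simp: toF_def ap_def fun_eq_iff scalar_prod_def atLeast0LessThan)

lemma toF_add: "v \<in> carrier_vec n \<Longrightarrow> w \<in> carrier_vec n \<Longrightarrow> toF (v + w) = toF v + toF w"
  for v :: "'k::field vec"
  by (auto simp: toF_def fun_eq_iff)

lemma toF_smult: "toF (c \<cdot>\<^sub>v v) = c \<odot> toF v"
  by (auto simp: toF_def fun_eq_iff)

lemma toF_zero: "toF (0\<^sub>v n) = (0 :: nat \<Rightarrow> 'k::field)"
  by (auto simp: toF_def fun_eq_iff)

section \<open>Dimension arguments, functionals and bases\<close>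

lemma fsp_span: "(fsp n :: (nat \<Rightarrow> 'k::field) set) = fv.span (unit ` {..<n})"
proof
  show "(fsp n :: (nat \<Rightarrow> 'k) set) \<subseteq> fv.span (unit ` {..<n})"
  proof
    fix f :: "nat \<Rightarrow> 'k" assume "f \<in> fsp n"
    moreover have "(\<Sum>j<n. f j \<odot> unit j) \<in> fv.span (unit ` {..<n})"
      by (intro fv.span_sum fv.span_scale fv.span_base) auto
    ultimately show "f \<in> fv.span (unit ` {..<n})"
      by (simp only: fsp_expand[symmetric])
  qed
  show "fv.span (unit ` {..<n}) \<subseteq> (fsp n :: (nat \<Rightarrow> 'k) set)"
    by (rule fv.span_minimal[OF _ subspace_fsp]) auto
qed

lemma inj_unit: "inj_on (unit :: nat \<Rightarrow> nat \<Rightarrow> 'k::field) S"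
  by (auto simp: inj_on_def unit_def fun_eq_iff)

lemma independent_units: "fv.independent ((unit :: nat \<Rightarrow> nat \<Rightarrow> 'k::field) ` {..<n})"
proof (rule fv.independent_if_scalars_zero)
  fix c :: "(nat \<Rightarrow> 'k) \<Rightarrow> 'k" and x :: "nat \<Rightarrow> 'k"
  assume 0: "(\<Sum>x\<in>unit ` {..<n}. c x \<odot> x) = 0" and x: "x \<in> unit ` {..<n}"
  then obtain j where j: "j < n" "x = unit j" by auto
  have "0 = (\<Sum>i<n. c (unit i) \<odot> unit i) j"
    using 0 by (simp add: sum.reindex[OF inj_unit] zero_fun_def)
  also have "\<dots> = c (unit j)"
    using j by (auto simp: unit_def if_distrib[of "\<lambda>x. _ * x"] cong: if_cong)
  finally show "c x = 0" using j by simp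
qed auto

text \<open>The images of m unit vectors stay independent and lie in the span of n vectors.\<close>

lemma lin_inj_dim:
  assumes "lin h" "inj_on h (fsp m)" "\<And>f. f \<in> fsp m \<Longrightarrow> h f \<in> fsp n"
  shows "m \<le> n"
proof -
  let ?S = "unit ` {..<m} :: (nat \<Rightarrow> 'a) set"
  have inj: "inj_on h (fv.span ?S)" using assms(2) by (simp add: fsp_span)
  have ind: "fv.independent (h ` ?S)"
    using fvp.linear_independent_injective_image[OF _ independent_units inj] assms(1)
    by (simp add: lin_iff_linear)
  have "h ` ?S \<subseteq> fv.span (unit ` {..<n})"
    using assms(3) by (simp add: image_subset_iff flip: fsp_span)
  then have "card (h ` ?S) \<le> card ((unit :: nat \<Rightarrow> nat \<Rightarrow> 'a) ` {..<n})"
    by (intro fv.independent_span_bound[OF _ ind, THEN conjunct2]) auto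
  moreover have "card (h ` ?S) = m"
    using inj_on_subset[OF inj fv.span_superset] by (simp add: card_image inj_unit)
  ultimately show ?thesis by (simp add: card_image inj_unit)
qed

lemma lin_inj_onI:
  assumes "lin h" "\<And>f. f \<in> fsp m \<Longrightarrow> h f = 0 \<Longrightarrow> f = 0"
  shows "inj_on h (fsp m)"
proof (rule inj_onI)
  fix f g assume "f \<in> fsp m" "g \<in> fsp m" "h f = h g"
  then have "f - g = 0" using assms(2)[of "f - g"] by (simp add: lin_diff[OF assms(1)])
  then show "f = g" by simp
qed

text \<open>One step of basis extension: a vector outside the image becomes the image of a new last
  coordinate. It serves for endomorphisms, for the growth of bases and for composition
  series.\<close>

lemma inj_extend:
  assumes h: "lin h" "inj_on h (fsp m)" and y: "y \<notin> h ` fsp m"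
  obtains g where "lin g" "inj_on g (fsp (Suc m))" "\<And>f. \<exists>x\<in>fsp m. \<exists>c. g f = h x + c \<odot> y"
    "\<And>x c. x \<in> fsp m \<Longrightarrow> h x + c \<odot> y \<in> g ` fsp (Suc m)"
proof
  define T where "T f = (\<lambda>i. if i < m then f i else 0)" for f :: "nat \<Rightarrow> 'a"
  have T: "T f \<in> fsp m" for f by (auto simp: fsp_def T_def)
  \<comment> \<open>The one-term sum has the form to which \<open>lin_combination\<close>
    applies.\<close>
  define g where "g f = h (T f) + (\<Sum>j\<in>{m}. f j \<odot> y)" for f
  show g: "lin g"
    unfolding g_def T_def by (intro lin_plus lin_comp[OF h(1)] lin_reindex lin_combination)
  show "\<exists>x\<in>fsp m. \<exists>c. g f = h x + c \<odot> y" for f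
    using T by (auto simp: g_def)
  show "h x + c \<odot> y \<in> g ` fsp (Suc m)" if "x \<in> fsp m" for x c
  proof (rule image_eqI)
    let ?f = "\<lambda>i. if i < m then x i else if i = m then c else 0"
    have "T ?f = x" using that by (auto simp: T_def fsp_def fun_eq_iff)
    then show "h x + c \<odot> y = g ?f" by (simp add: g_def)
    show "?f \<in> fsp (Suc m)" by (auto simp: fsp_def)
  qed
  show "inj_on g (fsp (Suc m))"
  proof (rule lin_inj_onI[OF g])
    fix f assume f: "f \<in> fsp (Suc m)" "g f = 0"
    have fm: "f m = 0"
    proof (rule ccontr)
      assume "f m \<noteq> 0"
      have "h (T f) = - (f m \<odot> y)" using f(2) by (simp add: g_def add_eq_0_iff)
      then have "h (inverse (- f m) \<odot> T f) = inverse (- f m) \<odot> - (f m \<odot> y)"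
        by (simp only: lin_sm[OF h(1)])
      also have "\<dots> = y" using \<open>f m \<noteq> 0\<close> by (auto simp: fun_eq_iff)
      finally show False using y T by (metis fsp_closed(4) image_eqI)
    qed
    then have "h (T f) = h 0"
      using f(2) by (simp add: g_def lin_zero[OF h(1)])
    then have "T f = 0"
      using h(2) T by (meson fsp_closed(1) inj_onD)
    then show "f = 0" using fm f(1) by (auto simp: fun_eq_iff fsp_def T_def) (metis Suc_leI nat_neq_iff)
  qed
qed

text \<open>A missed vector would extend \<open>h\<close> to an injection from dimension n + 1 into
  dimension n.\<close>

lemma lin_inj_surj:
  assumes h: "lin h" "inj_on h (fsp n)" "\<And>f. f \<in> fsp n \<Longrightarrow> h f \<in> fsp n"
  shows "h ` fsp n = fsp n"
proof (rule ccontr)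
  assume "h ` fsp n \<noteq> fsp n"
  then obtain y where y: "y \<in> fsp n" "y \<notin> h ` fsp n" using h(3) by auto
  obtain g where g: "lin g" "inj_on g (fsp (Suc n))" "\<And>f. \<exists>x\<in>fsp n. \<exists>c. g f = h x + c \<odot> y"
    by (rule inj_extend[OF h(1,2) y(2)]) (rule that)
  have "g f \<in> fsp n" for f using g(3)[of f] h(3) y(1) by auto
  then show False using lin_inj_dim[OF g(1,2), of n] by auto
qed

lemma lin_surj_section:
  assumes "lin h" "h ` fsp m = fsp n"
  obtains g where "lin g" "\<And>f. g f \<in> fsp m" "\<And>f. f \<in> fsp n \<Longrightarrow> h (g f) = f"
proof -
  have "\<forall>j. \<exists>x. j < n \<longrightarrow> x \<in> fsp m \<and> h x = unit j"
    using assms(2) by (metis (no_types) imageE unit_fsp)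
  then obtain p where p: "\<And>j. j < n \<Longrightarrow> p j \<in> fsp m \<and> h (p j) = unit j" by metis
  show thesis
  proof
    show "lin (\<lambda>f. \<Sum>j<n. f j \<odot> p j)" by (rule lin_combination)
    show "(\<Sum>j<n. f j \<odot> p j) \<in> fsp m" for f using p by (auto intro!: fsp_sum)
    show "h (\<Sum>j<n. f j \<odot> p j) = f" if "f \<in> fsp n" for f
      using p fsp_expand[OF that] by (simp add: lin_simps[OF assms(1)])
  qed
qed

lemma lin_surj_inj:
  assumes h: "lin h" "h ` fsp n = fsp n"
  shows "inj_on h (fsp n)"
proof -
  obtain g where g: "lin g" "\<And>f. g f \<in> fsp n" "\<And>f. f \<in> fsp n \<Longrightarrow> h (g f) = f"
    using lin_surj_section[OF h] by blast
  have "inj_on g (fsp n)" by (rule inj_onI) (metis g(3))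
  then have "g ` fsp n = fsp n" using lin_inj_surj g by blast
  then show ?thesis by (intro inj_onI) (metis g(3) image_iff)
qed

lemma lin_surj_dim:
  assumes "lin h" "h ` fsp m = fsp n"
  shows "n \<le> m"
proof -
  obtain g where g: "lin g" "\<And>f. g f \<in> fsp m" "\<And>f. f \<in> fsp n \<Longrightarrow> h (g f) = f"
    using lin_surj_section[OF assms] by blast
  have "inj_on g (fsp n)" by (rule inj_onI) (metis g(3))
  then show ?thesis using lin_inj_dim g(1,2) by blast
qed

lemma functional_exists:
  fixes S :: "('i \<Rightarrow> 'k::field) set"
  assumes "fv.subspace S" "v \<notin> S"
  obtains f :: "('i \<Rightarrow> 'k) \<Rightarrow> 'k"
  where "\<And>x y. f (x + y) = f x + f y" "\<And>c x. f (c \<odot> x) = c * f x" "f v = 1" "\<And>x. x \<in> S \<Longrightarrow> f x = 0"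
proof -
  obtain B where B: "B \<subseteq> S" "fv.independent B" "S \<subseteq> fv.span B"
    using fv.maximal_independent_subset by blast
  have "fv.span B \<subseteq> S" using B(1) assms(1) by (rule fv.span_minimal)
  then have v: "v \<notin> fv.span B" using assms(2) by auto
  then have "fv.independent (insert v B)" using B(2) by (simp add: fv.independent_insertI)
  \<comment> \<open>Functions on the one-point type serve as the one-dimensional target, so that the
    extension theorem for pairs of function spaces yields a scalar functional.\<close>
  then obtain g :: "('i \<Rightarrow> 'k) \<Rightarrow> unit \<Rightarrow> 'k" where
    g: "Vector_Spaces.linear sm sm g" "\<And>x. x \<in> insert v B \<Longrightarrow> g x = (if x = v then \<lambda>_. 1 else 0)"
    using fvp.linear_independent_extend[of "insert v B" "\<lambda>x. if x = v then (\<lambda>_. 1) else 0"] by blast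
  have l: "lin g" using g(1) by (simp add: lin_iff_linear)
  have "g x = 0" if "x \<in> B" for x
    using g(2)[of x] that v fv.span_base by (auto split: if_splits)
  then have "B \<subseteq> {x. g x = 0}" by auto
  moreover have "fv.subspace {x. g x = 0}"
    using lin_simps[OF l] by (auto simp: fv.subspace_def)
  ultimately have "fv.span B \<subseteq> {x. g x = 0}" by (rule fv.span_minimal)
  then show thesis
    using B(3) g(2)[of v] by (intro that[of "\<lambda>x. g x ()"]) (auto simp: lin_simps[OF l])
qed

lemma projection_exists:
  fixes S :: "('i \<Rightarrow> 'k::field) set"
  assumes "fv.subspace S"
  obtains p where "lin p" "\<And>x. p x \<in> S" "\<And>x. x \<in> S \<Longrightarrow> p x = x"
proof -
  have "Vector_Spaces.linear (sm :: 'k \<Rightarrow> ('i \<Rightarrow> 'k) \<Rightarrow> 'i \<Rightarrow> 'k) sm (\<lambda>x. x)"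
    using lin_id lin_iff_linear by blast
  from fvp.linear_exists_left_inverse_on[OF this assms]
  show thesis using that by (auto simp: lin_iff_linear)
qed

lemma linear_dependence:
  fixes u :: "nat \<Rightarrow> nat \<Rightarrow> 'k::field"
  assumes "\<And>j. j < m \<Longrightarrow> u j \<in> fsp n" "n < m"
  obtains c where "c \<in> fsp m" "c \<noteq> 0" "(\<Sum>j<m. c j \<odot> u j) = 0"
proof -
  let ?h = "\<lambda>f. \<Sum>j<m. f j \<odot> u j"
  have "?h f \<in> fsp n" for f using assms(1) by (auto intro!: fsp_sum)
  then have "\<not> inj_on ?h (fsp m)"
    using lin_inj_dim[OF lin_combination[where I = "{..<m}" and v = u], of m n] assms(2) by auto
  then show thesis using lin_inj_onI[OF lin_combination[where I = "{..<m}" and v = u], of m] that by blast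
qed

text \<open>Take an injective map into S from a space of the largest possible dimension:
  \<open>lin_inj_dim\<close> bounds this dimension, and \<open>inj_extend\<close> would raise it if
  a vector of S were missed.\<close>

lemma basis_exists:
  fixes S :: "(nat \<Rightarrow> 'k::field) set"
  assumes "fv.subspace S" "S \<subseteq> fsp n"
  obtains m h where "lin h" "inj_on h (fsp m)" "h ` fsp m = S"
proof -
  define P where "P m \<longleftrightarrow> (\<exists>h. lin h \<and> inj_on h (fsp m) \<and> h ` fsp m \<subseteq> S)" for m
  have "P 0"
    unfolding P_def using assms(1)
    by (intro exI[of _ "\<lambda>_. 0"]) (auto simp: lin_zero_fun inj_on_def fsp_def fun_eq_iff fv.subspace_0)
  moreover have bound: "m \<le> n" if "P m" for m
    using that assms(2) lin_inj_dim unfolding P_def by blast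
  ultimately obtain m where m: "P m" "\<And>l. P l \<Longrightarrow> l \<le> m"
    using GreatestI_nat[of P 0 n] Greatest_le_nat[of P _ n] by blast
  obtain h where h: "lin h" "inj_on h (fsp m)" "h ` fsp m \<subseteq> S" using m(1) unfolding P_def by auto
  have "h ` fsp m = S"
  proof (rule ccontr)
    assume "h ` fsp m \<noteq> S"
    then obtain y where y: "y \<in> S" "y \<notin> h ` fsp m" using h(3) by auto
    obtain g where g: "lin g" "inj_on g (fsp (Suc m))" "\<And>f. \<exists>x\<in>fsp m. \<exists>c. g f = h x + c \<odot> y"
      by (rule inj_extend[OF h(1,2) y(2)]) (rule that)
    have "g f \<in> S" for f
      using g(3)[of f] h(3) y(1) assms(1) by (auto intro!: fv.subspace_add fv.subspace_scale)
    then have "P (Suc m)" unfolding P_def using g(1,2) by blast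
    then show False using m(2) by fastforce
  qed
  then show thesis using that h by blast
qed

section \<open>Representations\<close>

abbreviation elm :: "'k::field rep \<Rightarrow> (nat \<Rightarrow> 'k) set" where "elm M \<equiv> fsp (mdim M)"
abbreviation opa :: "'k::field rep \<Rightarrow> (nat \<Rightarrow> 'k) \<Rightarrow> nat \<Rightarrow> 'k" where "opa M \<equiv> ap (act_a M)"
abbreviation opb :: "'k::field rep \<Rightarrow> (nat \<Rightarrow> 'k) \<Rightarrow> nat \<Rightarrow> 'k" where "opb M \<equiv> ap (act_b M)"
abbreviation opc :: "'k::field rep \<Rightarrow> (nat \<Rightarrow> 'k) \<Rightarrow> nat \<Rightarrow> 'k" where "opc M \<equiv> ap (act_c M)"
abbreviation opd :: "'k::field rep \<Rightarrow> (nat \<Rightarrow> 'k) \<Rightarrow> nat \<Rightarrow> 'k" where "opd M \<equiv> ap (act_d M)"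

definition wf_rep :: "'k::field rep \<Rightarrow> bool" where
  "wf_rep M \<longleftrightarrow> act_a M \<in> carrier_mat (mdim M) (mdim M) \<and> act_b M \<in> carrier_mat (mdim M) (mdim M) \<and>
     act_c M \<in> carrier_mat (mdim M) (mdim M) \<and> act_d M \<in> carrier_mat (mdim M) (mdim M)"

lemma op_elm [simp]:
  assumes "wf_rep M"
  shows "opa M f \<in> elm M" "opb M f \<in> elm M" "opc M f \<in> elm M" "opd M f \<in> elm M"
  using assms by (auto simp: wf_rep_def intro: ap_fsp)

text \<open>The relations are oriented as rewrite rules that move b and c towards the vector and a
  outside of d, so that words are brought to the order a, d, b, c of the monomial basis of the
  algebra.\<close>

definition D4_relations :: "'k::field rep \<Rightarrow> (nat \<Rightarrow> 'k) \<Rightarrow> bool" where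
  "D4_relations M f \<longleftrightarrow>
     opb M (opa M f) = - opa M (opb M f) \<and> opb M (opd M f) = - opd M (opb M f) \<and>
     opc M (opa M f) = - opa M (opc M f) \<and> opc M (opd M f) = - opd M (opc M f) \<and>
     opc M (opb M f) = opb M (opc M f) \<and> opa M (opa M f) = 0 \<and> opb M (opb M f) = f \<and>
     opc M (opc M f) = f \<and> opd M (opd M f) = 0 \<and>
     opd M (opa M f) = f - opb M (opc M f) - opa M (opd M f)"

lemma D4_module_iff:
  "D4_module M \<longleftrightarrow> wf_rep M \<and> (\<forall>f\<in>elm M. D4_relations M f)"
proof -
  have *: "P = Q \<longleftrightarrow> (\<forall>f\<in>elm M. ap P f = ap Q f)"
    if "P \<in> carrier_mat (mdim M) (mdim M)" "Q \<in> carrier_mat (mdim M) (mdim M)" for P Q :: "'a mat"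
    using that mat_eq_ap by blast
  show ?thesis
  proof (cases "wf_rep M")
    case True
    then have w: "act_a M \<in> carrier_mat (mdim M) (mdim M)" "act_b M \<in> carrier_mat (mdim M) (mdim M)"
      "act_c M \<in> carrier_mat (mdim M) (mdim M)" "act_d M \<in> carrier_mat (mdim M) (mdim M)"
      by (auto simp: wf_rep_def)
    note m = ap_mult[OF w(1)] ap_mult[OF w(2)] ap_mult[OF w(3)] ap_mult[OF w(4)]
    have 1: "act_b M * act_a M = - (act_a M * act_b M) \<longleftrightarrow> (\<forall>f\<in>elm M. opb M (opa M f) = - opa M (opb M f))"
      by (subst *) (use w in \<open>auto simp: ap_mult ap_uminus\<close>)
    have 2: "act_d M * act_b M = - (act_b M * act_d M) \<longleftrightarrow> (\<forall>f\<in>elm M. opb M (opd M f) = - opd M (opb M f))"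
      by (subst *) (use w in \<open>auto simp: ap_mult ap_uminus\<close>)
    have 3: "act_c M * act_a M = - (act_a M * act_c M) \<longleftrightarrow> (\<forall>f\<in>elm M. opc M (opa M f) = - opa M (opc M f))"
      by (subst *) (use w in \<open>auto simp: ap_mult ap_uminus\<close>)
    have 4: "act_d M * act_c M = - (act_c M * act_d M) \<longleftrightarrow> (\<forall>f\<in>elm M. opc M (opd M f) = - opd M (opc M f))"
      by (subst *) (use w in \<open>auto simp: ap_mult ap_uminus\<close>)
    have 5: "act_b M * act_c M = act_c M * act_b M \<longleftrightarrow> (\<forall>f\<in>elm M. opc M (opb M f) = opb M (opc M f))"
      by (subst *) (use w in \<open>auto simp: ap_mult\<close>)
    have 6: "act_a M * act_a M = 0\<^sub>m (mdim M) (mdim M) \<longleftrightarrow> (\<forall>f\<in>elm M. opa M (opa M f) = 0)"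
      by (subst *) (use w in \<open>auto simp: ap_mult ap_zero\<close>)
    have 7: "act_b M * act_b M = 1\<^sub>m (mdim M) \<longleftrightarrow> (\<forall>f\<in>elm M. opb M (opb M f) = f)"
      by (subst *) (use w in \<open>auto simp: ap_mult ap_one\<close>)
    have 8: "act_c M * act_c M = 1\<^sub>m (mdim M) \<longleftrightarrow> (\<forall>f\<in>elm M. opc M (opc M f) = f)"
      by (subst *) (use w in \<open>auto simp: ap_mult ap_one\<close>)
    have 9: "act_d M * act_d M = 0\<^sub>m (mdim M) (mdim M) \<longleftrightarrow> (\<forall>f\<in>elm M. opd M (opd M f) = 0)"
      by (subst *) (use w in \<open>auto simp: ap_mult ap_zero\<close>)
    have 10: "act_d M * act_a M + act_a M * act_d M = 1\<^sub>m (mdim M) - act_b M * act_c M \<longleftrightarrow>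
        (\<forall>f\<in>elm M. opd M (opa M f) = f - opb M (opc M f) - opa M (opd M f))"
    proof (subst *)
      show "(\<forall>f\<in>elm M. ap (act_d M * act_a M + act_a M * act_d M) f = ap (1\<^sub>m (mdim M) - act_b M * act_c M) f)
         \<longleftrightarrow> (\<forall>f\<in>elm M. opd M (opa M f) = f - opb M (opc M f) - opa M (opd M f))"
      proof (rule ball_cong[OF refl])
        fix f assume f: "f \<in> elm M"
        have e1: "ap (act_d M * act_a M + act_a M * act_d M) f = opd M (opa M f) + opa M (opd M f)"
          by (subst ap_plus[where n = "mdim M" and m = "mdim M"])
            (use w in \<open>auto simp: ap_mult[OF w(4) w(1)] ap_mult[OF w(1) w(4)]\<close>)
        have e2: "ap (1\<^sub>m (mdim M) - act_b M * act_c M) f = f - opb M (opc M f)"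
          by (subst ap_minus[where n = "mdim M" and m = "mdim M"])
            (use w f in \<open>auto simp: ap_mult[OF w(2) w(3)] ap_one\<close>)
        show "(ap (act_d M * act_a M + act_a M * act_d M) f = ap (1\<^sub>m (mdim M) - act_b M * act_c M) f)
         \<longleftrightarrow> (opd M (opa M f) = f - opb M (opc M f) - opa M (opd M f))"
          unfolding e1 e2 by (simp add: eq_diff_eq)
      qed
    qed (use w in auto)
    show ?thesis
      unfolding D4_module_def Let_def D4_relations_def ball_conj_distrib 1 2 3 4 5 6 7 8 9 10
      using True w by blast
  qed (auto simp: D4_module_def wf_rep_def Let_def)
qed

lemma D4_module_wf: "D4_module M \<Longrightarrow> wf_rep M"
  by (simp add: D4_module_iff)

lemma D4_rules:
  assumes "D4_module M" "f \<in> elm M"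
  shows "opb M (opa M f) = - opa M (opb M f)" "opb M (opd M f) = - opd M (opb M f)"
    "opc M (opa M f) = - opa M (opc M f)" "opc M (opd M f) = - opd M (opc M f)"
    "opc M (opb M f) = opb M (opc M f)" "opa M (opa M f) = 0" "opb M (opb M f) = f"
    "opc M (opc M f) = f" "opd M (opd M f) = 0"
    "opd M (opa M f) = f - opb M (opc M f) - opa M (opd M f)"
  using assms unfolding D4_module_iff D4_relations_def by auto

section \<open>Homomorphisms and isomorphisms as functions\<close>

definition fhom :: "'k::field rep \<Rightarrow> 'k rep \<Rightarrow> ((nat \<Rightarrow> 'k) \<Rightarrow> nat \<Rightarrow> 'k) \<Rightarrow> bool" where
  "fhom M N h \<longleftrightarrow> lin h \<and> (\<forall>f\<in>elm M. h f \<in> elm N \<and> h (opa M f) = opa N (h f) \<and>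
     h (opb M f) = opb N (h f) \<and> h (opc M f) = opc N (h f) \<and> h (opd M f) = opd N (h f))"

lemma fhomD:
  assumes "fhom M N h"
  shows "lin h" "f \<in> elm M \<Longrightarrow> h f \<in> elm N" "f \<in> elm M \<Longrightarrow> h (opa M f) = opa N (h f)"
    "f \<in> elm M \<Longrightarrow> h (opb M f) = opb N (h f)" "f \<in> elm M \<Longrightarrow> h (opc M f) = opc N (h f)"
    "f \<in> elm M \<Longrightarrow> h (opd M f) = opd N (h f)"
  using assms by (auto simp: fhom_def)

lemma fhomI:
  assumes "lin h" "\<And>f. f \<in> elm M \<Longrightarrow> h f \<in> elm N" "\<And>f. f \<in> elm M \<Longrightarrow> h (opa M f) = opa N (h f)"
    "\<And>f. f \<in> elm M \<Longrightarrow> h (opb M f) = opb N (h f)" "\<And>f. f \<in> elm M \<Longrightarrow> h (opc M f) = opc N (h f)"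
    "\<And>f. f \<in> elm M \<Longrightarrow> h (opd M f) = opd N (h f)"
  shows "fhom M N h"
  using assms by (auto simp: fhom_def)

lemma fhom_comp: "wf_rep M \<Longrightarrow> fhom M N h \<Longrightarrow> fhom N L g \<Longrightarrow> fhom M L (\<lambda>f. g (h f))"
  by (auto simp: fhom_def lin_comp)

lemma fhom_ap:
  assumes "wf_rep M" "wf_rep N" "H \<in> D4_hom M N"
  shows "fhom M N (ap H)"
proof -
  have H: "H \<in> carrier_mat (mdim N) (mdim M)"
    "H * act_a M = act_a N * H" "H * act_b M = act_b N * H"
    "H * act_c M = act_c N * H" "H * act_d M = act_d N * H"
    using assms(3) by (auto simp: D4_hom_def)
  have comm: "ap H (ap A f) = ap B (ap H f)"
    if "H * A = B * H" "A \<in> carrier_mat (mdim M) (mdim M)" "B \<in> carrier_mat (mdim N) (mdim N)" for A B f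
    using that by (simp flip: ap_mult[OF H(1)] ap_mult[OF _ H(1)])
  show ?thesis
    using assms(1,2) H by (intro fhomI lin_ap ap_fsp[OF H(1)] comm) (auto simp: wf_rep_def)
qed

lemma mof_D4_hom:
  assumes "wf_rep M" "wf_rep N" "fhom M N h"
  shows "mof (mdim N) (mdim M) h \<in> D4_hom M N"
proof -
  let ?H = "mof (mdim N) (mdim M) h"
  have ap: "ap ?H f = h f" if "f \<in> elm M" for f
    using ap_mof[OF fhomD(1,2)[OF assms(3)]] that by blast
  have comm: "?H * A = B * ?H"
    if "A \<in> carrier_mat (mdim M) (mdim M)" "B \<in> carrier_mat (mdim N) (mdim N)"
      "\<And>f. f \<in> elm M \<Longrightarrow> h (ap A f) = ap B (h f)" for A B
    by (rule mat_eq_ap[OF mult_carrier_mat[OF mof_carrier that(1)] mult_carrier_mat[OF that(2) mof_carrier]])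
      (use that in \<open>auto simp: ap ap_fsp ap_mult[OF mof_carrier that(1)] ap_mult[OF that(2) mof_carrier]\<close>)
  show ?thesis
    using assms(1,2) fhomD(3-)[OF assms(3)] by (auto simp: D4_hom_def wf_rep_def intro!: comm)
qed

lemma fhom_elm_eq: "fhom M N h \<Longrightarrow> f \<in> elm M \<Longrightarrow> ap (mof (mdim N) (mdim M) h) f = h f"
  using ap_mof fhomD(1,2) by blast

definition fiso :: "'k::field rep \<Rightarrow> 'k rep \<Rightarrow> ((nat \<Rightarrow> 'k) \<Rightarrow> nat \<Rightarrow> 'k) \<Rightarrow> bool" where
  "fiso M N h \<longleftrightarrow> fhom M N h \<and> bij_betw h (elm M) (elm N)"

lemma fhom_zero_iff:
  assumes "fhom M N h" "inj_on h (elm M)" "f \<in> elm M"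
  shows "h f = 0 \<longleftrightarrow> f = 0"
  using inj_onD[OF assms(2), of f 0] assms(3) lin_zero[OF fhomD(1)[OF assms(1)]] by auto

lemma fiso_inverse:
  assumes "wf_rep M" "wf_rep N" "fiso M N h"
  obtains g where "fiso N M g" "\<And>x. x \<in> elm M \<Longrightarrow> g (h x) = x" "\<And>y. y \<in> elm N \<Longrightarrow> h (g y) = y"
proof -
  have h: "fhom M N h" "inj_on h (elm M)" "h ` elm M = elm N"
    using assms(3) by (auto simp: fiso_def bij_betw_def)
  obtain g where g: "lin g" "\<And>f. g f \<in> elm M" "\<And>f. f \<in> elm N \<Longrightarrow> h (g f) = f"
    using lin_surj_section[OF fhomD(1)[OF h(1)] h(3)] by blast
  have gh: "g (h x) = x" if "x \<in> elm M" for x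
    using that h g by (metis fhomD(2) inj_onD)
  have "fhom N M g"
    using g gh h(3) fhomD[OF h(1)] op_elm[OF assms(1)] by (intro fhomI) (metis imageE)+
  moreover have "bij_betw g (elm N) (elm M)"
    using g(2,3) gh fhomD(2)[OF h(1)] by (intro bij_betw_byWitness[where f' = h]) auto
  ultimately show thesis using that gh g(3) by (auto simp: fiso_def)
qed

lemma fiso_dim:
  assumes "wf_rep M" "wf_rep N" "fiso M N h"
  shows "mdim M = mdim N"
proof -
  obtain g where g: "fiso N M g" by (rule fiso_inverse[OF assms])
  have "mdim K \<le> mdim L" if "fiso K L k" for K L :: "'a rep" and k
    using that by (intro lin_inj_dim[of k]) (auto simp: fiso_def fhom_def bij_betw_def)
  from this[OF g] this[OF assms(3)] show ?thesis by simp
qed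

lemma D4_iso_iff:
  assumes M: "wf_rep M" and N: "wf_rep N"
  shows "M \<cong>\<^sub>D N \<longleftrightarrow> (\<exists>h. fiso M N h)"
proof
  assume "M \<cong>\<^sub>D N"
  then obtain H where H: "H \<in> D4_hom M N" "invertible_mat H" by (auto simp: D4_iso_def)
  have C: "H \<in> carrier_mat (mdim N) (mdim M)" using H(1) by (auto simp: D4_hom_def)
  have d: "mdim M = mdim N" using H(2) C by (auto simp: invertible_mat_def)
  obtain G where G: "H * G = 1\<^sub>m (mdim N)" "G * H = 1\<^sub>m (dim_row G)"
    using H(2) C by (auto simp: invertible_mat_def inverts_mat_def)
  have GC: "G \<in> carrier_mat (mdim M) (mdim N)"
    using arg_cong[OF G(1), of dim_col] arg_cong[OF G(2), of dim_col] C d by auto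
  have 1: "ap H (ap G f) = f" "ap G (ap H f) = f" if "f \<in> elm M" for f
    using that GC d G by (simp_all add: ap_one flip: ap_mult[OF C GC] ap_mult[OF GC C])
  have "bij_betw (ap H) (elm M) (elm N)"
    using 1 ap_fsp[OF C] ap_fsp[OF GC] d by (intro bij_betw_byWitness[where f' = "ap G"]) auto
  then show "\<exists>h. fiso M N h" using fhom_ap[OF M N H(1)] by (auto simp: fiso_def)
next
  assume "\<exists>h. fiso M N h"
  then obtain h where h: "fiso M N h" by blast
  obtain g where g: "fiso N M g" "\<And>x. x \<in> elm M \<Longrightarrow> g (h x) = x" "\<And>y. y \<in> elm N \<Longrightarrow> h (g y) = y"
    using fiso_inverse[OF M N h] by blast
  let ?H = "mof (mdim N) (mdim M) h" and ?G = "mof (mdim M) (mdim N) g"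
  have hg: "fhom M N h" "fhom N M g" using h g by (auto simp: fiso_def)
  have d: "mdim M = mdim N" using fiso_dim[OF M N h] .
  have HG: "?H * ?G = 1\<^sub>m (mdim N)"
  proof (rule mat_eq_ap[OF mult_carrier_mat[OF mof_carrier mof_carrier]])
    fix f :: "nat \<Rightarrow> 'a" assume f: "f \<in> elm N"
    then show "ap (?H * ?G) f = ap (1\<^sub>m (mdim N)) f"
      using g(3) fhomD(2)[OF hg(2)] by (simp add: ap_mult[OF mof_carrier mof_carrier] fhom_elm_eq hg ap_one)
  qed auto
  have GH: "?G * ?H = 1\<^sub>m (mdim M)"
  proof (rule mat_eq_ap[OF mult_carrier_mat[OF mof_carrier mof_carrier]])
    fix f :: "nat \<Rightarrow> 'a" assume f: "f \<in> elm M"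
    then show "ap (?G * ?H) f = ap (1\<^sub>m (mdim M)) f"
      using g(2) fhomD(2)[OF hg(1)] by (simp add: ap_mult[OF mof_carrier mof_carrier] fhom_elm_eq hg ap_one)
  qed auto
  have "invertible_mat ?H"
    unfolding invertible_mat_def inverts_mat_def using HG GH d by (auto simp: mof_def)
  then show "M \<cong>\<^sub>D N" using mof_D4_hom[OF M N hg(1)] by (auto simp: D4_iso_def)
qed

lemma fiso_comp:
  "wf_rep M \<Longrightarrow> fiso M N h \<Longrightarrow> fiso N L g \<Longrightarrow> fiso M L (\<lambda>f. g (h f))"
  unfolding fiso_def using fhom_comp bij_betw_trans[of h _ _ g] by (auto simp: comp_def)

lemma fhom_surj_fiso:
  assumes "fhom M N h" "elm N \<subseteq> h ` elm M" "mdim M = mdim N"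
  shows "fiso M N h"
proof -
  have "h ` elm M = elm N" using assms(2) fhomD(2)[OF assms(1)] by auto
  then show ?thesis
    using lin_surj_inj[of h "mdim M"] assms fhomD(1)[OF assms(1)] by (auto simp: fiso_def bij_betw_def)
qed

text \<open>Each relation is an equation between vectors of \<open>N\<close>, so it may be tested
  after applying \<open>h\<close>.\<close>

lemma D4_module_inj:
  assumes "wf_rep N" "fhom N M h" "inj_on h (elm N)" "D4_module M"
  shows "D4_module N"
  unfolding D4_module_iff
proof (intro conjI ballI)
  fix f assume f: "f \<in> elm N"
  note [simp] = fhomD(2-)[OF assms(2)] op_elm[OF assms(1)] lin_simps[OF fhomD(1)[OF assms(2)]]
    D4_rules[OF assms(4)]
  have eq: "x = y" if "h x = h y" "x \<in> elm N" "y \<in> elm N" for x y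
    using inj_onD[OF assms(3) that] .
  show "D4_relations N f"
    unfolding D4_relations_def by (intro conjI; rule eq; use f in simp)
qed fact

section \<open>Submodules as sets of functions\<close>

definition fsub :: "'k::field rep \<Rightarrow> (nat \<Rightarrow> 'k) set \<Rightarrow> bool" where
  "fsub M S \<longleftrightarrow> fv.subspace S \<and> S \<subseteq> elm M \<and>
     (\<forall>f\<in>S. opa M f \<in> S \<and> opb M f \<in> S \<and> opc M f \<in> S \<and> opd M f \<in> S)"

lemma fsubD:
  assumes "fsub M S"
  shows "fv.subspace S" "f \<in> S \<Longrightarrow> f \<in> elm M" "f \<in> S \<Longrightarrow> opa M f \<in> S" "f \<in> S \<Longrightarrow> opb M f \<in> S"
    "f \<in> S \<Longrightarrow> opc M f \<in> S" "f \<in> S \<Longrightarrow> opd M f \<in> S"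
    "0 \<in> S" "f \<in> S \<Longrightarrow> g \<in> S \<Longrightarrow> f + g \<in> S" "f \<in> S \<Longrightarrow> g \<in> S \<Longrightarrow> f - g \<in> S"
    "f \<in> S \<Longrightarrow> c \<odot> f \<in> S" "f \<in> S \<Longrightarrow> - f \<in> S"
  using assms by (auto simp: fsub_def fv.subspace_0 fv.subspace_add fv.subspace_diff fv.subspace_scale fv.subspace_neg)

lemma fsubI:
  assumes "S \<subseteq> elm M" "0 \<in> S" "\<And>f g. f \<in> S \<Longrightarrow> g \<in> S \<Longrightarrow> f + g \<in> S" "\<And>c f. f \<in> S \<Longrightarrow> c \<odot> f \<in> S"
    "\<And>f. f \<in> S \<Longrightarrow> opa M f \<in> S" "\<And>f. f \<in> S \<Longrightarrow> opb M f \<in> S" "\<And>f. f \<in> S \<Longrightarrow> opc M f \<in> S"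
    "\<And>f. f \<in> S \<Longrightarrow> opd M f \<in> S"
  shows "fsub M S"
  using assms by (auto simp: fsub_def fv.subspace_def)

lemma fsub_image:
  assumes "fhom M N h" "fsub M S"
  shows "fsub N (h ` S)"
proof (rule fsubI)
  note h = fhomD[OF assms(1)] and S = fsubD[OF assms(2)]
  show "h ` S \<subseteq> elm N" using h(2) S(2) by auto
  show "0 \<in> h ` S" using lin_zero[OF h(1)] S(7) by (metis imageI)
  show "f + g \<in> h ` S" if "f \<in> h ` S" "g \<in> h ` S" for f g
    using that S(8) by (auto simp flip: lin_add[OF h(1)])
  show "c \<odot> f \<in> h ` S" if "f \<in> h ` S" for c f
    using that S(10) by (auto simp flip: lin_sm[OF h(1)])
  show "opa N f \<in> h ` S" if "f \<in> h ` S" for f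
    using that S h(3) by (metis (no_types, lifting) imageE imageI)
  show "opb N f \<in> h ` S" if "f \<in> h ` S" for f
    using that S h(4) by (metis (no_types, lifting) imageE imageI)
  show "opc N f \<in> h ` S" if "f \<in> h ` S" for f
    using that S h(5) by (metis (no_types, lifting) imageE imageI)
  show "opd N f \<in> h ` S" if "f \<in> h ` S" for f
    using that S h(6) by (metis (no_types, lifting) imageE imageI)
qed

lemma fsub_elm: "wf_rep M \<Longrightarrow> fsub M (elm M)"
  by (rule fsubI) auto

lemma fsub_kernel:
  assumes "wf_rep M" "fhom M N h"
  shows "fsub M {f \<in> elm M. h f = 0}"
  by (rule fsubI) (auto simp: fhomD[OF assms(2)] lin_simps[OF fhomD(1)[OF assms(2)]] assms(1) ap_simps)

lemma D4_submodule_iff: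
  assumes "wf_rep M"
  shows "D4_submodule M W \<longleftrightarrow> W \<subseteq> space M \<and> fsub M (toF ` W)"
proof -
  have w: "act_a M \<in> carrier_mat (mdim M) (mdim M)" "act_b M \<in> carrier_mat (mdim M) (mdim M)"
      "act_c M \<in> carrier_mat (mdim M) (mdim M)" "act_d M \<in> carrier_mat (mdim M) (mdim M)"
    using assms by (auto simp: wf_rep_def)
  have "subspace class_ring W (module_vec TYPE('a) (mdim M)) \<longleftrightarrow>
      W \<subseteq> space M \<and> 0\<^sub>v (mdim M) \<in> W \<and> (\<forall>v\<in>W. \<forall>w\<in>W. v + w \<in> W) \<and> (\<forall>c. \<forall>v\<in>W. c \<cdot>\<^sub>v v \<in> W)"
    (is "_ \<longleftrightarrow> ?R")
    using vec_vs[where ?'a = 'a] vec_module[where ?'a = 'a]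
    by (auto simp: subspace_def submodule_def module_vec_simps class_ring_simps)
  also have "\<dots> \<longleftrightarrow> W \<subseteq> space M \<and> fv.subspace (toF ` W)"
  proof (cases "W \<subseteq> space M")
    case True
    have mem: "toF v \<in> toF ` W \<longleftrightarrow> v \<in> W" if "v \<in> space M" for v
    proof
      assume "toF v \<in> toF ` W"
      then obtain w where "w \<in> W" "toF v = toF w" by auto
      moreover from this have "w \<in> space M" using True by auto
      ultimately show "v \<in> W" using toF_inj[OF that] by blast
    qed auto
    have "0 \<in> toF ` W \<longleftrightarrow> 0\<^sub>v (mdim M) \<in> W"
      using mem[of "0\<^sub>v (mdim M)"] by (simp add: toF_zero)
    moreover have "toF v + toF w \<in> toF ` W \<longleftrightarrow> v + w \<in> W" if "v \<in> W" "w \<in> W" for v w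
    proof -
      have "v \<in> space M" "w \<in> space M" using that True by auto
      then show ?thesis using mem[of "v + w"] toF_add[of v "mdim M" w] by simp
    qed
    moreover have "c \<odot> toF v \<in> toF ` W \<longleftrightarrow> c \<cdot>\<^sub>v v \<in> W" if "v \<in> W" for c v
    proof -
      have "v \<in> space M" using that True by auto
      then show ?thesis using mem[of "c \<cdot>\<^sub>v v"] toF_smult[of c v] by simp
    qed
    ultimately show ?thesis using True by (auto simp: fv.subspace_def)
  qed auto
  finally have 1: "subspace class_ring W (module_vec TYPE('a) (mdim M)) \<longleftrightarrow> W \<subseteq> space M \<and> fv.subspace (toF ` W)" .
  show ?thesis
  proof (cases "W \<subseteq> space M")
    case True
    have mem: "ap A (toF v) \<in> toF ` W \<longleftrightarrow> A *\<^sub>v v \<in> W" if "v \<in> W" "A \<in> carrier_mat (mdim M) (mdim M)" for v A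
    proof -
      have "v \<in> space M" using that True by auto
      then have eq: "toF (A *\<^sub>v v) = ap A (toF v)" and sp: "A *\<^sub>v v \<in> space M"
        using that(2) by (auto simp: toF_mult)
      show ?thesis
      proof
        assume "ap A (toF v) \<in> toF ` W"
        then obtain w where "w \<in> W" "toF (A *\<^sub>v v) = toF w" unfolding eq by auto
        moreover from this have "w \<in> space M" using True by auto
        ultimately show "A *\<^sub>v v \<in> W" using toF_inj[OF sp] by blast
      qed (simp flip: eq)
    qed
    show ?thesis
      unfolding D4_submodule_def 1 fsub_def using True w mem
      by (auto simp: toF_fsp subset_iff)
  qed (simp add: D4_submodule_def 1)
qed

lemma D4_submodule_vec:
  assumes "wf_rep M" "fsub M S"
  shows "D4_submodule M (vec (mdim M) ` S)" "toF ` vec (mdim M) ` S = S"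
proof -
  show eq: "toF ` vec (mdim M) ` S = S"
    using fsubD(2)[OF assms(2)] by (force simp: image_image toF_vec)
  show "D4_submodule M (vec (mdim M) ` S)"
    unfolding D4_submodule_iff[OF assms(1)] eq using assms(2) by auto
qed

lemma toF_ap_image:
  "A \<in> carrier_mat n m \<Longrightarrow> W \<subseteq> carrier_vec m \<Longrightarrow> toF ` ((*\<^sub>v) A ` W) = ap A ` toF ` W"
  unfolding image_image by (intro image_cong refl toF_mult) auto

text \<open>A basis identifies S with some k^m, and the action is transported through a left inverse
  of the basis map.\<close>

lemma submodule_rep_exists:
  assumes M: "D4_module M" and S: "fsub M S"
  obtains N h where "D4_module N" "fhom N M h" "inj_on h (elm N)" "h ` elm N = S"
proof -
  obtain m h where h: "lin h" "inj_on h (fsp m)" "h ` fsp m = S"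
    by (rule basis_exists[of S "mdim M"]) (use S in \<open>auto simp: fsub_def\<close>)
  have "\<exists>g. g ` UNIV \<subseteq> fsp m \<and> Vector_Spaces.linear sm sm g \<and> (\<forall>v\<in>fsp m. g (h v) = v)"
    using fvp.linear_exists_left_inverse_on[OF _ subspace_fsp h(2)] h(1) by (simp add: lin_iff_linear)
  then obtain g where g: "\<And>x. g x \<in> fsp m" "lin g" "\<And>x. x \<in> fsp m \<Longrightarrow> g (h x) = x"
    by (auto simp: lin_iff_linear)
  have hg: "h (g y) = y" if "y \<in> S" for y using that g(3) h(3) by auto
  define r where "r A = mof m m (\<lambda>f. g (ap A (h f)))" for A
  define N where "N = \<lparr>mdim = m, act_a = r (act_a M), act_b = r (act_b M), act_c = r (act_c M), act_d = r (act_d M)\<rparr>"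
  have r: "ap (r A) f = g (ap A (h f))" if "f \<in> fsp m" for A f
    unfolding r_def using g(1) that by (intro ap_mof lin_comp[OF g(2) lin_comp[OF lin_ap h(1)]]) auto
  have N: "wf_rep N" by (simp add: wf_rep_def N_def r_def)
  have hS: "h f \<in> S" if "f \<in> fsp m" for f using that h(3) by auto
  have hom: "fhom N M h"
    by (intro fhomI h(1)) (simp_all add: N_def r hg fsubD[OF S] hS)
  show thesis
    using that[of N h] D4_module_inj[OF N hom _ M] hom h by (simp add: N_def)
qed

section \<open>Direct sums: first block, second block and shift\<close>

definition trunc :: "nat \<Rightarrow> (nat \<Rightarrow> 'k::zero) \<Rightarrow> nat \<Rightarrow> 'k" where
  "trunc m f = (\<lambda>i. if i < m then f i else 0)"

definition drp :: "nat \<Rightarrow> (nat \<Rightarrow> 'k::zero) \<Rightarrow> nat \<Rightarrow> 'k" where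
  "drp m f = (\<lambda>i. f (m + i))"

definition emb :: "nat \<Rightarrow> (nat \<Rightarrow> 'k::zero) \<Rightarrow> nat \<Rightarrow> 'k" where
  "emb m f = (\<lambda>i. if i < m then 0 else f (i - m))"

lemma lin_trunc: "lin (trunc m)" and lin_drp: "lin (drp m)" and lin_emb: "lin (emb m)"
  by (auto intro!: linI simp: trunc_def drp_def emb_def)

lemma trunc_fsp: "trunc m f \<in> fsp m"
  by (auto simp: trunc_def fsp_def)

lemma trunc_id: "f \<in> fsp m \<Longrightarrow> trunc m f = f"
  by (auto simp: trunc_def fsp_def fun_eq_iff)

lemma drp_fsp: "f \<in> fsp (m + n) \<Longrightarrow> drp m f \<in> fsp n"
  by (auto simp: drp_def fsp_def)

lemma split_fsp: "trunc m f + emb m (drp m f) = (f :: nat \<Rightarrow> 'k::field)"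
  by (auto simp: trunc_def emb_def drp_def fun_eq_iff)

lemma trunc_emb: "f \<in> fsp m \<Longrightarrow> trunc m (f + emb m g) = (f :: nat \<Rightarrow> 'k::field)"
  and drp_emb: "f \<in> fsp m \<Longrightarrow> drp m (f + emb m g) = g"
  by (auto simp: trunc_def emb_def drp_def fsp_def fun_eq_iff)

lemma emb_fsp: "f \<in> fsp m \<Longrightarrow> g \<in> fsp n \<Longrightarrow> f + emb m g \<in> fsp (m + n)" for f :: "nat \<Rightarrow> 'k::field"
  by (auto simp: emb_def fsp_def)

lemma ap_diag:
  assumes "A \<in> carrier_mat m m" "B \<in> carrier_mat n n"
  shows "ap (diag_block_mat [A, B]) f = ap A (trunc m f) + emb m (ap B (drp m f))"
proof
  fix i
  have s: "(\<Sum>j<m + n. g j) = (\<Sum>j<m. g j) + (\<Sum>j<n. g (m + j))" for g :: "nat \<Rightarrow> 'a"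
    by (induction n) (auto simp: add.assoc)
  show "ap (diag_block_mat [A, B]) f i = (ap A (trunc m f) + emb m (ap B (drp m f))) i"
    using assms by (auto simp: ap_def trunc_def emb_def drp_def s Let_def)
qed

lemma wf_dsum: "wf_rep M \<Longrightarrow> wf_rep N \<Longrightarrow> wf_rep (M \<oplus>\<^sub>D N)"
  by (auto simp: wf_rep_def dsum_def Let_def)

lemma op_dsum:
  assumes "wf_rep M" "wf_rep N"
  shows "opa (M \<oplus>\<^sub>D N) f = opa M (trunc (mdim M) f) + emb (mdim M) (opa N (drp (mdim M) f))"
    "opb (M \<oplus>\<^sub>D N) f = opb M (trunc (mdim M) f) + emb (mdim M) (opb N (drp (mdim M) f))"
    "opc (M \<oplus>\<^sub>D N) f = opc M (trunc (mdim M) f) + emb (mdim M) (opc N (drp (mdim M) f))"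
    "opd (M \<oplus>\<^sub>D N) f = opd M (trunc (mdim M) f) + emb (mdim M) (opd N (drp (mdim M) f))"
  using assms unfolding dsum_def rep.simps
  by (intro ap_diag[where n = "mdim N"]; simp add: wf_rep_def)+

lemma mdim_dsum [simp]: "mdim (M \<oplus>\<^sub>D N) = mdim M + mdim N"
  by (simp add: dsum_def)

lemma fhom_dsum:
  assumes w: "wf_rep M" "wf_rep N" and h: "fhom M L h" and g: "fhom N L g"
  shows "fhom (M \<oplus>\<^sub>D N) L (\<lambda>f. h (trunc (mdim M) f) + g (drp (mdim M) f))"
proof (rule fhomI)
  show "lin (\<lambda>f. h (trunc (mdim M) f) + g (drp (mdim M) f))"
    by (intro lin_plus lin_comp[OF fhomD(1)[OF h] lin_trunc] lin_comp[OF fhomD(1)[OF g] lin_drp])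
  note [simp] = op_dsum[OF w] trunc_emb[OF op_elm(1)[OF w(1)]] trunc_emb[OF op_elm(2)[OF w(1)]]
    trunc_emb[OF op_elm(3)[OF w(1)]] trunc_emb[OF op_elm(4)[OF w(1)]]
    drp_emb[OF op_elm(1)[OF w(1)]] drp_emb[OF op_elm(2)[OF w(1)]]
    drp_emb[OF op_elm(3)[OF w(1)]] drp_emb[OF op_elm(4)[OF w(1)]]
    fhomD(2-)[OF h] fhomD(2-)[OF g] trunc_fsp drp_fsp ap_simps
  fix f assume f: "f \<in> elm (M \<oplus>\<^sub>D N)"
  then have d: "drp (mdim M) f \<in> elm N" by (simp add: drp_fsp)
  show "h (trunc (mdim M) f) + g (drp (mdim M) f) \<in> elm L" using d by simp
  show "h (trunc (mdim M) (opa (M \<oplus>\<^sub>D N) f)) + g (drp (mdim M) (opa (M \<oplus>\<^sub>D N) f))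
      = opa L (h (trunc (mdim M) f) + g (drp (mdim M) f))" using d by simp
  show "h (trunc (mdim M) (opb (M \<oplus>\<^sub>D N) f)) + g (drp (mdim M) (opb (M \<oplus>\<^sub>D N) f))
      = opb L (h (trunc (mdim M) f) + g (drp (mdim M) f))" using d by simp
  show "h (trunc (mdim M) (opc (M \<oplus>\<^sub>D N) f)) + g (drp (mdim M) (opc (M \<oplus>\<^sub>D N) f))
      = opc L (h (trunc (mdim M) f) + g (drp (mdim M) f))" using d by simp
  show "h (trunc (mdim M) (opd (M \<oplus>\<^sub>D N) f)) + g (drp (mdim M) (opd (M \<oplus>\<^sub>D N) f))
      = opd L (h (trunc (mdim M) f) + g (drp (mdim M) f))" using d by simp
qed

lemma dsum_image:
  assumes "lin h" "lin g"
  shows "(\<lambda>f. h (trunc m f) + g (drp m f)) ` fsp (m + n) = {x + y |x y. x \<in> h ` fsp m \<and> y \<in> g ` fsp n}"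
    (is "?F ` _ = ?R")
proof
  show "?F ` fsp (m + n) \<subseteq> ?R" using trunc_fsp drp_fsp by blast
  show "?R \<subseteq> ?F ` fsp (m + n)"
  proof
    fix z assume "z \<in> ?R"
    then obtain x y where xy: "z = h x + g y" "x \<in> fsp m" "y \<in> fsp n" by auto
    then show "z \<in> ?F ` fsp (m + n)"
      by (intro image_eqI[of _ _ "x + emb m y"]) (auto simp: trunc_emb drp_emb emb_fsp)
  qed
qed

section \<open>Projective covers\<close>

lemma D4_surj_fhom:
  assumes "wf_rep M" "wf_rep N" "H \<in> D4_surj M N"
  shows "fhom M N (ap H)" "ap H ` elm M = elm N"
proof -
  have H: "H \<in> D4_hom M N" "(*\<^sub>v) H ` space M = space N" using assms(3) by (auto simp: D4_surj_def)
  show "fhom M N (ap H)" using fhom_ap[OF assms(1,2) H(1)] .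
  have "H \<in> carrier_mat (mdim N) (mdim M)" using H(1) by (auto simp: D4_hom_def)
  from toF_ap_image[OF this, of "space M"] H(2) show "ap H ` elm M = elm N" by (simp add: toF_image)
qed

lemma D4_inj_fhom:
  assumes "wf_rep M" "wf_rep N" "H \<in> D4_inj M N"
  shows "fhom M N (ap H)" "inj_on (ap H) (elm M)" "toF ` ((*\<^sub>v) H ` space M) = ap H ` elm M"
proof -
  have H: "H \<in> D4_hom M N" "inj_on ((*\<^sub>v) H) (space M)" using assms(3) by (auto simp: D4_inj_def)
  show "fhom M N (ap H)" using fhom_ap[OF assms(1,2) H(1)] .
  have C: "H \<in> carrier_mat (mdim N) (mdim M)" using H(1) by (auto simp: D4_hom_def)
  from toF_ap_image[OF this, of "space M"] show "toF ` ((*\<^sub>v) H ` space M) = ap H ` elm M" by (simp add: toF_image)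
  show "inj_on (ap H) (elm M)"
  proof (rule inj_onI)
    fix x y assume x: "x \<in> elm M" and y: "y \<in> elm M" and eq: "ap H x = ap H y"
    have "toF (H *\<^sub>v vec (mdim M) x) = toF (H *\<^sub>v vec (mdim M) y)"
      using eq x y by (simp add: toF_mult[OF C] toF_vec)
    then have "H *\<^sub>v vec (mdim M) x = H *\<^sub>v vec (mdim M) y"
      using C by (subst (asm) toF_inj[where n = "mdim N"]) auto
    then have "vec (mdim M) x = vec (mdim M) y" using H(2) by (auto dest: inj_onD)
    then show "x = y" using x y by (metis toF_vec)
  qed
qed

lemma toF_kernel:
  assumes "H \<in> carrier_mat n m"
  shows "toF ` mat_kernel H = {x \<in> fsp m. ap H x = 0}"
proof
  show "toF ` mat_kernel H \<subseteq> {x \<in> fsp m. ap H x = 0}"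
    using assms by (auto simp: mat_kernel[OF assms] toF_fsp toF_zero simp flip: toF_mult[OF assms])
  show "{x \<in> fsp m. ap H x = 0} \<subseteq> toF ` mat_kernel H"
  proof
    fix x assume x: "x \<in> {x \<in> fsp m. ap H x = 0}"
    then have "toF (H *\<^sub>v vec m x) = toF (0\<^sub>v n)" by (simp add: toF_mult[OF assms] toF_vec toF_zero)
    then have "H *\<^sub>v vec m x = 0\<^sub>v n" using assms by (subst (asm) toF_inj[where n = n]) auto
    then show "x \<in> toF ` mat_kernel H"
      using x by (intro image_eqI[of _ _ "vec m x"]) (auto simp: mat_kernel[OF assms] toF_vec)
  qed
qed

definition fcover :: "'k::field rep \<Rightarrow> ((nat \<Rightarrow> 'k) \<Rightarrow> nat \<Rightarrow> 'k) \<Rightarrow> 'k rep \<Rightarrow> bool" where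
  "fcover P h N \<longleftrightarrow> D4_projective P \<and> D4_module N \<and> fhom P N h \<and> h ` elm P = elm N \<and>
     (\<forall>U. fsub P U \<longrightarrow> (\<forall>x\<in>elm P. \<exists>u\<in>U. \<exists>k\<in>elm P. h k = 0 \<and> x = u + k) \<longrightarrow> U = elm P)"

lemma projective_cover_fcover:
  assumes "projective_cover P f N"
  shows "fcover P (ap f) N"
proof -
  have f: "f \<in> D4_surj P N" "D4_projective P" "D4_module N" "superfluous P (mat_kernel f)"
    using assms by (auto simp: projective_cover_def)
  have w: "wf_rep P" "wf_rep N" using f by (auto simp: D4_projective_def D4_module_wf)
  have C: "f \<in> carrier_mat (mdim N) (mdim P)" using f(1) by (auto simp: D4_surj_def D4_hom_def)
  show ?thesis
    unfolding fcover_def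
  proof (intro conjI allI impI f D4_surj_fhom[OF w f(1)])
    fix U assume U: "fsub P U" and cov: "\<forall>x\<in>elm P. \<exists>u\<in>U. \<exists>k\<in>elm P. ap f k = 0 \<and> x = u + k"
    let ?U = "vec (mdim P) ` U"
    have "{u + v |u v. u \<in> ?U \<and> v \<in> mat_kernel f} = space P"
    proof
      show "{u + v |u v. u \<in> ?U \<and> v \<in> mat_kernel f} \<subseteq> space P"
        using mat_kernel_carrier[OF C] by auto
      show "space P \<subseteq> {u + v |u v. u \<in> ?U \<and> v \<in> mat_kernel f}"
      proof
        fix x assume x: "x \<in> space P"
        then obtain u k where uk: "u \<in> U" "k \<in> elm P" "ap f k = 0" "toF x = u + k"
          using cov toF_fsp by blast
        have "k \<in> toF ` mat_kernel f" unfolding toF_kernel[OF C] using uk by auto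
        then obtain k' where k': "k' \<in> mat_kernel f" "k = toF k'" by auto
        have u: "u \<in> elm P" using fsubD(2)[OF U uk(1)] .
        have kc: "k' \<in> space P" using k' mat_kernel_carrier[OF C] by auto
        have "toF x = toF (vec (mdim P) u + k')"
          using uk(4) k'(2) toF_add[OF vec_carrier kc, of u] toF_vec[OF u] by simp
        then have "x = vec (mdim P) u + k'" using x kc by (subst (asm) toF_inj[where n = "mdim P"]) auto
        then show "x \<in> {u + v |u v. u \<in> ?U \<and> v \<in> mat_kernel f}" using uk(1) k'(1) by blast
      qed
    qed
    then have "?U = space P"
      using f(4) D4_submodule_vec(1)[OF w(1) U] by (auto simp: superfluous_def)
    then show "U = elm P" using D4_submodule_vec(2)[OF w(1) U] toF_image by metis
  qed
qed

lemma projective_lift: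
  assumes "D4_projective P" "D4_module X" "D4_module Y" "fhom X Y g" "g ` elm X = elm Y" "fhom P Y f"
  obtains h where "fhom P X h" "\<And>x. x \<in> elm P \<Longrightarrow> g (h x) = f x"
proof -
  have w: "wf_rep P" "wf_rep X" "wf_rep Y" using assms by (auto simp: D4_projective_def D4_module_wf)
  let ?g = "mof (mdim Y) (mdim X) g" and ?f = "mof (mdim Y) (mdim P) f"
  have g: "?g \<in> D4_hom X Y" and f: "?f \<in> D4_hom P Y" using mof_D4_hom w assms by auto
  have "toF ` ((*\<^sub>v) ?g ` space X) = ap ?g ` elm X"
    using toF_ap_image[OF mof_carrier, of "space X"] by (simp add: toF_image)
  also have "\<dots> = elm Y" using assms(5) by (auto simp: fhom_elm_eq[OF assms(4)])
  finally have "toF ` ((*\<^sub>v) ?g ` space X) = toF ` space Y" by (simp add: toF_image)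
  moreover have "(*\<^sub>v) ?g ` space X \<subseteq> space Y"
    using mult_mat_vec_carrier[OF mof_carrier] by auto
  moreover have "inj_on toF (space Y)" by (auto simp: inj_on_def toF_inj)
  ultimately have "(*\<^sub>v) ?g ` space X = space Y" by (metis inj_on_image_eq_iff subset_refl)
  then have "?g \<in> D4_surj X Y" using g by (auto simp: D4_surj_def)
  then obtain h where h: "h \<in> D4_hom P X" "?g * h = ?f"
    using assms(1-3) f unfolding D4_projective_def by blast
  have H: "fhom P X (ap h)" using fhom_ap[OF w(1,2) h(1)] .
  have hc: "h \<in> carrier_mat (mdim X) (mdim P)" using h(1) by (auto simp: D4_hom_def)
  have "g (ap h x) = f x" if x: "x \<in> elm P" for x
  proof -
    have "g (ap h x) = ap ?g (ap h x)" using fhom_elm_eq[OF assms(4) fhomD(2)[OF H x]] by simp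
    also have "\<dots> = ap ?f x" unfolding h(2)[symmetric] by (rule ap_mult[OF mof_carrier hc, symmetric])
    finally show ?thesis using fhom_elm_eq[OF assms(6) x] by simp
  qed
  then show thesis using that H by blast
qed

lemma projectiveI:
  assumes P: "D4_module P"
    and lift: "\<And>X Y g f. D4_module X \<Longrightarrow> D4_module Y \<Longrightarrow> fhom X Y g \<Longrightarrow> g ` elm X = elm Y \<Longrightarrow> fhom P Y f \<Longrightarrow>
      \<exists>h. fhom P X h \<and> (\<forall>x\<in>elm P. g (h x) = f x)"
  shows "D4_projective P"
  unfolding D4_projective_def
proof (intro conjI allI ballI impI P)
  fix X Y :: "'a rep" and g f assume g: "g \<in> D4_surj X Y" and f: "f \<in> D4_hom P Y" and X: "D4_module X" and Y: "D4_module Y"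
  note w = D4_module_wf[OF P] D4_module_wf[OF X] D4_module_wf[OF Y]
  obtain h where h: "fhom P X h" "\<forall>x\<in>elm P. ap g (h x) = ap f x"
    using lift[OF X Y D4_surj_fhom[OF w(2,3) g] fhom_ap[OF w(1,3) f]] by blast
  have C: "g \<in> carrier_mat (mdim Y) (mdim X)" "f \<in> carrier_mat (mdim Y) (mdim P)"
    using f g by (auto simp: D4_hom_def D4_surj_def)
  have "g * mof (mdim X) (mdim P) h = f"
  proof (rule mat_eq_ap[OF mult_carrier_mat[OF C(1) mof_carrier] C(2)])
    fix x :: "nat \<Rightarrow> 'a" assume "x \<in> elm P"
    then show "ap (g * mof (mdim X) (mdim P) h) x = ap f x"
      using h by (simp add: ap_mult[OF C(1) mof_carrier] fhom_elm_eq[OF h(1)])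
  qed
  then show "\<exists>h\<in>D4_hom P X. g * h = f" using mof_D4_hom[OF w(1,2) h(1)] by blast
qed

lemma fcover_unique:
  assumes c: "fcover P f N" and c': "fcover P' g N'" and \<theta>: "fiso N N' \<theta>"
  obtains h where "fiso P P' h" "\<And>x. x \<in> elm P \<Longrightarrow> g (h x) = \<theta> (f x)"
proof -
  have P: "D4_projective P" "D4_module N" "fhom P N f" "f ` elm P = elm N"
    and P': "D4_projective P'" "D4_module N'" "fhom P' N' g" "g ` elm P' = elm N'"
    using c c' by (auto simp: fcover_def)
  have m: "D4_module P" "D4_module P'" using P P' by (auto simp: D4_projective_def)
  note w = m[THEN D4_module_wf] P(2)[THEN D4_module_wf] P'(2)[THEN D4_module_wf]
  have t: "fhom N N' \<theta>" "inj_on \<theta> (elm N)" "\<theta> ` elm N = elm N'"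
    using \<theta> by (auto simp: fiso_def bij_betw_def)
  obtain h where h: "fhom P P' h" "\<And>x. x \<in> elm P \<Longrightarrow> g (h x) = \<theta> (f x)"
    by (rule projective_lift[OF P(1) m(2) P'(2-4) fhom_comp[OF w(1) P(3) t(1)]]) blast
  have "h ` elm P = elm P'"
  proof -
    have "\<forall>x\<in>elm P'. \<exists>u\<in>h ` elm P. \<exists>k\<in>elm P'. g k = 0 \<and> x = u + k"
    proof
      fix x assume x: "x \<in> elm P'"
      then have "g x \<in> \<theta> ` f ` elm P" using fhomD(2)[OF P'(3)] t(3) P(4) by auto
      then obtain p where p: "p \<in> elm P" "g x = \<theta> (f p)" by auto
      have "g (x - h p) = 0" using p h(2) by (simp add: lin_diff[OF fhomD(1)[OF P'(3)]])
      then show "\<exists>u\<in>h ` elm P. \<exists>k\<in>elm P'. g k = 0 \<and> x = u + k"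
        using p x fhomD(2)[OF h(1)] by (intro bexI[of _ "h p"] bexI[of _ "x - h p"]) auto
    qed
    then show ?thesis using c' fsub_image[OF h(1) fsub_elm[OF w(1)]] unfolding fcover_def by blast
  qed
  have id: "fhom P' P' (\<lambda>x. x)" by (auto simp: fhom_def lin_id)
  obtain k where k: "fhom P' P k" "\<And>x. x \<in> elm P' \<Longrightarrow> h (k x) = x"
    by (rule projective_lift[OF P'(1) m h(1) \<open>h ` elm P = elm P'\<close> id]) blast
  have "k ` elm P' = elm P"
  proof -
    have "\<forall>x\<in>elm P. \<exists>u\<in>k ` elm P'. \<exists>y\<in>elm P. f y = 0 \<and> x = u + y"
    proof
      fix x assume x: "x \<in> elm P"
      let ?y = "x - k (h x)"
      have hx: "h x \<in> elm P'" using x fhomD(2)[OF h(1)] by simp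
      have y: "?y \<in> elm P" using x hx fhomD(2)[OF k(1)] by simp
      have "h ?y = 0" using k(2)[OF hx] by (simp add: lin_diff[OF fhomD(1)[OF h(1)]])
      then have "\<theta> (f ?y) = 0" using h(2)[OF y] by (simp add: lin_zero[OF fhomD(1)[OF P'(3)]])
      then have "f ?y = 0" using fhom_zero_iff[OF t(1,2) fhomD(2)[OF P(3) y]] by simp
      then show "\<exists>u\<in>k ` elm P'. \<exists>y\<in>elm P. f y = 0 \<and> x = u + y"
        using hx y by (intro bexI[of _ "k (h x)"] bexI[of _ ?y]) auto
    qed
    then show ?thesis using c fsub_image[OF k(1) fsub_elm[OF w(2)]] unfolding fcover_def by blast
  qed
  then have "k (h x) = x" if "x \<in> elm P" for x
    using that k(2) by (metis imageE)
  then have "inj_on h (elm P)" by (intro inj_on_inverseI[of _ k]) auto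
  then show thesis using that h \<open>h ` elm P = elm P'\<close> by (auto simp: fiso_def bij_betw_def)
qed

text \<open>Compose \<open>i\<close> with a left inverse of \<open>j\<close>. This makes the kernel
  in \<open>is_Omega\<close> independent of the chosen representative.\<close>

lemma submodule_rep_unique:
  assumes w: "wf_rep K" "wf_rep K'" "wf_rep P"
    and i: "fhom K P i" "inj_on i (elm K)" and j: "fhom K' P j" "inj_on j (elm K')"
    and eq: "i ` elm K = j ` elm K'"
  obtains h where "fiso K K' h"
proof -
  have "\<exists>g. g ` UNIV \<subseteq> elm K' \<and> Vector_Spaces.linear sm sm g \<and> (\<forall>v\<in>elm K'. g (j v) = v)"
    using fvp.linear_exists_left_inverse_on[OF _ subspace_fsp j(2)] fhomD(1)[OF j(1)] by (simp add: lin_iff_linear)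
  then obtain g where g: "\<And>x. g x \<in> elm K'" "lin g" "\<And>x. x \<in> elm K' \<Longrightarrow> g (j x) = x"
    by (auto simp: lin_iff_linear)
  have jg: "j (g (i x)) = i x" if "x \<in> elm K" for x
  proof -
    have "i x \<in> j ` elm K'" using that eq by auto
    then show ?thesis using g(3) by auto
  qed
  have comm: "g (i (op x)) = op' (g (i x))"
    if "x \<in> elm K" "op x \<in> elm K" "op' (g (i x)) \<in> elm K'" "i (op x) = opP (i x)" "j (op' (g (i x))) = opP (j (g (i x)))"
    for op op' opP x
    using that g(3) jg by metis
  have hom: "fhom K K' (\<lambda>x. g (i x))"
  proof (intro fhomI lin_comp[OF g(2) fhomD(1)[OF i(1)]] g(1))
    fix x assume x: "x \<in> elm K"
    show "g (i (opa K x)) = opa K' (g (i x))"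
      by (rule comm[where opP = "opa P"]) (use x w g(1) fhomD[OF i(1)] fhomD[OF j(1)] in auto)
    show "g (i (opb K x)) = opb K' (g (i x))"
      by (rule comm[where opP = "opb P"]) (use x w g(1) fhomD[OF i(1)] fhomD[OF j(1)] in auto)
    show "g (i (opc K x)) = opc K' (g (i x))"
      by (rule comm[where opP = "opc P"]) (use x w g(1) fhomD[OF i(1)] fhomD[OF j(1)] in auto)
    show "g (i (opd K x)) = opd K' (g (i x))"
      by (rule comm[where opP = "opd P"]) (use x w g(1) fhomD[OF i(1)] fhomD[OF j(1)] in auto)
  qed
  have "inj_on (\<lambda>x. g (i x)) (elm K)"
    by (rule inj_onI) (metis jg i(2) inj_onD)
  moreover have "y \<in> (\<lambda>x. g (i x)) ` elm K" if "y \<in> elm K'" for y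
  proof -
    have "j y \<in> i ` elm K" using that eq by auto
    then obtain x where "x \<in> elm K" "j y = i x" by auto
    then show ?thesis using g(3)[OF that] by (intro image_eqI[of _ _ x]) auto
  qed
  ultimately have "bij_betw (\<lambda>x. g (i x)) (elm K) (elm K')"
    using g(1) by (auto simp: bij_betw_def)
  then show thesis using that[of "\<lambda>x. g (i x)"] hom by (simp add: fiso_def)
qed

section \<open>Kronecker modules\<close>

text \<open>A pair of maps \<alpha>, \<delta> from k^p to k^q becomes a module with p vectors of
  weight \<rho> on top of q vectors of weight -\<rho>. As b c = 1 and all products of two of a, d
  vanish, the relations of the algebra impose no condition on the pair.\<close>

definition KM :: "nat \<Rightarrow> nat \<Rightarrow> ((nat \<Rightarrow> 'k) \<Rightarrow> nat \<Rightarrow> 'k) \<Rightarrow> ((nat \<Rightarrow> 'k) \<Rightarrow> nat \<Rightarrow> 'k) \<Rightarrow> 'k \<Rightarrow> 'k::field rep" where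
  "KM p q \<alpha> \<delta> \<rho> = \<lparr> mdim = p + q,
     act_a = mof (p + q) (p + q) (\<lambda>f. emb p (\<alpha> (trunc p f))),
     act_b = mof (p + q) (p + q) (\<lambda>f. \<rho> \<odot> trunc p f - \<rho> \<odot> emb p (drp p f)),
     act_c = mof (p + q) (p + q) (\<lambda>f. \<rho> \<odot> trunc p f - \<rho> \<odot> emb p (drp p f)),
     act_d = mof (p + q) (p + q) (\<lambda>f. emb p (\<delta> (trunc p f))) \<rparr>"

lemma mdim_KM [simp]: "mdim (KM p q \<alpha> \<delta> \<rho>) = p + q"
  by (simp add: KM_def)

lemma wf_KM: "wf_rep (KM p q \<alpha> \<delta> \<rho>)"
  by (simp add: wf_rep_def KM_def)

lemma trunc_drp_emb [simp]:
  "trunc p (emb p g) = 0" "drp p (emb p g) = g" "trunc p (trunc p f) = trunc p f" "drp p (trunc p f) = 0"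
  for f g :: "nat \<Rightarrow> 'k::field"
  by (auto simp: trunc_def drp_def emb_def fun_eq_iff)

lemma drp_eq_0: "f \<in> fsp p \<Longrightarrow> drp p f = 0" for f :: "nat \<Rightarrow> 'k::field"
  by (auto simp: drp_def fsp_def fun_eq_iff)

lemmas split_simps = lin_simps[OF lin_trunc] lin_simps[OF lin_drp] lin_simps[OF lin_emb]

lemma op_KM:
  assumes "lin \<alpha>" "lin \<delta>" "\<And>x. x \<in> fsp p \<Longrightarrow> \<alpha> x \<in> fsp q" "\<And>x. x \<in> fsp p \<Longrightarrow> \<delta> x \<in> fsp q" "f \<in> fsp (p + q)"
  shows "opa (KM p q \<alpha> \<delta> \<rho>) f = emb p (\<alpha> (trunc p f))"
    "opb (KM p q \<alpha> \<delta> \<rho>) f = \<rho> \<odot> trunc p f - \<rho> \<odot> emb p (drp p f)"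
    "opc (KM p q \<alpha> \<delta> \<rho>) f = \<rho> \<odot> trunc p f - \<rho> \<odot> emb p (drp p f)"
    "opd (KM p q \<alpha> \<delta> \<rho>) f = emb p (\<delta> (trunc p f))"
proof -
  have e: "emb p x \<in> fsp (p + q)" if "x \<in> fsp q" for x :: "nat \<Rightarrow> 'a"
    using that emb_fsp[of 0 p x q] by simp
  have t: "trunc p x \<in> fsp (p + q)" for x :: "nat \<Rightarrow> 'a"
    by (auto simp: trunc_def fsp_def)
  show "opa (KM p q \<alpha> \<delta> \<rho>) f = emb p (\<alpha> (trunc p f))"
    unfolding KM_def rep.simps
    by (rule ap_mof[OF lin_comp[OF lin_emb lin_comp[OF assms(1) lin_trunc]] _ assms(5)])
      (simp add: e assms(3) trunc_fsp)
  show "opd (KM p q \<alpha> \<delta> \<rho>) f = emb p (\<delta> (trunc p f))"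
    unfolding KM_def rep.simps
    by (rule ap_mof[OF lin_comp[OF lin_emb lin_comp[OF assms(2) lin_trunc]] _ assms(5)])
      (simp add: e assms(4) trunc_fsp)
  have "ap (mof (p + q) (p + q) (\<lambda>f. \<rho> \<odot> trunc p f - \<rho> \<odot> emb p (drp p f))) f = \<rho> \<odot> trunc p f - \<rho> \<odot> emb p (drp p f)"
    by (rule ap_mof[OF lin_minus_fun[OF lin_sm_fun[OF lin_trunc] lin_sm_fun[OF lin_comp[OF lin_emb lin_drp]]] _ assms(5)])
      (simp add: e t drp_fsp)
  then show "opb (KM p q \<alpha> \<delta> \<rho>) f = \<rho> \<odot> trunc p f - \<rho> \<odot> emb p (drp p f)"
    "opc (KM p q \<alpha> \<delta> \<rho>) f = \<rho> \<odot> trunc p f - \<rho> \<odot> emb p (drp p f)"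
    by (simp_all add: KM_def)
qed

lemma D4_module_KM:
  assumes "lin \<alpha>" "lin \<delta>" "\<And>x. x \<in> fsp p \<Longrightarrow> \<alpha> x \<in> fsp q" "\<And>x. x \<in> fsp p \<Longrightarrow> \<delta> x \<in> fsp q" "\<rho> * \<rho> = 1"
  shows "D4_module (KM p q \<alpha> \<delta> \<rho>)"
  unfolding D4_module_iff
proof (intro conjI ballI wf_KM)
  let ?M = "KM p q \<alpha> \<delta> \<rho>"
  fix f assume f: "f \<in> elm ?M"
  note op = op_KM[where \<alpha> = \<alpha> and \<delta> = \<delta> and p = p and q = q and \<rho> = \<rho>, OF assms(1-4)]
  have cl: "opa ?M g \<in> fsp (p + q)" "opb ?M g \<in> fsp (p + q)" "opc ?M g \<in> fsp (p + q)" "opd ?M g \<in> fsp (p + q)" for g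
    using op_elm[OF wf_KM, of p q \<alpha> \<delta> \<rho> g] by simp_all
  have s: "\<rho> \<odot> \<rho> \<odot> g = g" for g :: "nat \<Rightarrow> 'a" using assms(5) by (auto simp: fun_eq_iff mult.assoc[symmetric])
  have r: "\<rho> \<odot> \<rho> \<odot> trunc p f + \<rho> \<odot> \<rho> \<odot> emb p (drp p f) = f" unfolding s by (rule split_fsp)
  have m: "emb p (\<alpha> (trunc p f)) \<in> fsp (p + q)" "emb p (\<delta> (trunc p f)) \<in> fsp (p + q)"
    "\<rho> \<odot> trunc p f - \<rho> \<odot> emb p (drp p f) \<in> fsp (p + q)"
    using f cl(1)[of f] cl(2)[of f] cl(4)[of f] by (simp_all add: op)
  show "D4_relations ?M f"
    unfolding D4_relations_def using f r m
    by (simp add: op split_simps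
        lin_simps[OF assms(1)] lin_simps[OF assms(2)] fv.scale_right_diff_distrib)
qed

lemma fhom_from_KM:
  assumes \<alpha>: "lin \<alpha>" "lin \<delta>" "\<And>x. x \<in> fsp p \<Longrightarrow> \<alpha> x \<in> fsp q" "\<And>x. x \<in> fsp p \<Longrightarrow> \<delta> x \<in> fsp q"
    and u: "lin u" "lin w" "\<And>x. x \<in> fsp p \<Longrightarrow> u x \<in> elm Y" "\<And>x. x \<in> fsp q \<Longrightarrow> w x \<in> elm Y"
    "\<And>x. x \<in> fsp p \<Longrightarrow> opa Y (u x) = w (\<alpha> x)" "\<And>x. x \<in> fsp p \<Longrightarrow> opd Y (u x) = w (\<delta> x)"
    "\<And>x. x \<in> fsp q \<Longrightarrow> opa Y (w x) = 0" "\<And>x. x \<in> fsp q \<Longrightarrow> opd Y (w x) = 0"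
    "\<And>x. x \<in> fsp p \<Longrightarrow> opb Y (u x) = \<rho> \<odot> u x" "\<And>x. x \<in> fsp p \<Longrightarrow> opc Y (u x) = \<rho> \<odot> u x"
    "\<And>x. x \<in> fsp q \<Longrightarrow> opb Y (w x) = - (\<rho> \<odot> w x)" "\<And>x. x \<in> fsp q \<Longrightarrow> opc Y (w x) = - (\<rho> \<odot> w x)"
  shows "fhom (KM p q \<alpha> \<delta> \<rho>) Y (\<lambda>f. u (trunc p f) + w (drp p f))"
proof (rule fhomI)
  show "lin (\<lambda>f. u (trunc p f) + w (drp p f))"
    by (intro lin_plus lin_comp[OF u(1) lin_trunc] lin_comp[OF u(2) lin_drp])
qed (auto simp: op_KM[OF \<alpha>] split_simps lin_simps[OF u(1)] lin_simps[OF u(2)] ap_simps u(3-) trunc_fsp drp_fsp)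

lemma fhom_into_KM:
  assumes \<alpha>: "lin \<alpha>" "lin \<delta>" "\<And>x. x \<in> fsp p \<Longrightarrow> \<alpha> x \<in> fsp q" "\<And>x. x \<in> fsp p \<Longrightarrow> \<delta> x \<in> fsp q"
    and u: "lin u" "lin w" "\<And>x. x \<in> elm Y \<Longrightarrow> u x \<in> fsp p" "\<And>x. x \<in> elm Y \<Longrightarrow> w x \<in> fsp q"
    "\<And>x. x \<in> elm Y \<Longrightarrow> w (opa Y x) = \<alpha> (u x)" "\<And>x. x \<in> elm Y \<Longrightarrow> w (opd Y x) = \<delta> (u x)"
    "\<And>x. x \<in> elm Y \<Longrightarrow> u (opa Y x) = 0" "\<And>x. x \<in> elm Y \<Longrightarrow> u (opd Y x) = 0"
    "\<And>x. x \<in> elm Y \<Longrightarrow> u (opb Y x) = \<rho> \<odot> u x" "\<And>x. x \<in> elm Y \<Longrightarrow> u (opc Y x) = \<rho> \<odot> u x"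
    "\<And>x. x \<in> elm Y \<Longrightarrow> w (opb Y x) = - (\<rho> \<odot> w x)" "\<And>x. x \<in> elm Y \<Longrightarrow> w (opc Y x) = - (\<rho> \<odot> w x)"
  shows "fhom Y (KM p q \<alpha> \<delta> \<rho>) (\<lambda>f. u f + emb p (w f))"
proof (rule fhomI)
  show "lin (\<lambda>f. u f + emb p (w f))"
    by (intro lin_plus u lin_comp[OF lin_emb u(2)])
qed (auto simp: op_KM[OF \<alpha>] emb_fsp split_simps trunc_id drp_eq_0 u(3-))

section \<open>Free modules on weight vectors\<close>

text \<open>Reduces identities in \<open>QM\<close> to one block of coordinates at a time, where the
  nested conditionals in \<open>op_QM\<close> are decided by simplification.\<close>

lemma ext_quarters:
  fixes F G :: "nat \<Rightarrow> 'b"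
  assumes "\<And>j. j < m \<Longrightarrow> F j = G j" "\<And>j. j < m \<Longrightarrow> F (m + j) = G (m + j)"
    "\<And>j. j < m \<Longrightarrow> F (2 * m + j) = G (2 * m + j)" "\<And>j. j < m \<Longrightarrow> F (3 * m + j) = G (3 * m + j)"
    "\<And>j. F (4 * m + j) = G (4 * m + j)"
  shows "F = G"
proof
  fix i
  consider "i < m" | "m \<le> i" "i < 2 * m" | "2 * m \<le> i" "i < 3 * m" | "3 * m \<le> i" "i < 4 * m" | "4 * m \<le> i"
    by linarith
  then show "F i = G i"
    using assms(1)[of i] assms(2)[of "i - m"] assms(3)[of "i - 2 * m"] assms(4)[of "i - 3 * m"] assms(5)[of "i - 4 * m"]
    by cases auto
qed

text \<open>The free module on generators \<open>g\<^sub>i\<close>, \<open>i < m\<close>, of weight \<open>\<rho>\<close>: the four blocks of coordinates of length \<open>m\<close>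
  belong to \<open>g\<^sub>i\<close>, \<open>a g\<^sub>i\<close>, \<open>d g\<^sub>i\<close> and \<open>a d g\<^sub>i\<close>.\<close>

definition QM :: "nat \<Rightarrow> 'k::field \<Rightarrow> 'k rep" where
  "QM m \<rho> = \<lparr> mdim = 4 * m,
     act_a = mof (4 * m) (4 * m) (\<lambda>f i. if m \<le> i \<and> i < 2 * m \<or> 3 * m \<le> i \<and> i < 4 * m then f (i - m) else 0),
     act_b = mof (4 * m) (4 * m) (\<lambda>f i. if i < m then \<rho> * f i else if i < 3 * m then - \<rho> * f i else if i < 4 * m then \<rho> * f i else 0),
     act_c = mof (4 * m) (4 * m) (\<lambda>f i. if i < m then \<rho> * f i else if i < 3 * m then - \<rho> * f i else if i < 4 * m then \<rho> * f i else 0),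
     act_d = mof (4 * m) (4 * m) (\<lambda>f i. if 2 * m \<le> i \<and> i < 3 * m then f (i - 2 * m)
        else if 3 * m \<le> i \<and> i < 4 * m then - f (i - 2 * m) else 0) \<rparr>"

lemma mdim_QM [simp]: "mdim (QM m \<rho>) = 4 * m"
  by (simp add: QM_def)

lemma wf_QM: "wf_rep (QM m \<rho>)"
  by (simp add: wf_rep_def QM_def)

lemma ap_mof_cut:
  assumes "lin h" "\<And>f. h f \<in> fsp n" "\<And>f. h (trunc m f) = h f"
  shows "ap (mof n m h) f = h f"
proof -
  have "ap (mof n m h) f = ap (mof n m h) (trunc m f)"
    by (auto simp: ap_def trunc_def mof_def intro!: sum.cong)
  also have "\<dots> = h f" using ap_mof[OF assms(1,2) trunc_fsp] assms(3) by simp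
  finally show ?thesis .
qed

lemma op_QM:
  "opa (QM m \<rho>) f = (\<lambda>i. if m \<le> i \<and> i < 2 * m \<or> 3 * m \<le> i \<and> i < 4 * m then f (i - m) else 0)"
    "opb (QM m \<rho>) f = (\<lambda>i. if i < m then \<rho> * f i else if i < 3 * m then - \<rho> * f i else if i < 4 * m then \<rho> * f i else 0)"
    "opc (QM m \<rho>) f = (\<lambda>i. if i < m then \<rho> * f i else if i < 3 * m then - \<rho> * f i else if i < 4 * m then \<rho> * f i else 0)"
    "opd (QM m \<rho>) f = (\<lambda>i. if 2 * m \<le> i \<and> i < 3 * m then f (i - 2 * m)
        else if 3 * m \<le> i \<and> i < 4 * m then - f (i - 2 * m) else 0)"
  unfolding QM_def rep.simps
  by (rule ap_mof_cut; (rule linI)?; auto simp: trunc_def fsp_def fun_eq_iff algebra_simps)+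

lemma D4_module_QM:
  assumes "\<rho> * \<rho> = 1"
  shows "D4_module (QM m \<rho>)"
  unfolding D4_module_iff
proof (intro conjI ballI wf_QM)
  let ?M = "QM m \<rho>"
  fix f assume f: "f \<in> elm ?M"
  have s: "\<rho> * (\<rho> * x) = x" for x using assms by (simp flip: mult.assoc)
  have z: "f i = 0" if "4 * m \<le> i" for i using f that by (simp add: fsp_def)
  show "D4_relations ?M f"
    unfolding D4_relations_def op_QM
    by (intro conjI; rule ext_quarters[of m]; simp add: s z)
qed

definition pcmp :: "nat \<Rightarrow> nat \<Rightarrow> (nat \<Rightarrow> 'k::zero) \<Rightarrow> nat \<Rightarrow> 'k" where
  "pcmp m k f = (\<lambda>i. if i < m then f (k * m + i) else 0)"

lemma lin_pcmp: "lin (pcmp m k)"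
  by (auto intro!: linI simp: pcmp_def)

lemma pcmp_fsp [simp]: "pcmp m k f \<in> fsp m"
  by (auto simp: pcmp_def fsp_def)

lemma pcmp_QM:
  "pcmp m 0 (opa (QM m \<rho>) f) = 0" "pcmp m 1 (opa (QM m \<rho>) f) = pcmp m 0 f"
    "pcmp m 2 (opa (QM m \<rho>) f) = 0" "pcmp m 3 (opa (QM m \<rho>) f) = pcmp m 2 f"
    "pcmp m 0 (opd (QM m \<rho>) f) = 0" "pcmp m 1 (opd (QM m \<rho>) f) = 0"
    "pcmp m 2 (opd (QM m \<rho>) f) = pcmp m 0 f" "pcmp m 3 (opd (QM m \<rho>) f) = - pcmp m 1 f"
    "pcmp m 0 (opb (QM m \<rho>) f) = \<rho> \<odot> pcmp m 0 f" "pcmp m 1 (opb (QM m \<rho>) f) = - (\<rho> \<odot> pcmp m 1 f)"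
    "pcmp m 2 (opb (QM m \<rho>) f) = - (\<rho> \<odot> pcmp m 2 f)" "pcmp m 3 (opb (QM m \<rho>) f) = \<rho> \<odot> pcmp m 3 f"
    "pcmp m 0 (opc (QM m \<rho>) f) = \<rho> \<odot> pcmp m 0 f" "pcmp m 1 (opc (QM m \<rho>) f) = - (\<rho> \<odot> pcmp m 1 f)"
    "pcmp m 2 (opc (QM m \<rho>) f) = - (\<rho> \<odot> pcmp m 2 f)" "pcmp m 3 (opc (QM m \<rho>) f) = \<rho> \<odot> pcmp m 3 f"
  by (auto simp: op_QM pcmp_def fun_eq_iff intro!: arg_cong[where f = f])

text \<open>The universal property of the free module: a linear map to vectors of weight \<rho>
  extends along g, a g, d g, a d g. Since b c fixes these vectors and their images under d, the
  relation for d a reduces to d a = - a d where it is applied.\<close>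

lemma fhom_from_QM:
  assumes Y: "D4_module Y" and y: "lin y" "\<And>x. x \<in> fsp m \<Longrightarrow> y x \<in> elm Y"
    "\<And>x. x \<in> fsp m \<Longrightarrow> opb Y (y x) = \<rho> \<odot> y x" "\<And>x. x \<in> fsp m \<Longrightarrow> opc Y (y x) = \<rho> \<odot> y x" and \<rho>: "\<rho> * \<rho> = 1"
  shows "fhom (QM m \<rho>) Y (\<lambda>f. y (pcmp m 0 f) + opa Y (y (pcmp m 1 f)) + opd Y (y (pcmp m 2 f))
    + opa Y (opd Y (y (pcmp m 3 f))))"
proof (rule fhomI)
  note lp = lin_comp[OF y(1) lin_pcmp]
  show "lin (\<lambda>f. y (pcmp m 0 f) + opa Y (y (pcmp m 1 f)) + opd Y (y (pcmp m 2 f)) + opa Y (opd Y (y (pcmp m 3 f))))"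
    by (intro lin_plus lp lin_comp[OF lin_ap lp] lin_comp[OF lin_ap lin_comp[OF lin_ap lp]])
  note w = D4_module_wf[OF Y]
  have "opb Y (opc Y (y x)) = y x" if "x \<in> fsp m" for x
    using that \<rho> by (simp add: y ap_simps)
  note [simp] = D4_rules[OF Y] y(2-) op_elm[OF w] lin_simps[OF y(1)] ap_simps
    pcmp_QM pcmp_QM[unfolded One_nat_def] this
  have dad: "opd Y (opa Y (opd Y (y x))) = 0" if "x \<in> fsp m" for x
    using that \<rho> by (simp add: fun_eq_iff mult.assoc[symmetric])
  note [simp] = dad
  fix f assume f: "f \<in> elm (QM m \<rho>)"
  show "y (pcmp m 0 f) + opa Y (y (pcmp m 1 f)) + opd Y (y (pcmp m 2 f)) + opa Y (opd Y (y (pcmp m 3 f))) \<in> elm Y"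
    by simp
  show "y (pcmp m 0 (opa (QM m \<rho>) f)) + opa Y (y (pcmp m 1 (opa (QM m \<rho>) f))) + opd Y (y (pcmp m 2 (opa (QM m \<rho>) f)))
      + opa Y (opd Y (y (pcmp m 3 (opa (QM m \<rho>) f))))
    = opa Y (y (pcmp m 0 f) + opa Y (y (pcmp m 1 f)) + opd Y (y (pcmp m 2 f)) + opa Y (opd Y (y (pcmp m 3 f))))"
    by simp
  show "y (pcmp m 0 (opb (QM m \<rho>) f)) + opa Y (y (pcmp m 1 (opb (QM m \<rho>) f))) + opd Y (y (pcmp m 2 (opb (QM m \<rho>) f)))
      + opa Y (opd Y (y (pcmp m 3 (opb (QM m \<rho>) f))))
    = opb Y (y (pcmp m 0 f) + opa Y (y (pcmp m 1 f)) + opd Y (y (pcmp m 2 f)) + opa Y (opd Y (y (pcmp m 3 f))))"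
    by simp
  show "y (pcmp m 0 (opc (QM m \<rho>) f)) + opa Y (y (pcmp m 1 (opc (QM m \<rho>) f))) + opd Y (y (pcmp m 2 (opc (QM m \<rho>) f)))
      + opa Y (opd Y (y (pcmp m 3 (opc (QM m \<rho>) f))))
    = opc Y (y (pcmp m 0 f) + opa Y (y (pcmp m 1 f)) + opd Y (y (pcmp m 2 f)) + opa Y (opd Y (y (pcmp m 3 f))))"
    by simp
  show "y (pcmp m 0 (opd (QM m \<rho>) f)) + opa Y (y (pcmp m 1 (opd (QM m \<rho>) f))) + opd Y (y (pcmp m 2 (opd (QM m \<rho>) f)))
      + opa Y (opd Y (y (pcmp m 3 (opd (QM m \<rho>) f))))
    = opd Y (y (pcmp m 0 f) + opa Y (y (pcmp m 1 f)) + opd Y (y (pcmp m 2 f)) + opa Y (opd Y (y (pcmp m 3 f))))"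
    using \<rho> by (simp add: algebra_simps)
qed

lemma QM_expand:
  assumes "f \<in> fsp (4 * m)"
  shows "f = pcmp m 0 f + opa (QM m \<rho>) (pcmp m 1 f) + opd (QM m \<rho>) (pcmp m 2 f)
    + opa (QM m \<rho>) (opd (QM m \<rho>) (pcmp m 3 f))"
proof -
  have z: "f i = 0" if "4 * m \<le> i" for i using assms that by (simp add: fsp_def)
  show ?thesis
    unfolding op_QM
    by (rule ext_quarters[of m]) (simp_all add: pcmp_def z)
qed

lemma projective_QM:
  assumes "\<rho> * \<rho> = 1" "(2 :: 'k::field) \<noteq> 0"
  shows "D4_projective (QM m (\<rho> :: 'k))"
proof (rule projectiveI[OF D4_module_QM[OF assms(1)]])
  let ?Q = "QM m \<rho>"
  fix X Y :: "'k rep" and g f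
  assume X: "D4_module X" and Y: "D4_module Y" and g: "fhom X Y g" "g ` elm X = elm Y" and f: "fhom ?Q Y f"
  note w = D4_module_wf[OF X] D4_module_wf[OF Y]
  obtain \<sigma> where \<sigma>: "lin \<sigma>" "\<And>x. \<sigma> x \<in> elm X" "\<And>x. x \<in> elm Y \<Longrightarrow> g (\<sigma> x) = x"
    using lin_surj_section[OF fhomD(1)[OF g(1)] g(2)] by blast
  have \<rho>s: "\<rho> * (\<rho> * x) = x" for x using assms(1) by (simp flip: mult.assoc)
  \<comment> \<open>This is (1 + \<rho> b)(1 + \<rho> c)/4, the projection to weight \<rho>. It is
    compatible with g, so it corrects an arbitrary linear lift to one of the right weight.\<close>
  define pr where "pr x = inverse 4 \<odot> (x + \<rho> \<odot> opb X x + \<rho> \<odot> opc X x + opb X (opc X x))" for x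
  have pr: "lin pr"
    unfolding pr_def by (intro lin_sm_fun lin_plus lin_id lin_ap lin_comp[OF lin_ap lin_ap])
  have pr_elm: "pr x \<in> elm X" if "x \<in> elm X" for x
    using that w by (simp add: pr_def)
  have pr_b: "opb X (pr x) = \<rho> \<odot> pr x" and pr_c: "opc X (pr x) = \<rho> \<odot> pr x" if "x \<in> elm X" for x
    using that w by (auto simp: pr_def ap_simps D4_rules[OF X] fun_eq_iff algebra_simps \<rho>s)
  have four: "(4 :: 'k) \<noteq> 0" using assms(2) by (metis mult_2 mult_eq_0_iff numeral_Bit0)
  have pr_g: "g (pr x) = g x" if "x \<in> elm X" "opb Y (g x) = \<rho> \<odot> g x" "opc Y (g x) = \<rho> \<odot> g x" for x
  proof -
    have "g (pr x) = inverse 4 \<odot> (g x + g x + g x + g x)"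
      using that w assms(1)
      by (simp add: pr_def fhomD[OF g(1)] lin_simps[OF fhomD(1)[OF g(1)]] ap_simps)
    also have "\<dots> = inverse 4 \<odot> (4 \<odot> g x)" by (simp add: fun_eq_iff)
    finally have "g (pr x) = inverse 4 \<odot> (4 \<odot> g x)" .
    then show ?thesis using four by (simp add: fun_eq_iff)
  qed
  have Qop: "opb ?Q x = \<rho> \<odot> x" "opc ?Q x = \<rho> \<odot> x" "x \<in> elm ?Q" if "x \<in> fsp m" for x
  proof -
    have x: "x \<in> fsp (4 * m)" using that by (auto simp: fsp_def)
    then show "x \<in> elm ?Q" by simp
    show "opb ?Q x = \<rho> \<odot> x" "opc ?Q x = \<rho> \<odot> x"
      unfolding op_QM using that by (auto simp: fun_eq_iff fsp_def)
  qed
  define y where "y x = pr (\<sigma> (f x))" for x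
  have y: "lin y" unfolding y_def by (rule lin_comp[OF pr lin_comp[OF \<sigma>(1) fhomD(1)[OF f]]])
  have gy: "g (y x) = f x" if "x \<in> fsp m" for x
  proof -
    have e: "f x \<in> elm Y" using fhomD(2)[OF f] Qop(3) that by blast
    have "opb Y (f x) = \<rho> \<odot> f x" "opc Y (f x) = \<rho> \<odot> f x"
      using fhomD(4,5)[OF f Qop(3)[OF that]] Qop(1,2)[OF that] by (simp_all add: lin_sm[OF fhomD(1)[OF f]])
    then show ?thesis using \<sigma>(2,3) e by (simp add: y_def pr_g)
  qed
  have ye: "y x \<in> elm X" for x by (simp add: y_def pr_elm \<sigma>(2))
  let ?h = "\<lambda>f. y (pcmp m 0 f) + opa X (y (pcmp m 1 f)) + opd X (y (pcmp m 2 f)) + opa X (opd X (y (pcmp m 3 f)))"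
  have h: "fhom ?Q X ?h"
    by (rule fhom_from_QM[OF X y _ _ _ assms(1)]) (simp_all add: y_def pr_elm pr_b pr_c \<sigma>(2))
  have "g (?h x) = f x" if x: "x \<in> elm ?Q" for x
  proof -
    have q: "pcmp m k x \<in> elm ?Q" for k using Qop(3) by simp
    have "g (?h x) = f (pcmp m 0 x) + opa Y (f (pcmp m 1 x)) + opd Y (f (pcmp m 2 x)) + opa Y (opd Y (f (pcmp m 3 x)))"
      using w ye by (simp add: lin_add[OF fhomD(1)[OF g(1)]] fhomD(3-6)[OF g(1)] gy)
    also have "\<dots> = f (pcmp m 0 x + opa ?Q (pcmp m 1 x) + opd ?Q (pcmp m 2 x) + opa ?Q (opd ?Q (pcmp m 3 x)))"
      using q op_elm[OF wf_QM[of m \<rho>]] by (simp only: lin_add[OF fhomD(1)[OF f]] fhomD(3-6)[OF f])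
    also have "\<dots> = f x" using QM_expand[of x m \<rho>] x by simp
    finally show ?thesis .
  qed
  then show "\<exists>h. fhom ?Q X h \<and> (\<forall>x\<in>elm ?Q. g (h x) = f x)" using h by blast
qed

section \<open>Syzygies of the simple modules\<close>

text \<open>The model of \<open>\<Omega>\<^sup>s V(r)\<close> has a basis \<open>x\<^sub>0, \<dots>, x\<^sub>s, y\<^sub>1, \<dots>, y\<^sub>s\<close> with
  \<open>a x\<^sub>i = y\<^sub>i\<close> and \<open>d x\<^sub>i = y\<^sub>i\<^sub>+\<^sub>1\<close>, where \<open>y\<^sub>0 = y\<^sub>s\<^sub>+\<^sub>1 = 0\<close>.\<close>

definition Om :: "nat \<Rightarrow> 'k::field \<Rightarrow> 'k rep" where
  "Om s \<rho> = KM (Suc s) s (\<lambda>f i. if i < s then f (Suc i) else 0) (\<lambda>f i. if i < s then f i else 0) \<rho>"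

lemma mdim_Om [simp]: "mdim (Om s \<rho>) = Suc s + s"
  by (simp add: Om_def)

lemma wf_Om: "wf_rep (Om s \<rho>)"
  by (simp add: Om_def wf_KM)

lemma D4_module_Om: "\<rho> * \<rho> = 1 \<Longrightarrow> D4_module (Om s \<rho>)"
  unfolding Om_def by (rule D4_module_KM) (auto intro!: linI simp: fsp_def)

lemma op_Om:
  assumes "f \<in> fsp (Suc s + s)"
  shows "opa (Om s \<rho>) f = (\<lambda>i. if Suc s \<le> i \<and> i < Suc s + s then f (i - s) else 0)"
    "opb (Om s \<rho>) f = (\<lambda>i. if i < Suc s then \<rho> * f i else - \<rho> * f i)"
    "opc (Om s \<rho>) f = (\<lambda>i. if i < Suc s then \<rho> * f i else - \<rho> * f i)"
    "opd (Om s \<rho>) f = (\<lambda>i. if Suc s \<le> i \<and> i < Suc s + s then f (i - Suc s) else 0)"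
proof -
  note op = op_KM[where \<alpha> = "\<lambda>f i. if i < s then f (Suc i) else 0" and \<delta> = "\<lambda>f i. if i < s then f i else 0",
      OF lin_reindex lin_reindex _ _ assms, of \<rho>, folded Om_def]
  show "opa (Om s \<rho>) f = (\<lambda>i. if Suc s \<le> i \<and> i < Suc s + s then f (i - s) else 0)"
    by (subst op; auto simp: fsp_def fun_eq_iff emb_def trunc_def Suc_diff_le[symmetric])
  show "opb (Om s \<rho>) f = (\<lambda>i. if i < Suc s then \<rho> * f i else - \<rho> * f i)"
    by (subst op; auto simp: fsp_def fun_eq_iff emb_def trunc_def drp_def)
  show "opc (Om s \<rho>) f = (\<lambda>i. if i < Suc s then \<rho> * f i else - \<rho> * f i)"
    by (subst op; auto simp: fsp_def fun_eq_iff emb_def trunc_def drp_def)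
  show "opd (Om s \<rho>) f = (\<lambda>i. if Suc s \<le> i \<and> i < Suc s + s then f (i - Suc s) else 0)"
    by (subst op; auto simp: fsp_def fun_eq_iff emb_def trunc_def)
qed

text \<open>Sends g_i to x_i. The coefficient of y_j, which stands at position s + j, collects those
  of a g_j and d g_(j-1); the elements a d g_i go to 0.\<close>

definition Om_cover :: "nat \<Rightarrow> (nat \<Rightarrow> 'k::field) \<Rightarrow> nat \<Rightarrow> 'k" where
  "Om_cover s f = (\<lambda>i. if i < Suc s then f i else if i < Suc s + s then f (Suc i) + f (Suc s + i) else 0)"

text \<open>With generators \<open>g\<^sub>0, \<dots>, g\<^sub>s\<close> of the cover, \<open>x\<^sub>i\<close> is sent to \<open>d g\<^sub>i\<^sub>-\<^sub>1 - a g\<^sub>i\<close> and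
  \<open>y\<^sub>i\<close> to \<open>a d g\<^sub>i\<^sub>-\<^sub>1\<close>, where \<open>g\<^sub>-\<^sub>1 = g\<^sub>s\<^sub>+\<^sub>1 = 0\<close>.\<close>

definition Om_syz :: "nat \<Rightarrow> (nat \<Rightarrow> 'k::field) \<Rightarrow> nat \<Rightarrow> 'k" where
  "Om_syz m f = (\<lambda>i. if m \<le> i \<and> i < 2 * m then - f (i - m)
     else if 2 * m \<le> i \<and> i < 3 * m then f (Suc i - 2 * m)
     else if 3 * m \<le> i \<and> i < 4 * m then f (Suc i - 2 * m) else 0)"

lemma fhom_Om_cover: "fhom (QM (Suc s) \<rho>) (Om s \<rho>) (Om_cover s)"
proof (rule fhomI)
  show l: "lin (Om_cover s)" by (auto intro!: linI simp: Om_cover_def algebra_simps)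
  have e: "Om_cover s f \<in> fsp (Suc s + s)" for f by (auto simp: Om_cover_def fsp_def)
  fix f assume "f \<in> elm (QM (Suc s) \<rho>)"
  then have f: "f \<in> fsp (4 * Suc s)" by simp
  show "Om_cover s f \<in> elm (Om s \<rho>)" using e by simp
  show "Om_cover s (opa (QM (Suc s) \<rho>) f) = opa (Om s \<rho>) (Om_cover s f)"
    unfolding op_QM op_Om[OF e]
    by (rule ext_quarters[of "Suc s"]) (auto simp: Om_cover_def)
  show "Om_cover s (opb (QM (Suc s) \<rho>) f) = opb (Om s \<rho>) (Om_cover s f)"
    unfolding op_QM op_Om[OF e]
    by (rule ext_quarters[of "Suc s"]) (auto simp: Om_cover_def algebra_simps)
  show "Om_cover s (opc (QM (Suc s) \<rho>) f) = opc (Om s \<rho>) (Om_cover s f)"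
    unfolding op_QM op_Om[OF e]
    by (rule ext_quarters[of "Suc s"]) (auto simp: Om_cover_def algebra_simps)
  show "Om_cover s (opd (QM (Suc s) \<rho>) f) = opd (Om s \<rho>) (Om_cover s f)"
    unfolding op_QM op_Om[OF e]
    by (rule ext_quarters[of "Suc s"]) (auto simp: Om_cover_def)
qed

text \<open>The sign of the weight changes because the top of the syzygy is sent to the span of the
  a g_i and d g_i.\<close>

lemma fhom_Om_syz: "fhom (Om m (- \<rho>)) (QM m \<rho>) (Om_syz m)"
proof (rule fhomI)
  show l: "lin (Om_syz m)" by (auto intro!: linI simp: Om_syz_def algebra_simps)
  have e: "Om_syz m f \<in> fsp (4 * m)" for f by (auto simp: Om_syz_def fsp_def)
  fix f assume "f \<in> elm (Om m (- \<rho>))"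
  then have f: "f \<in> fsp (Suc m + m)" by simp
  show "Om_syz m f \<in> elm (QM m \<rho>)" using e by simp
  show "Om_syz m (opa (Om m (- \<rho>)) f) = opa (QM m \<rho>) (Om_syz m f)"
    unfolding op_Om[OF f] op_QM
    by (rule ext_quarters[of m]) (simp_all add: Om_syz_def)
  show "Om_syz m (opb (Om m (- \<rho>)) f) = opb (QM m \<rho>) (Om_syz m f)"
    unfolding op_Om[OF f] op_QM
    by (rule ext_quarters[of m]) (simp_all add: Om_syz_def)
  show "Om_syz m (opc (Om m (- \<rho>)) f) = opc (QM m \<rho>) (Om_syz m f)"
    unfolding op_Om[OF f] op_QM
    by (rule ext_quarters[of m]) (simp_all add: Om_syz_def)
  show "Om_syz m (opd (Om m (- \<rho>)) f) = opd (QM m \<rho>) (Om_syz m f)"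
    unfolding op_Om[OF f] op_QM
    by (rule ext_quarters[of m]) (simp_all add: Om_syz_def)
qed

lemma inj_Om_syz:
  assumes "m > 0"
  shows "inj_on (Om_syz m) (fsp (Suc m + m))"
proof (rule lin_inj_onI)
  show "lin (Om_syz m)" by (auto intro!: linI simp: Om_syz_def algebra_simps)
  fix f :: "nat \<Rightarrow> 'a" assume f: "f \<in> fsp (Suc m + m)" and 0: "Om_syz m f = 0"
  show "f = 0"
  proof
    fix i
    consider "i < m" | "m \<le> i" "i < Suc m + m" | "Suc m + m \<le> i" by linarith
    then show "f i = 0 i"
    proof cases
      case 1
      then show ?thesis using fun_cong[OF 0, of "m + i"] by (simp add: Om_syz_def)
    next
      case 2
      \<comment> \<open>For i = m this position is the last one of the block of the d g_j and
        carries x_m; for larger i it lies in the block of the a d g_j and carries y_(i-m).\<close>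
      then have "Om_syz m f (2 * m + i - 1) = f i"
        using assms unfolding Om_syz_def by (auto intro!: arg_cong[where f = f])
      then show ?thesis using 0 by simp
    next
      case 3
      then show ?thesis using f by (simp add: fsp_def)
    qed
  qed
qed

lemma Om_cover_kernel:
  "{f \<in> fsp (4 * Suc s). Om_cover s f = 0} = Om_syz (Suc s) ` fsp (Suc (Suc s) + Suc s)"
  (is "?K = _")
proof
  show "?K \<subseteq> Om_syz (Suc s) ` fsp (Suc (Suc s) + Suc s)"
  proof
    fix f :: "nat \<Rightarrow> 'a" assume "f \<in> ?K"
    then have f: "f \<in> fsp (4 * Suc s)" "Om_cover s f = 0" by auto
    have z: "f i = 0" if "i < Suc s" for i
      using fun_cong[OF f(2), of i] that by (simp add: Om_cover_def)
    have r: "f (2 * Suc s + j) = - f (Suc s + Suc j)" if "j < s" for j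
      using fun_cong[OF f(2), of "Suc s + j"] that
      by (simp add: Om_cover_def add_eq_0_iff2 mult_2 add.assoc)
    have t: "f i = 0" if "4 * Suc s \<le> i" for i using f(1) that by (simp add: fsp_def)
    \<comment> \<open>The preimage is read off: x_i for i \<le> s from the coefficient of a g_i,
      x_(s+1) from that of d g_s, and y_j from that of a d g_(j-1). The remaining coefficients of d
      g_j are determined by the kernel equation \<open>r\<close>.\<close>
    define g where "g i = (if i < Suc s then - f (Suc s + i) else if i < Suc (Suc s) + Suc s then f (2 * Suc s + i - 1) else 0)" for i
    have "f = Om_syz (Suc s) g"
    proof (rule ext_quarters[of "Suc s"])
      fix j assume j: "j < Suc s"
      show "f j = Om_syz (Suc s) g j" using z j by (simp add: Om_syz_def)
      show "f (Suc s + j) = Om_syz (Suc s) g (Suc s + j)" using j by (simp add: Om_syz_def g_def)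
      show "f (2 * Suc s + j) = Om_syz (Suc s) g (2 * Suc s + j)"
      proof (cases "j < s")
        case True
        then show ?thesis using r by (simp add: Om_syz_def g_def mult_2 add.assoc)
      next
        case False
        then have "j = s" using j by simp
        then show ?thesis by (simp add: Om_syz_def g_def)
      qed
      show "f (3 * Suc s + j) = Om_syz (Suc s) g (3 * Suc s + j)"
        using j by (auto simp: Om_syz_def g_def intro!: arg_cong[where f = f])
    next
      fix j show "f (4 * Suc s + j) = Om_syz (Suc s) g (4 * Suc s + j)"
        using t by (simp add: Om_syz_def)
    qed
    moreover have "g \<in> fsp (Suc (Suc s) + Suc s)" by (auto simp: g_def fsp_def)
    ultimately show "f \<in> Om_syz (Suc s) ` fsp (Suc (Suc s) + Suc s)" by blast
  qed
  show "Om_syz (Suc s) ` fsp (Suc (Suc s) + Suc s) \<subseteq> ?K"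
  proof clarify
    fix g :: "nat \<Rightarrow> 'a" assume "g \<in> fsp (Suc (Suc s) + Suc s)"
    have "Om_cover s (Om_syz (Suc s) g) i = 0" for i
    proof -
      consider "i < Suc s" | "Suc s \<le> i" "i < Suc s + s" | "Suc s + s \<le> i" by linarith
      then show ?thesis
      proof cases
        case 2
        define j where "j = i - Suc s"
        have "i = Suc s + j" "j < s" using 2 by (auto simp: j_def)
        then show ?thesis by (simp add: Om_cover_def Om_syz_def)
      qed (simp_all add: Om_cover_def Om_syz_def)
    qed
    moreover have "Om_syz (Suc s) g \<in> fsp (4 * Suc s)" by (auto simp: Om_syz_def fsp_def)
    ultimately show "Om_syz (Suc s) g \<in> fsp (4 * Suc s) \<and> Om_cover s (Om_syz (Suc s) g) = 0"
      by (auto simp: fun_eq_iff)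
  qed
qed

lemma fcover_Om:
  assumes "\<rho> * \<rho> = 1" "(2 :: 'k::field) \<noteq> 0"
  shows "fcover (QM (Suc s) (\<rho> :: 'k)) (Om_cover s) (Om s \<rho>)"
  unfolding fcover_def
proof (intro conjI allI impI projective_QM[OF assms] D4_module_Om[OF assms(1)] fhom_Om_cover)
  let ?Q = "QM (Suc s) \<rho>"
  let ?m = "Suc s"
  show "Om_cover s ` elm ?Q = elm (Om s \<rho>)"
  proof
    show "Om_cover s ` elm ?Q \<subseteq> elm (Om s \<rho>)" using fhomD(2)[OF fhom_Om_cover] by blast
    show "elm (Om s \<rho>) \<subseteq> Om_cover s ` elm ?Q"
    proof
      fix y assume y: "y \<in> elm (Om s \<rho>)"
      define f where "f i = (if i < Suc s then y i else if Suc s < i \<and> i < 2 * Suc s then y (i - 1) else 0)" for i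
      have "y = Om_cover s f" using y by (auto simp: Om_cover_def f_def fun_eq_iff fsp_def)
      moreover have "f \<in> elm ?Q" by (auto simp: f_def fsp_def)
      ultimately show "y \<in> Om_cover s ` elm ?Q" by blast
    qed
  qed
  fix U assume U: "fsub ?Q U" and cov: "\<forall>x\<in>elm ?Q. \<exists>u\<in>U. \<exists>k\<in>elm ?Q. Om_cover s k = 0 \<and> x = u + k"
  have p: "pcmp ?m n f \<in> elm ?Q" for n f by (auto simp: pcmp_def fsp_def)
  have cov': "\<exists>k. pcmp ?m n f - k \<in> U \<and> k \<in> fsp (4 * ?m) \<and> pcmp ?m 0 k = 0" for n f
  proof -
    obtain u k where k: "u \<in> U" "k \<in> elm ?Q" "Om_cover s k = 0" "pcmp ?m n f = u + k" using cov p by metis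
    have "k i = 0" if "i < ?m" for i using fun_cong[OF k(3), of i] that by (simp add: Om_cover_def)
    then have "pcmp ?m 0 k = 0" by (auto simp: pcmp_def)
    moreover have "pcmp ?m n f - k = u" using k(4) by (simp add: fun_eq_iff)
    ultimately show ?thesis using k(1,2) by auto
  qed
  have ad: "opa ?Q (opd ?Q (pcmp ?m n f)) \<in> U" for n f
  proof -
    obtain k where k: "pcmp ?m n f - k \<in> U" "pcmp ?m 0 k = 0" using cov' by blast
    have k0: "k i = 0" if "i < ?m" for i using fun_cong[OF k(2), of i] that by (simp add: pcmp_def)
    have "opa ?Q (opd ?Q (pcmp ?m n f - k)) = opa ?Q (opd ?Q (pcmp ?m n f))"
      unfolding op_QM by (rule ext_quarters[of ?m]) (simp_all add: k0)
    then show ?thesis using fsubD(3,6)[OF U] k(1) by metis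
  qed
  have a: "opa ?Q (pcmp ?m n f) \<in> U" for n f
  proof -
    obtain k where k: "pcmp ?m n f - k \<in> U" "pcmp ?m 0 k = 0" using cov' by blast
    have k0: "k i = 0" if "i < ?m" for i using fun_cong[OF k(2), of i] that by (simp add: pcmp_def)
    have "opa ?Q (pcmp ?m n f) = opa ?Q (pcmp ?m n f - k) + opa ?Q (opd ?Q (pcmp ?m 2 k))"
      unfolding op_QM by (rule ext_quarters[of ?m]) (simp_all add: k0, simp_all add: pcmp_def)
    then show ?thesis using fsubD(3,8)[OF U] k(1) ad by metis
  qed
  have d: "opd ?Q (pcmp ?m n f) \<in> U" for n f
  proof -
    obtain k where k: "pcmp ?m n f - k \<in> U" "pcmp ?m 0 k = 0" using cov' by blast
    have k0: "k i = 0" if "i < ?m" for i using fun_cong[OF k(2), of i] that by (simp add: pcmp_def)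
    have "opd ?Q (pcmp ?m n f) = opd ?Q (pcmp ?m n f - k) - opa ?Q (opd ?Q (pcmp ?m 1 k))"
      unfolding op_QM by (rule ext_quarters[of ?m]) (simp_all add: k0, simp_all add: pcmp_def)
    then show ?thesis using fsubD(6,9)[OF U] k(1) ad by metis
  qed
  have g: "pcmp ?m n f \<in> U" for n f
  proof -
    obtain k where k: "pcmp ?m n f - k \<in> U" "k \<in> fsp (4 * ?m)" "pcmp ?m 0 k = 0" using cov' by blast
    have "k \<in> U"
      by (subst QM_expand[OF k(2), of \<rho>]) (use k(3) a d ad in \<open>simp add: fsubD(8)[OF U]\<close>)
    then show ?thesis using fsubD(8)[OF U k(1) \<open>k \<in> U\<close>] by simp
  qed
  show "U = elm ?Q"
  proof
    show "U \<subseteq> elm ?Q" using fsubD(2)[OF U] by blast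
    show "elm ?Q \<subseteq> U"
    proof
      fix f assume "f \<in> elm ?Q"
      then have f: "f \<in> fsp (4 * ?m)" by simp
      show "f \<in> U" by (subst QM_expand[OF f, of \<rho>]) (use g a d ad in \<open>simp add: fsubD(8)[OF U]\<close>)
    qed
  qed
qed

lemma sgn2_square: "sgn2 r * sgn2 r = (1 :: 'k::field)"
  by (simp add: sgn2_def)

lemma V_Om: "fiso (Om 0 (sgn2 r)) (V r) (\<lambda>x. x)"
proof -
  have sm: "ap (c \<cdot>\<^sub>m 1\<^sub>m 1) f = c \<odot> f" if "f \<in> fsp (Suc 0)" for c :: 'a and f
    using that by (auto simp: ap_def fsp_def fun_eq_iff)
  show ?thesis
    unfolding fiso_def
    by (auto simp: fhom_def lin_id V_def op_Om ap_zero sm[unfolded One_nat_def] bij_betw_def)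
      (auto simp: fun_eq_iff fsp_def)
qed

lemma wf_V: "wf_rep (V r)"
  by (auto simp: wf_rep_def V_def)

lemma is_P_QM:
  assumes "is_P r P" "(2 :: 'k::field) \<noteq> 0"
  obtains h where "fiso (QM 1 (sgn2 r :: 'k)) P h" "D4_module P"
proof -
  obtain f where f: "fcover P (ap f) (V r)"
    using assms(1) projective_cover_fcover by (auto simp: is_P_def)
  have "fcover (QM (Suc 0) (sgn2 r)) (Om_cover 0) (Om 0 (sgn2 r :: 'k))"
    by (rule fcover_Om[OF sgn2_square assms(2)])
  from fcover_unique[OF this f V_Om] obtain h where "fiso (QM (Suc 0) (sgn2 r)) P h" by blast
  then show thesis using that f by (auto simp: fcover_def D4_projective_def)
qed

lemma sgn2_plus_one: "sgn2 (r + 1) = - (sgn2 r :: 'k::field)"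
  by (cases r) (auto simp: sgn2_def)

text \<open>Each step of \<open>is_Omega\<close> is compared with \<open>Om_cover\<close>, whose
  kernel is the next model with the opposite weight; uniqueness of covers and of submodule
  representatives carries the comparison along.\<close>

lemma is_Omega_Om:
  assumes "is_Omega s (V r) X" "(2 :: 'k::field) \<noteq> 0"
  shows "D4_module X \<and> (\<exists>h. fiso (Om s (sgn2 (r + of_nat s) :: 'k)) X h)"
  using assms(1)
proof (induction s "V r :: 'k rep" X rule: is_Omega.induct)
  case (zero N)
  then obtain h where "fiso (V r) N h"
    using D4_iso_iff[OF wf_V D4_module_wf] by blast
  then have "fiso (Om 0 (sgn2 r)) N (\<lambda>x. h x)" by (rule fiso_comp[OF wf_Om V_Om])
  then show ?case using zero by auto
next
  case (Suc s N P f K)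
  let ?\<rho> = "sgn2 (r + of_nat s) :: 'k"
  have N: "D4_module N" and P: "fcover P (ap f) N"
    using Suc projective_cover_fcover by auto
  obtain h where h: "fiso (Om s ?\<rho>) N h" using Suc by blast
  from fcover_unique[OF fcover_Om[OF sgn2_square assms(2)] P h]
  obtain k where k: "fiso (QM (Suc s) ?\<rho>) P k" "\<And>x. x \<in> elm (QM (Suc s) ?\<rho>) \<Longrightarrow> ap f (k x) = h (Om_cover s x)"
    by blast
  have PM: "D4_module P" using P by (auto simp: fcover_def D4_projective_def)
  obtain i where i: "D4_module K" "i \<in> D4_inj K P" "(*\<^sub>v) i ` space K = mat_kernel f"
    using Suc by (auto simp: is_submodule_rep_def)
  note w = D4_module_wf[OF i(1)] D4_module_wf[OF PM]
  have fc: "f \<in> carrier_mat (mdim N) (mdim P)"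
    using Suc by (auto simp: projective_cover_def D4_surj_def D4_hom_def)
  note ih = D4_inj_fhom[OF w i(2), unfolded i(3) toF_kernel[OF fc]]
  have kh: "fhom (QM (Suc s) ?\<rho>) P k" "inj_on k (elm (QM (Suc s) ?\<rho>))" "k ` elm (QM (Suc s) ?\<rho>) = elm P"
    and hh: "fhom (Om s ?\<rho>) N h" "inj_on h (elm (Om s ?\<rho>))"
    using k(1) h by (auto simp: fiso_def bij_betw_def)
  let ?E = "Om (Suc s) (- ?\<rho>)"
  have e: "fhom ?E P (\<lambda>x. k (Om_syz (Suc s) x))"
    by (rule fhom_comp[OF wf_Om fhom_Om_syz kh(1)])
  have se: "Om_syz (Suc s) ` elm ?E = {x \<in> elm (QM (Suc s) ?\<rho>). Om_cover s x = 0}"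
    using Om_cover_kernel[of s, where ?'a = 'k] by simp
  have inj: "inj_on (\<lambda>x. k (Om_syz (Suc s) x)) (elm ?E)"
  proof (rule comp_inj_on[of "Om_syz (Suc s)" "elm ?E" k, unfolded comp_def])
    show "inj_on (Om_syz (Suc s)) (elm ?E)" using inj_Om_syz[of "Suc s", where ?'a = 'k] by simp
    show "inj_on k (Om_syz (Suc s) ` elm ?E)" unfolding se by (rule inj_on_subset[OF kh(2)]) auto
  qed
  have "(\<lambda>x. k (Om_syz (Suc s) x)) ` elm ?E = k ` {x \<in> elm (QM (Suc s) ?\<rho>). Om_cover s x = 0}"
    unfolding se[symmetric] by (simp add: image_image)
  also have "\<dots> = {y \<in> elm P. ap f y = 0}"
  proof -
    have "ap f (k x) = 0 \<longleftrightarrow> Om_cover s x = 0" if "x \<in> elm (QM (Suc s) ?\<rho>)" for x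
      using k(2)[OF that] fhom_zero_iff[OF hh fhomD(2)[OF fhom_Om_cover that]] by simp
    then have "{x \<in> elm (QM (Suc s) ?\<rho>). Om_cover s x = 0} = {x \<in> elm (QM (Suc s) ?\<rho>). ap f (k x) = 0}"
      by blast
    then show ?thesis unfolding kh(3)[symmetric] by auto
  qed
  also have "\<dots> = ap i ` elm K" using ih(3) .
  finally obtain g where "fiso ?E K g"
    using submodule_rep_unique[OF wf_Om w e inj ih(1,2)] by blast
  moreover have "- ?\<rho> = sgn2 (r + of_nat (Suc s))"
    using sgn2_plus_one[of "r + of_nat s", where ?'k = 'k] by (simp add: ac_simps)
  ultimately show ?case using i(1) by auto
qed

section \<open>Indecomposable modules\<close>

text \<open>M is the direct sum of the image and the kernel of e. One of them must vanish, and f0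
  shows that it is not the image.\<close>

lemma indecomposable_idempotent:
  assumes ind: "indecomposable M" and e: "fhom M M e" "\<And>f. f \<in> elm M \<Longrightarrow> e (e f) = e f"
    and f0: "f0 \<in> elm M" "e f0 \<noteq> 0" and f: "f \<in> elm M"
  shows "e f = f"
proof -
  have M: "D4_module M" using ind by (simp add: indecomposable_def)
  note w = D4_module_wf[OF M] and el = lin_simps[OF fhomD(1)[OF e(1)]]
  obtain N1 h1 where 1: "D4_module N1" "fhom N1 M h1" "inj_on h1 (elm N1)" "h1 ` elm N1 = e ` elm M"
    using submodule_rep_exists[OF M fsub_image[OF e(1) fsub_elm[OF w]]] by blast
  obtain N2 h2 where 2: "D4_module N2" "fhom N2 M h2" "inj_on h2 (elm N2)" "h2 ` elm N2 = {f \<in> elm M. e f = 0}"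
    using submodule_rep_exists[OF M fsub_kernel[OF w e(1)]] by blast
  note w1 = D4_module_wf[OF 1(1)] and w2 = D4_module_wf[OF 2(1)]
  have e1: "e (h1 x) = h1 x" if "x \<in> elm N1" for x
  proof -
    have "h1 x \<in> e ` elm M" using that 1(4) by blast
    then show ?thesis using e(2) by auto
  qed
  have e2: "e (h2 x) = 0" if "x \<in> elm N2" for x
  proof -
    have "h2 x \<in> {f \<in> elm M. e f = 0}" using that 2(4) by blast
    then show ?thesis by simp
  qed
  let ?g = "\<lambda>f. h1 (trunc (mdim N1) f) + h2 (drp (mdim N1) f)"
  have g: "fhom (N1 \<oplus>\<^sub>D N2) M ?g" by (rule fhom_dsum[OF w1 w2 1(2) 2(2)])
  have "inj_on ?g (elm (N1 \<oplus>\<^sub>D N2))"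
  proof (rule lin_inj_onI[OF fhomD(1)[OF g]])
    fix x assume x: "x \<in> elm (N1 \<oplus>\<^sub>D N2)" and 0: "?g x = 0"
    let ?y = "trunc (mdim N1) x" and ?z = "drp (mdim N1) x"
    have yz: "?y \<in> elm N1" "?z \<in> elm N2" using x by (simp_all add: trunc_fsp drp_fsp)
    have "e (?g x) = 0" using 0 el by simp
    then have "h1 ?y = 0" using e1[OF yz(1)] e2[OF yz(2)] by (simp add: el)
    then have y: "?y = 0" using fhom_zero_iff[OF 1(2,3) yz(1)] by simp
    moreover have "h2 ?z = 0" using 0 \<open>h1 ?y = 0\<close> by simp
    then have "?z = 0" using fhom_zero_iff[OF 2(2,3) yz(2)] by simp
    ultimately show "x = 0" using split_fsp[of "mdim N1" x] by (simp add: split_simps)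
  qed
  moreover have "?g ` elm (N1 \<oplus>\<^sub>D N2) = elm M"
  proof
    show "?g ` elm (N1 \<oplus>\<^sub>D N2) \<subseteq> elm M" using fhomD(2)[OF g] by blast
    show "elm M \<subseteq> ?g ` elm (N1 \<oplus>\<^sub>D N2)"
    proof
      fix x assume x: "x \<in> elm M"
      have "e x \<in> h1 ` elm N1" using x 1(4) by simp
      moreover have "x - e x \<in> h2 ` elm N2" unfolding 2(4) using x e fhomD(2)[OF e(1)] by (simp add: el)
      ultimately have "e x + (x - e x) \<in> ?g ` elm (N1 \<oplus>\<^sub>D N2)"
        unfolding mdim_dsum dsum_image[OF fhomD(1)[OF 1(2)] fhomD(1)[OF 2(2)]] by blast
      then show "x \<in> ?g ` elm (N1 \<oplus>\<^sub>D N2)" by simp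
    qed
  qed
  ultimately have "fiso (N1 \<oplus>\<^sub>D N2) M ?g" using g by (simp add: fiso_def bij_betw_def)
  then obtain k where "fiso M (N1 \<oplus>\<^sub>D N2) k" using fiso_inverse[OF wf_dsum[OF w1 w2] w] by blast
  then have "M \<cong>\<^sub>D N1 \<oplus>\<^sub>D N2" using D4_iso_iff[OF w wf_dsum[OF w1 w2]] by blast
  then have "mdim N1 = 0 \<or> mdim N2 = 0" using ind 1(1) 2(1) by (simp add: indecomposable_def)
  moreover have z: "(fsp 0 :: (nat \<Rightarrow> 'a) set) = {0}" by (auto simp: fsp_def fun_eq_iff)
  moreover have "mdim N1 \<noteq> 0"
  proof
    assume "mdim N1 = 0"
    then have "e ` elm M = {0}" using 1(4) z lin_zero[OF fhomD(1)[OF 1(2)]] by simp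
    then show False using f0 by blast
  qed
  ultimately have "h2 ` elm N2 = {0}" using lin_zero[OF fhomD(1)[OF 2(2)]] by simp
  moreover have "f - e f \<in> {f \<in> elm M. e f = 0}" using f e fhomD(2)[OF e(1)] by (simp add: el)
  ultimately show ?thesis unfolding 2(4) by auto
qed

lemma half_half: "(2 :: 'k::field) \<noteq> 0 \<Longrightarrow> inverse 2 * x + inverse 2 * x = (x :: 'k)"
  by (metis distrib_left mult_2 mult.assoc left_inverse mult_1)

lemma half_vec: "(2 :: 'k::field) \<noteq> 0 \<Longrightarrow> inverse 2 \<odot> (f + f) = (f :: 'i \<Rightarrow> 'k)"
  by (rule ext) (simp add: distrib_left half_half)

text \<open>Both b and c anticommute with a and d, so b c commutes with everything and (1 + b c)/2
  is an idempotent endomorphism; it fixes v.\<close>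

lemma indecomposable_bc:
  assumes ind: "indecomposable M" and two: "(2 :: 'k::field) \<noteq> 0"
    and v: "v \<in> elm M" "v \<noteq> 0" "opb M v = \<rho> \<odot> v" "opc M v = \<rho> \<odot> v" "\<rho> * \<rho> = (1 :: 'k)"
    and f: "f \<in> elm M"
  shows "opc M f = opb M f"
proof -
  have M: "D4_module M" using ind by (simp add: indecomposable_def)
  note w = D4_module_wf[OF M]
  define e where "e x = inverse 2 \<odot> (x + opb M (opc M x))" for x
  have e: "fhom M M e"
    unfolding e_def
    by (intro fhomI lin_sm_fun lin_plus lin_id lin_comp[OF lin_ap lin_ap])
      (use w in \<open>simp_all add: ap_simps D4_rules[OF M]\<close>)
  have idem: "e (e x) = e x" if "x \<in> elm M" for x
  proof -
    have "opb M (opc M (opb M (opc M x))) = x" using that w by (simp add: D4_rules[OF M])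
    then have "opb M (opc M (e x)) = e x" by (simp add: e_def ap_simps add.commute)
    then have "e (e x) = inverse 2 \<odot> (e x + e x)" by (simp add: e_def[of "e x"])
    also have "\<dots> = e x" by (rule half_vec[OF two])
    finally show ?thesis .
  qed
  have "opb M (opc M v) = v" using v by (simp add: ap_simps)
  then have "e v = v" by (simp only: e_def half_vec[OF two])
  then have "e f = f" using indecomposable_idempotent[OF ind e idem v(1) _ f] v(2) by simp
  then have "e f + e f = f + f" by simp
  moreover have "e f + e f = f + opb M (opc M f)"
    using half_vec[OF two, of "f + opb M (opc M f)"] by (simp only: e_def fv.scale_right_distrib)
  ultimately have "opb M (opc M f) = f" by simp
  then have "opb M (opb M (opc M f)) = opb M f" by simp
  then show ?thesis using f w by (simp add: D4_rules[OF M])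
qed

section \<open>Maximal submodules when \<open>b = c\<close>\<close>

definition fmax :: "'k::field rep \<Rightarrow> (nat \<Rightarrow> 'k) set \<Rightarrow> (nat \<Rightarrow> 'k) set \<Rightarrow> bool" where
  "fmax M U W \<longleftrightarrow> fsub M U \<and> fsub M W \<and> U \<subset> W \<and> (\<forall>X. fsub M X \<longrightarrow> U \<subseteq> X \<longrightarrow> X \<subseteq> W \<longrightarrow> X = U \<or> X = W)"

lemma toF_image_subset: "U \<subseteq> carrier_vec n \<Longrightarrow> W \<subseteq> carrier_vec n \<Longrightarrow> toF ` U \<subseteq> toF ` W \<longleftrightarrow> U \<subseteq> W"
  by (auto simp: subset_iff image_iff) (metis vec_toF)

lemma toF_image_eq: "U \<subseteq> carrier_vec n \<Longrightarrow> W \<subseteq> carrier_vec n \<Longrightarrow> toF ` U = toF ` W \<longleftrightarrow> U = W"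
  using toF_image_subset by (metis subset_antisym subset_refl)

lemma maximal_in_iff:
  assumes "wf_rep M"
  shows "maximal_in M U W \<longleftrightarrow> U \<subseteq> space M \<and> W \<subseteq> space M \<and> fmax M (toF ` U) (toF ` W)"
proof (cases "U \<subseteq> space M \<and> W \<subseteq> space M")
  case True
  note sub = toF_image_subset[where n = "mdim M"] and eq = toF_image_eq[where n = "mdim M"]
  have "(\<forall>X. D4_submodule M X \<longrightarrow> U \<subseteq> X \<longrightarrow> X \<subseteq> W \<longrightarrow> X = U \<or> X = W) \<longleftrightarrow>
    (\<forall>Y. fsub M Y \<longrightarrow> toF ` U \<subseteq> Y \<longrightarrow> Y \<subseteq> toF ` W \<longrightarrow> Y = toF ` U \<or> Y = toF ` W)" (is "?L \<longleftrightarrow> ?R")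
  proof
    assume L: ?L
    show ?R
    proof (intro allI impI)
      fix Y assume Y: "fsub M Y" "toF ` U \<subseteq> Y" "Y \<subseteq> toF ` W"
      let ?X = "vec (mdim M) ` Y"
      note X = D4_submodule_vec[OF assms Y(1)]
      have s: "?X \<subseteq> space M" by auto
      have "toF ` U \<subseteq> toF ` ?X" "toF ` ?X \<subseteq> toF ` W" using Y(2,3) unfolding X(2) by auto
      then have "U \<subseteq> ?X" "?X \<subseteq> W" using sub[of U ?X] sub[of ?X W] s True by blast+
      then have "?X = U \<or> ?X = W" using L X(1) by blast
      then show "Y = toF ` U \<or> Y = toF ` W" using X(2) by metis
    qed
  next
    assume R: ?R
    show ?L
    proof (intro allI impI)
      fix X assume X: "D4_submodule M X" "U \<subseteq> X" "X \<subseteq> W"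
      then have "fsub M (toF ` X)" "X \<subseteq> space M" using D4_submodule_iff[OF assms] by auto
      then show "X = U \<or> X = W" using R X(2,3) eq[of X U] eq[of X W] True by (metis image_mono)
    qed
  qed
  then show ?thesis
    using True sub[of U W] sub[of W U] by (auto simp: maximal_in_def fmax_def D4_submodule_iff[OF assms] less_le_not_le)
qed (auto simp: maximal_in_def D4_submodule_iff[OF assms])

text \<open>The block b c = 1: here a and d satisfy the relations of an exterior algebra, on which b
  acts by signs.\<close>

locale bc_module =
  fixes M :: "'k::field rep"
  assumes mod: "D4_module M" and two: "(2 :: 'k) \<noteq> 0" and bc: "\<And>f. f \<in> elm M \<Longrightarrow> opc M f = opb M f"
begin

lemma wf: "wf_rep M"
  using D4_module_wf[OF mod] .

lemma da: "f \<in> elm M \<Longrightarrow> opd M (opa M f) = - opa M (opd M f)"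
  using D4_rules(7,10)[OF mod, of f] bc[of f] by simp

lemmas rules = D4_rules(1,2,6,7,9)[OF mod] da bc op_elm[OF wf]

text \<open>A nilpotent operator annihilates the simple module W/U: U + op W is a submodule between
  U and W, and if it is all of W, then w = u + op v gives op w = op u, which lies in U.\<close>

lemma max_op:
  assumes UW: "fmax M U W" and op: "lin op" "\<And>w. w \<in> W \<Longrightarrow> op w \<in> W" "\<And>w. w \<in> W \<Longrightarrow> op (op w) = 0"
    "\<And>w. w \<in> W \<Longrightarrow> \<exists>y\<in>W. opa M (op w) = op y" "\<And>w. w \<in> W \<Longrightarrow> \<exists>y\<in>W. opb M (op w) = op y"
    "\<And>w. w \<in> W \<Longrightarrow> \<exists>y\<in>W. opd M (op w) = op y" "\<And>u. u \<in> U \<Longrightarrow> op u \<in> U"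
    and w: "w \<in> W"
  shows "op w \<in> U"
proof -
  have U: "fsub M U" and W: "fsub M W" and sub: "U \<subseteq> W" using UW by (auto simp: fmax_def)
  let ?X = "{u + op w |u w. u \<in> U \<and> w \<in> W}"
  have XW: "?X \<subseteq> W" using sub op(2) fsubD(8)[OF W] by blast
  have step: "A (u + op w) \<in> ?X" if "lin A" "\<And>u. u \<in> U \<Longrightarrow> A u \<in> U" "\<And>w. w \<in> W \<Longrightarrow> \<exists>y\<in>W. A (op w) = op y"
    "u \<in> U" "w \<in> W" for A :: "(nat \<Rightarrow> 'k) \<Rightarrow> nat \<Rightarrow> 'k" and u w
    using that by (auto simp: lin_add[OF that(1)]) metis
  have X: "fsub M ?X"
  proof (rule fsubI)
    show "?X \<subseteq> elm M" using XW fsubD(2)[OF W] by blast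
    have "0 + op 0 \<in> ?X" using fsubD(7)[OF U] fsubD(7)[OF W] by blast
    then show "0 \<in> ?X" by (simp add: lin_zero[OF op(1)])
    fix f g assume f: "f \<in> ?X" "g \<in> ?X"
    then obtain u w u' w' where "f = u + op w" "g = u' + op w'" "u \<in> U" "w \<in> W" "u' \<in> U" "w' \<in> W" by blast
    moreover from this have "f + g = (u + u') + op (w + w')" by (simp add: lin_add[OF op(1)])
    ultimately show "f + g \<in> ?X" using fsubD(8)[OF U] fsubD(8)[OF W] by blast
  next
    fix c f assume "f \<in> ?X"
    then obtain u w where f: "f = u + op w" "u \<in> U" "w \<in> W" by blast
    moreover from this have "c \<odot> f = c \<odot> u + op (c \<odot> w)" by (simp add: lin_sm[OF op(1)] fv.scale_right_distrib)
    ultimately show "c \<odot> f \<in> ?X" using fsubD(10)[OF U] fsubD(10)[OF W] by blast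
  next
    fix f assume "f \<in> ?X"
    then obtain u w where f: "f = u + op w" "u \<in> U" "w \<in> W" by blast
    show "opa M f \<in> ?X" unfolding f(1) by (rule step) (use op(4) f fsubD(3)[OF U] lin_ap in auto)
    show b: "opb M f \<in> ?X" unfolding f(1) by (rule step) (use op(5) f fsubD(4)[OF U] lin_ap in auto)
    have "f \<in> elm M" using f op(2) fsubD(2)[OF U] fsubD(2)[OF W] by simp
    then show "opc M f \<in> ?X" using b bc by simp
    show "opd M f \<in> ?X" unfolding f(1) by (rule step) (use op(6) f fsubD(6)[OF U] lin_ap in auto)
  qed
  have "U \<subseteq> ?X"
  proof
    fix u assume "u \<in> U"
    then have "u + op 0 \<in> ?X" using fsubD(7)[OF W] by blast
    then show "u \<in> ?X" by (simp add: lin_zero[OF op(1)])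
  qed
  then consider "?X = U" | "?X = W" using UW X XW unfolding fmax_def by blast
  then show ?thesis
  proof cases
    case 1
    have "0 + op w \<in> ?X" using w fsubD(7)[OF U] by blast
    then show ?thesis using 1 by simp
  next
    case 2
    then obtain u v where uv: "w = u + op v" "u \<in> U" "v \<in> W" using w by blast
    then show ?thesis using op(3)[OF uv(3)] op(7)[OF uv(2)] by (simp add: lin_add[OF op(1)])
  qed
qed

lemma max_ad:
  assumes "fmax M U W" "w \<in> W"
  shows "opa M w \<in> U" "opd M w \<in> U"
proof -
  have U: "fsub M U" and W: "fsub M W" using assms(1) by (auto simp: fmax_def)
  note We = fsubD(2)[OF W] and Wc = fsubD[OF W]
  show "opa M w \<in> U"
  proof (rule max_op[OF assms(1) lin_ap _ _ _ _ _ _ assms(2)])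
    fix x assume x: "x \<in> W"
    show "\<exists>y\<in>W. opa M (opa M x) = opa M y"
      using We[OF x] Wc(7) by (intro bexI[of _ 0]) (simp_all add: rules ap_simps)
    show "\<exists>y\<in>W. opb M (opa M x) = opa M y"
      using We[OF x] Wc(4,11) x by (intro bexI[of _ "- opb M x"]) (simp_all add: rules ap_simps)
    show "\<exists>y\<in>W. opd M (opa M x) = opa M y"
      using We[OF x] Wc(6,11) x by (intro bexI[of _ "- opd M x"]) (simp_all add: rules ap_simps)
  qed (use Wc fsubD(3)[OF U] We in \<open>auto simp: rules\<close>)
  show "opd M w \<in> U"
  proof (rule max_op[OF assms(1) lin_ap _ _ _ _ _ _ assms(2)])
    fix x assume x: "x \<in> W"
    show "\<exists>y\<in>W. opa M (opd M x) = opd M y"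
      using We[OF x] Wc(3,11) x by (intro bexI[of _ "- opa M x"]) (simp_all add: rules ap_simps)
    show "\<exists>y\<in>W. opb M (opd M x) = opd M y"
      using We[OF x] Wc(4,11) x by (intro bexI[of _ "- opb M x"]) (simp_all add: rules ap_simps)
    show "\<exists>y\<in>W. opd M (opd M x) = opd M y"
      using We[OF x] Wc(7) by (intro bexI[of _ 0]) (simp_all add: rules ap_simps)
  qed (use Wc fsubD(6)[OF U] We in \<open>auto simp: rules\<close>)
qed

text \<open>A simple factor has dimension one, because a and d annihilate it and it contains an
  eigenvector of b.\<close>

lemma max_step:
  assumes UW: "fmax M U W" and h: "lin h" "inj_on h (fsp i)" "h ` fsp i = U"
  obtains g where "lin g" "inj_on g (fsp (Suc i))" "g ` fsp (Suc i) = W"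
proof -
  have U: "fsub M U" and W: "fsub M W" and sub: "U \<subset> W" using UW by (auto simp: fmax_def)
  obtain w where w: "w \<in> W" "w \<notin> U" using sub by blast
  have we: "w \<in> elm M" using fsubD(2)[OF W w(1)] .
  \<comment> \<open>As w is half the sum of w + b w and w - b w, these do not both lie in U.\<close>
  have "\<exists>\<epsilon>. \<epsilon> * \<epsilon> = 1 \<and> w + \<epsilon> \<odot> opb M w \<notin> U"
  proof (rule ccontr)
    assume "\<not> ?thesis"
    then have "w + 1 \<odot> opb M w \<in> U" "w + (- 1) \<odot> opb M w \<in> U" by (auto simp del: fv.scale_minus_left fv.scale_one)
    then have "inverse 2 \<odot> ((w + 1 \<odot> opb M w) + (w + (- 1) \<odot> opb M w)) \<in> U" using fsubD(8,10)[OF U] by blast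
    moreover have "inverse 2 \<odot> ((w + 1 \<odot> opb M w) + (w + (- 1) \<odot> opb M w)) = w"
      using half_half[OF two] by (simp add: fun_eq_iff algebra_simps)
    ultimately show False using w(2) by metis
  qed
  then obtain \<epsilon> where \<epsilon>: "\<epsilon> * \<epsilon> = 1" "w + \<epsilon> \<odot> opb M w \<notin> U" by blast
  define y where "y = w + \<epsilon> \<odot> opb M w"
  have y: "y \<in> W" "y \<notin> U" using \<epsilon>(2) w(1) fsubD(4,8,10)[OF W] by (auto simp: y_def)
  have ye: "y \<in> elm M" using fsubD(2)[OF W y(1)] .
  have yb: "opb M y = \<epsilon> \<odot> y"
    using we \<epsilon>(1) by (simp add: y_def ap_simps rules fv.scale_right_distrib add.commute)
  let ?X = "{u + c \<odot> y |u c. u \<in> U}"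
  have XW: "?X \<subseteq> W" using sub y(1) fsubD(8,10)[OF W] by blast
  have X: "fsub M ?X"
  proof (rule fsubI)
    show "?X \<subseteq> elm M" using XW fsubD(2)[OF W] by blast
    have "0 + 0 \<odot> y \<in> ?X" using fsubD(7)[OF U] by blast
    then show "0 \<in> ?X" by simp
    fix f g assume f: "f \<in> ?X" "g \<in> ?X"
    then obtain u c u' c' where "f = u + c \<odot> y" "g = u' + c' \<odot> y" "u \<in> U" "u' \<in> U" by blast
    moreover from this have "f + g = (u + u') + (c + c') \<odot> y" by (simp add: fv.scale_left_distrib)
    ultimately show "f + g \<in> ?X" using fsubD(8)[OF U] by blast
  next
    fix c f assume "f \<in> ?X"
    then obtain u c' where f: "f = u + c' \<odot> y" "u \<in> U" by blast
    moreover from this have "c \<odot> f = c \<odot> u + (c * c') \<odot> y" by (simp add: fv.scale_right_distrib)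
    ultimately show "c \<odot> f \<in> ?X" using fsubD(10)[OF U] by blast
  next
    fix f assume "f \<in> ?X"
    then obtain u c where f: "f = u + c \<odot> y" "u \<in> U" by blast
    have "opa M u + c \<odot> opa M y \<in> U" using max_ad[OF UW y(1)] fsubD(3,8,10)[OF U] f(2) by blast
    then have "(opa M u + c \<odot> opa M y) + 0 \<odot> y \<in> ?X" by blast
    then show "opa M f \<in> ?X" by (simp add: f ap_simps)
    have "opd M u + c \<odot> opd M y \<in> U" using max_ad[OF UW y(1)] fsubD(6,8,10)[OF U] f(2) by blast
    then have "(opd M u + c \<odot> opd M y) + 0 \<odot> y \<in> ?X" by blast
    then show "opd M f \<in> ?X" by (simp add: f ap_simps)
    have "opb M u + (c * \<epsilon>) \<odot> y \<in> ?X" using fsubD(4)[OF U f(2)] by blast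
    then show b: "opb M f \<in> ?X" by (simp add: f ap_simps yb)
    have "f \<in> elm M" using f ye fsubD(2)[OF U] by simp
    then show "opc M f \<in> ?X" using b bc by simp
  qed
  have UX: "U \<subseteq> ?X"
  proof
    fix u assume "u \<in> U"
    then have "u + 0 \<odot> y \<in> ?X" by blast
    then show "u \<in> ?X" by simp
  qed
  have "0 + 1 \<odot> y \<in> ?X" using fsubD(7)[OF U] by blast
  then have "y \<in> ?X" by simp
  then have eq: "?X = W" using UW X XW UX y(2) unfolding fmax_def by blast
  have yh: "y \<notin> h ` fsp i" using y(2) h(3) by simp
  obtain g where g: "lin g" "inj_on g (fsp (Suc i))" "\<And>f. \<exists>x\<in>fsp i. \<exists>c. g f = h x + c \<odot> y"
    "\<And>x c. x \<in> fsp i \<Longrightarrow> h x + c \<odot> y \<in> g ` fsp (Suc i)"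
    by (rule inj_extend[OF h(1,2) yh]) (rule that)
  have "g f \<in> ?X" for f
    using g(3)[of f] h(3) by blast
  moreover have "f \<in> g ` fsp (Suc i)" if f: "f \<in> ?X" for f
  proof -
    obtain u c where "f = u + c \<odot> y" "u \<in> U" using f by blast
    then show ?thesis using g(4) h(3) by auto
  qed
  ultimately have "g ` fsp (Suc i) = W" unfolding eq[symmetric] by blast
  then show thesis using that g(1,2) by blast
qed

text \<open>Along a composition series the dimension grows by exactly one at each step.\<close>

lemma length_eq_dim:
  assumes "has_length M n"
  shows "mdim M = n"
proof -
  obtain W where W: "W 0 = zero_sub M" "W n = space M" "\<And>i. i < n \<Longrightarrow> maximal_in M (W i) (W (Suc i))"
    using assms by (auto simp: has_length_def)
  have "\<exists>h. lin h \<and> inj_on h (fsp i) \<and> h ` fsp i = toF ` W i" if "i \<le> n" for i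
    using that
  proof (induction i)
    case 0
    have "(fsp 0 :: (nat \<Rightarrow> 'k) set) = {0}" by (auto simp: fsp_def fun_eq_iff)
    then have "inj_on (\<lambda>_. 0) (fsp 0 :: (nat \<Rightarrow> 'k) set) \<and> (\<lambda>_. 0) ` (fsp 0 :: (nat \<Rightarrow> 'k) set) = toF ` W 0"
      using W(1) by (simp add: toF_zero)
    then show ?case using lin_zero_fun by blast
  next
    case (Suc i)
    then obtain h where h: "lin h" "inj_on h (fsp i)" "h ` fsp i = toF ` W i" by auto
    have "fmax M (toF ` W i) (toF ` W (Suc i))" using W(3)[of i] Suc maximal_in_iff[OF wf] by auto
    from max_step[OF this h] show ?case by metis
  qed
  then obtain h where h: "lin h" "inj_on h (fsp n)" "h ` fsp n = elm M" using W(2) toF_image by (metis order_refl)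
  then have "n \<le> mdim M" by (intro lin_inj_dim[OF h(1,2)]) auto
  then show ?thesis using lin_surj_dim[OF h(1,3)] by simp
qed

section \<open>The radical when \<open>b = c\<close>\<close>

definition frad :: "(nat \<Rightarrow> 'k) set \<Rightarrow> (nat \<Rightarrow> 'k) set" where
  "frad S = S \<inter> \<Inter>{U. fmax M U S}"

lemma fsub_frad: "fsub M S \<Longrightarrow> fsub M (frad S)"
proof (rule fsubI)
  assume S: "fsub M S"
  have U: "fsub M U" if "fmax M U S" for U using that by (simp add: fmax_def)
  show "frad S \<subseteq> elm M" using fsubD(2)[OF S] by (auto simp: frad_def)
  show "0 \<in> frad S" using fsubD(7)[OF S] fsubD(7)[OF U] by (simp add: frad_def)
  show "f + g \<in> frad S" if "f \<in> frad S" "g \<in> frad S" for f g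
    using that fsubD(8)[OF S] fsubD(8)[OF U] by (simp add: frad_def)
  show "c \<odot> f \<in> frad S" if "f \<in> frad S" for c f
    using that fsubD(10)[OF S] fsubD(10)[OF U] by (simp add: frad_def)
  show "opa M f \<in> frad S" if "f \<in> frad S" for f
    using that fsubD(3)[OF S] fsubD(3)[OF U] by (simp add: frad_def)
  show "opb M f \<in> frad S" if "f \<in> frad S" for f
    using that fsubD(4)[OF S] fsubD(4)[OF U] by (simp add: frad_def)
  show "opc M f \<in> frad S" if "f \<in> frad S" for f
    using that fsubD(5)[OF S] fsubD(5)[OF U] by (simp add: frad_def)
  show "opd M f \<in> frad S" if "f \<in> frad S" for f
    using that fsubD(6)[OF S] fsubD(6)[OF U] by (simp add: frad_def)
qed

lemma toF_rad:
  assumes "W \<subseteq> space M"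
  shows "toF ` rad M W = frad (toF ` W)"
proof -
  have "toF v \<in> frad (toF ` W) \<longleftrightarrow> v \<in> rad M W" if v: "v \<in> W" for v
  proof -
    have "(\<forall>U. maximal_in M U W \<longrightarrow> v \<in> U) \<longleftrightarrow> (\<forall>Y. fmax M Y (toF ` W) \<longrightarrow> toF v \<in> Y)"
    proof (intro iffI allI impI)
      fix Y assume L: "\<forall>U. maximal_in M U W \<longrightarrow> v \<in> U" and Y: "fmax M Y (toF ` W)"
      have fY: "fsub M Y" using Y by (simp add: fmax_def)
      have e: "toF ` vec (mdim M) ` Y = Y" using D4_submodule_vec(2)[OF wf fY] .
      have "maximal_in M (vec (mdim M) ` Y) W" unfolding maximal_in_iff[OF wf] e using Y assms by auto
      then show "toF v \<in> Y" using L e by blast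
    next
      fix U assume R: "\<forall>Y. fmax M Y (toF ` W) \<longrightarrow> toF v \<in> Y" and U: "maximal_in M U W"
      then have "toF v \<in> toF ` U" "U \<subseteq> space M" using maximal_in_iff[OF wf] by auto
      moreover have "v \<in> space M" using v assms by auto
      ultimately show "v \<in> U" using toF_image_subset[of "{v}" "mdim M" U] by auto
    qed
    then show ?thesis using v by (auto simp: rad_def frad_def)
  qed
  then show ?thesis by (auto simp: rad_def frad_def)
qed

lemma frad_lower:
  assumes "fsub M S" "f \<in> S"
  shows "opa M f \<in> frad S" "opd M f \<in> frad S"
  using assms max_ad fsubD(3,6)[OF assms(1)] by (auto simp: frad_def)

text \<open>If x lies outside aS + dS, a functional vanishing on aS + dS but not at x can be made an
  eigenvector for b; its kernel in S is then a maximal submodule that misses x.\<close>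

lemma frad_upper:
  assumes S: "fsub M S" and x: "x \<in> frad S"
  shows "\<exists>y\<in>S. \<exists>z\<in>S. x = opa M y + opd M z"
proof (rule ccontr)
  assume nx: "\<not> ?thesis"
  note Sc = fsubD[OF S]
  let ?R = "{opa M y + opd M z |y z. y \<in> S \<and> z \<in> S}"
  have R: "fv.subspace ?R"
    unfolding fv.subspace_def
  proof (intro conjI ballI allI)
    show "0 \<in> ?R" using Sc(7) by (intro CollectI exI[of _ 0]) (simp add: ap_simps)
    fix f assume "f \<in> ?R"
    then obtain y z where f: "f = opa M y + opd M z" "y \<in> S" "z \<in> S" by blast
    show "c \<odot> f \<in> ?R" for c
      using f Sc(10) by (intro CollectI exI[of _ "c \<odot> y"] exI[of _ "c \<odot> z"]) (simp add: ap_simps fv.scale_right_distrib)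
    fix g assume "g \<in> ?R"
    then obtain y' z' where g: "g = opa M y' + opd M z'" "y' \<in> S" "z' \<in> S" by blast
    show "f + g \<in> ?R"
      using f g Sc(8) by (intro CollectI exI[of _ "y + y'"] exI[of _ "z + z'"]) (simp add: ap_simps)
  qed
  have "x \<notin> ?R" using nx by blast
  then obtain \<phi> where \<phi>: "\<And>x y. \<phi> (x + y) = \<phi> x + \<phi> y" "\<And>c x. \<phi> (c \<odot> x) = c * \<phi> x" "\<phi> x = 1" "\<And>x. x \<in> ?R \<Longrightarrow> \<phi> x = 0"
    using functional_exists[OF R] by blast
  have xS: "x \<in> S" using x by (simp add: frad_def)
  \<comment> \<open>The values for the two signs add up to 2 \<phi> x, so one of them is
    nonzero.\<close>
  have "\<exists>\<epsilon>. \<epsilon> * \<epsilon> = 1 \<and> \<phi> x + \<epsilon> * \<phi> (opb M x) \<noteq> 0"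
  proof (rule ccontr)
    assume "\<not> ?thesis"
    then have n: "\<epsilon> * \<epsilon> = 1 \<Longrightarrow> \<phi> x + \<epsilon> * \<phi> (opb M x) = 0" for \<epsilon> by blast
    have "\<phi> x + \<phi> (opb M x) = 0" "\<phi> x - \<phi> (opb M x) = 0" using n[of 1] n[of "- 1"] by simp_all
    then have "(\<phi> x + \<phi> (opb M x)) + (\<phi> x - \<phi> (opb M x)) = 0" by (simp only: add_0)
    then have "\<phi> x + \<phi> x = 0" by (simp add: algebra_simps)
    then show False using \<phi>(3) two by simp
  qed
  then obtain \<epsilon> where \<epsilon>: "\<epsilon> * \<epsilon> = 1" "\<phi> x + \<epsilon> * \<phi> (opb M x) \<noteq> 0" by blast
  define g where "g v = \<phi> v + \<epsilon> * \<phi> (opb M v)" for v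
  have g: "g (v + w) = g v + g w" "g (c \<odot> v) = c * g v" for v w c
    by (simp_all add: g_def ap_simps \<phi>(1,2) algebra_simps)
  have gR: "g (opa M v) = 0" "g (opd M v) = 0" if "v \<in> S" for v
  proof -
    have "opa M v + opd M 0 \<in> ?R" "opa M (- opb M v) + opd M 0 \<in> ?R" "opa M 0 + opd M v \<in> ?R" "opa M 0 + opd M (- opb M v) \<in> ?R"
      using that Sc(4,7,11) by blast+
    then show "g (opa M v) = 0" "g (opd M v) = 0"
      using \<phi>(4) Sc(2)[OF that] by (simp_all add: ap_simps g_def rules)
  qed
  let ?H = "{v \<in> S. g v = 0}"
  have H: "fsub M ?H"
  proof (rule fsubI)
    have "g 0 = 0" using g(2)[of 0 0] by simp
    then show "0 \<in> ?H" using Sc(7) by simp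
    show b: "opb M f \<in> ?H" if "f \<in> ?H" for f
    proof -
      have fe: "f \<in> elm M" using that Sc(2) by simp
      have "g (opb M f) = \<epsilon> * g f"
        using fe \<epsilon>(1) by (simp add: g_def rules distrib_left add.commute flip: mult.assoc)
      then show ?thesis using that Sc(4) by simp
    qed
    show "opc M f \<in> ?H" if "f \<in> ?H" for f using b[OF that] that Sc(2) bc by simp
  qed (use Sc g gR in auto)
  have "fmax M ?H S"
    unfolding fmax_def
  proof (intro conjI H S allI impI)
    show "?H \<subset> S" using xS \<epsilon>(2) by (auto simp: g_def)
    fix X assume X: "fsub M X" "?H \<subseteq> X" "X \<subseteq> S"
    show "X = ?H \<or> X = S"
    proof (cases "X = ?H")
      case False
      then obtain z where z: "z \<in> X" "g z \<noteq> 0" "z \<in> S" using X by blast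
      have "v \<in> X" if v: "v \<in> S" for v
      proof -
        let ?k = "(- (g v / g z)) \<odot> z"
        have "v + ?k \<in> ?H" using v z Sc(8,10) by (simp add: g del: fv.scale_minus_left)
        then have "v + ?k \<in> X" using X(2) by blast
        then have "(v + ?k) - ?k \<in> X" using z(1) fsubD(9,10)[OF X(1)] by blast
        then show ?thesis by simp
      qed
      then show ?thesis using X(3) by blast
    qed blast
  qed
  then have "x \<in> ?H" using x by (auto simp: frad_def)
  then show False using \<epsilon>(2) by (simp add: g_def)
qed

text \<open>The second power of the radical is zero, and it contains every a d f.\<close>

lemma Loewy_length_2:
  assumes "Loewy_length M = 2" "f \<in> elm M"
  shows "opa M (opd M f) = 0"
proof -
  have iter: "(rad M ^^ n) (space M) \<subseteq> space M \<and> toF ` (rad M ^^ n) (space M) = (frad ^^ n) (elm M)" for n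
  proof (induction n)
    case (Suc n)
    moreover have "rad M ((rad M ^^ n) (space M)) \<subseteq> (rad M ^^ n) (space M)" by (auto simp: rad_def)
    ultimately show ?case using toF_rad[of "(rad M ^^ n) (space M)"] by auto
  qed (simp add: toF_image)
  have sub: "fsub M ((frad ^^ n) (elm M))" for n
    by (induction n) (auto simp: fsub_frad fsub_elm[OF wf])
  have up: "\<exists>y\<in>(frad ^^ n) (elm M). \<exists>z\<in>(frad ^^ n) (elm M). x = opa M y + opd M z"
    if "x \<in> (frad ^^ Suc n) (elm M)" for x n
    using frad_upper[OF sub] that by simp
  \<comment> \<open>\<open>LEAST\<close> is informative only once some power is known to vanish. The
    third one does, because every product of three of the operators a, d is zero.\<close>
  have "x = 0" if "x \<in> (frad ^^ 3) (elm M)" for x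
  proof -
    have "x \<in> (frad ^^ Suc (Suc (Suc 0))) (elm M)" using that by (simp only: numeral_3_eq_3)
    then obtain y z where 1: "x = opa M y + opd M z" "y \<in> (frad ^^ Suc (Suc 0)) (elm M)" "z \<in> (frad ^^ Suc (Suc 0)) (elm M)"
      using up by blast
    have "opa M y = 0 \<and> opd M y = 0" if y2: "y \<in> (frad ^^ Suc (Suc 0)) (elm M)" for y
    proof -
      obtain v w where y: "y = opa M v + opd M w" "v \<in> (frad ^^ Suc 0) (elm M)" "w \<in> (frad ^^ Suc 0) (elm M)"
        using up[OF y2] by blast
      obtain v1 v2 w1 w2 where "v = opa M v1 + opd M v2" "w = opa M w1 + opd M w2"
        "v1 \<in> elm M" "v2 \<in> elm M" "w1 \<in> elm M" "w2 \<in> elm M"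
        using up[OF y(2)] up[OF y(3)] by auto
      then show ?thesis unfolding y(1) by (simp add: ap_simps rules)
    qed
    then show ?thesis using 1 by simp
  qed
  then have "(frad ^^ 3) (elm M) = {0}" using fsubD(7)[OF sub] by blast
  then have "toF ` (rad M ^^ 3) (space M) = toF ` zero_sub M" using iter[of 3] by (simp add: toF_zero)
  then have "(rad M ^^ 3) (space M) = zero_sub M"
    using iter[of 3] toF_image_eq[of "(rad M ^^ 3) (space M)" "mdim M" "zero_sub M"] by simp
  then have "(rad M ^^ 2) (space M) = zero_sub M"
    using assms(1) LeastI[of "\<lambda>n. (rad M ^^ n) (space M) = zero_sub M" 3] by (simp add: Loewy_length_def)
  then have "(frad ^^ 2) (elm M) = {0}" using iter[of 2] by (simp add: toF_zero)
  moreover have "opa M (opd M f) \<in> (frad ^^ 2) (elm M)"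
    using frad_lower(1)[OF sub[of 1]] frad_lower(2)[OF sub[of 0]] assms(2) by (simp add: numeral_2_eq_2)
  ultimately show ?thesis by simp
qed

end

section \<open>Indecomposable modules of Loewy length two\<close>

text \<open>What is known of M_t(r, \<eta>) with \<rho> = (-1)^(r+1). The vector on which a does not
  vanish decides which of the two weights belongs to the top.\<close>

locale ll2_module = bc_module M for M :: "'k::field rep" +
  fixes \<rho> \<eta> :: 'k
  assumes ind: "indecomposable M" and ad: "\<And>f. f \<in> elm M \<Longrightarrow> opa M (opd M f) = 0"
    and \<rho>: "\<rho> * \<rho> = 1"
    and top_nontrivial: "\<exists>v. v \<in> elm M \<and> opb M v = \<rho> \<odot> v \<and> opa M v \<noteq> 0"
begin

lemma \<rho>2: "\<rho> * (\<rho> * x) = x"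
  using \<rho> by (simp flip: mult.assoc)

text \<open>The idempotent projects onto the sum of a complement of the socle in the \<open>\<rho>\<close>-eigenspace of
  \<open>b\<close> and the socle in the \<open>-\<rho>\<close>-eigenspace; it commutes with \<open>a\<close> and \<open>d\<close> as these map into the socle
  and exchange the two eigenspaces.\<close>

lemma socle_cases:
  shows "f \<in> elm M \<Longrightarrow> opb M f = - (\<rho> \<odot> f) \<Longrightarrow> opa M f = 0 \<and> opd M f = 0"
    and "f \<in> elm M \<Longrightarrow> opb M f = \<rho> \<odot> f \<Longrightarrow> opa M f = 0 \<Longrightarrow> opd M f = 0 \<Longrightarrow> f = 0"
proof -
  let ?K = "{x \<in> elm M. opa M x = 0 \<and> opd M x = 0}"
  have K: "fv.subspace ?K" by (auto simp: fv.subspace_def ap_simps)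
  obtain p where p: "lin p" "\<And>x. p x \<in> ?K" "\<And>x. x \<in> ?K \<Longrightarrow> p x = x"
    using projection_exists[OF K] by blast
  have pe: "p x \<in> elm M" "opa M (p x) = 0" "opd M (p x) = 0" for x using p(2)[of x] by auto
  \<comment> \<open>Averaging p over b gives a projection onto the common kernel of a and d that
    commutes with b.\<close>
  define \<pi> where "\<pi> x = inverse 2 \<odot> (p x + opb M (p (opb M x)))" for x
  have \<pi>l: "lin \<pi>"
    unfolding \<pi>_def by (intro lin_sm_fun lin_plus p(1) lin_comp[OF lin_ap lin_comp[OF p(1) lin_ap]])
  have \<pi>K: "\<pi> x \<in> elm M" "opa M (\<pi> x) = 0" "opd M (\<pi> x) = 0" for x
  proof -
    have "opa M (opb M (p y)) = 0" "opd M (opb M (p y)) = 0" for y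
      using D4_rules(1,2)[OF mod pe(1)[of y]] pe(2,3)[of y] by (simp_all add: ap_simps)
    then show "\<pi> x \<in> elm M" "opa M (\<pi> x) = 0" "opd M (\<pi> x) = 0"
      using pe by (simp_all add: \<pi>_def ap_simps rules)
  qed
  have \<pi>id: "\<pi> x = x" if x: "x \<in> elm M" "opa M x = 0" "opd M x = 0" for x
  proof -
    have "opa M (opb M x) = 0" "opd M (opb M x) = 0"
      using D4_rules(1,2)[OF mod x(1)] x(2,3) by (simp_all add: ap_simps)
    then have "p x = x" "p (opb M x) = opb M x" using p(3) x by (simp_all add: rules)
    moreover have "opb M (opb M x) = x" using x(1) by (rule rules)
    ultimately show ?thesis by (simp only: \<pi>_def half_vec[OF two])
  qed
  have \<pi>b: "\<pi> (opb M x) = opb M (\<pi> x)" if "x \<in> elm M" for x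
    using that pe by (simp add: \<pi>_def ap_simps rules add.commute)
  \<comment> \<open>This is 1 - \<pi> on weight \<rho> and \<pi> on weight -\<rho>.\<close>
  define e where "e x = inverse 2 \<odot> (x + \<rho> \<odot> opb M x) - \<rho> \<odot> opb M (\<pi> x)" for x
  have el: "lin e"
    unfolding e_def
    by (intro lin_minus_fun lin_sm_fun lin_plus lin_id lin_ap lin_comp[OF lin_ap \<pi>l])
  have ab\<pi>: "opa M (opb M (\<pi> x)) = 0" "opd M (opb M (\<pi> x)) = 0" for x
    using D4_rules(1,2)[OF mod \<pi>K(1)[of x]] \<pi>K(2,3)[of x] by (simp_all add: ap_simps)
  have \<pi>a: "\<pi> (opa M x) = opa M x" "\<pi> (opd M x) = opd M x" if "x \<in> elm M" for x
    using that ad by (auto intro!: \<pi>id simp: rules)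
  have eh: "fhom M M e"
  proof (intro fhomI el)
    fix x assume x: "x \<in> elm M"
    show "e x \<in> elm M" using x \<pi>K by (simp add: e_def rules)
    show eb: "e (opb M x) = opb M (e x)"
      using x \<pi>K by (simp add: e_def ap_simps rules \<pi>b)
    show "e (opc M x) = opc M (e x)"
      using x eb \<open>e x \<in> elm M\<close> by (simp add: bc)
    show "e (opa M x) = opa M (e x)"
      using x half_half[OF two]
      by (simp add: e_def ap_simps rules \<pi>a ab\<pi> fun_eq_iff algebra_simps)
    show "e (opd M x) = opd M (e x)"
      using x half_half[OF two]
      by (simp add: e_def ap_simps rules \<pi>a ab\<pi> fun_eq_iff algebra_simps)
  qed
  have idem: "e (e x) = e x" if x: "x \<in> elm M" for x
  proof -
    have 1: "\<pi> (e x) = inverse 2 \<odot> (\<pi> x - \<rho> \<odot> opb M (\<pi> x))"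
    proof -
      have "\<pi> (opb M (\<pi> x)) = opb M (\<pi> x)" using \<pi>b[OF \<pi>K(1)] \<pi>id[OF \<pi>K] by simp
      then have "\<pi> (e x) = inverse 2 \<odot> (\<pi> x + \<rho> \<odot> opb M (\<pi> x)) - \<rho> \<odot> opb M (\<pi> x)"
        using x by (simp add: e_def lin_simps[OF \<pi>l] \<pi>b)
      also have "\<dots> = inverse 2 \<odot> (\<pi> x - \<rho> \<odot> opb M (\<pi> x))"
      proof
        fix i
        have "inverse 2 * (\<rho> * opb M (\<pi> x) i) + inverse 2 * (\<rho> * opb M (\<pi> x) i) = \<rho> * opb M (\<pi> x) i"
          by (rule half_half[OF two])
        then show "(inverse 2 \<odot> (\<pi> x + \<rho> \<odot> opb M (\<pi> x)) - \<rho> \<odot> opb M (\<pi> x)) i = (inverse 2 \<odot> (\<pi> x - \<rho> \<odot> opb M (\<pi> x))) i"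
          by (simp add: algebra_simps)
      qed
      finally show ?thesis .
    qed
    have 2: "opb M (e x) = inverse 2 \<odot> (opb M x + \<rho> \<odot> x) - \<rho> \<odot> \<pi> x"
      using x \<pi>K by (simp add: e_def ap_simps rules)
    have 3: "opb M (\<pi> (e x)) = inverse 2 \<odot> (opb M (\<pi> x) - \<rho> \<odot> \<pi> x)"
      unfolding 1 using \<pi>K by (simp add: ap_simps rules)
    show ?thesis
    proof
      fix i
      let ?x = "x i" and ?b = "opb M x i" and ?p = "\<pi> x i" and ?q = "opb M (\<pi> x) i"
      have ei: "e x i = inverse 2 * (?x + \<rho> * ?b) - \<rho> * ?q" by (simp add: e_def)
      have "e (e x) i = inverse 2 * (e x i + \<rho> * opb M (e x) i) - \<rho> * opb M (\<pi> (e x)) i"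
        unfolding e_def[of "e x"] by simp
      also have "\<dots> = inverse 2 * ((inverse 2 * (?x + \<rho> * ?b) - \<rho> * ?q) + \<rho> * (inverse 2 * (?b + \<rho> * ?x) - \<rho> * ?p))
          - \<rho> * (inverse 2 * (?q - \<rho> * ?p))"
        by (simp add: 2 3 ei)
      also have "\<dots> = inverse 2 * (inverse 2 * ?x + inverse 2 * ?x + \<rho> * (inverse 2 * ?b + inverse 2 * ?b))
          - \<rho> * (inverse 2 * ?q + inverse 2 * ?q)"
        by (simp add: algebra_simps \<rho>2)
      also have "\<dots> = e x i" unfolding half_half[OF two] ei ..
      finally show "e (e x) i = e x i" .
    qed
  qed
  obtain w where w: "w \<in> elm M" "opb M w = \<rho> \<odot> w" "opa M w \<noteq> 0" using top_nontrivial by blast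
  have ew: "e w = w - \<pi> w"
  proof -
    have b: "opb M (\<pi> w) = \<rho> \<odot> \<pi> w"
      using \<pi>b[OF w(1)] w(2) by (simp add: lin_sm[OF \<pi>l])
    have r: "\<rho> \<odot> \<rho> \<odot> g = g" for g :: "nat \<Rightarrow> 'k" by (simp add: \<rho>)
    show ?thesis by (simp only: e_def w(2) b r half_vec[OF two])
  qed
  have "e w \<noteq> 0"
  proof
    assume "e w = 0"
    then have "w = \<pi> w" using ew by simp
    then show False using w(3) \<pi>K(2)[of w] by metis
  qed
  \<comment> \<open>Once e is the identity, \<pi> is the identity on weight -\<rho> and zero on
    weight \<rho>, which are the two claims.\<close>
  then have e1: "e f = f" if "f \<in> elm M" for f
    using indecomposable_idempotent[OF ind eh idem w(1) _ that] by blast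
  show "opa M f = 0 \<and> opd M f = 0" if f: "f \<in> elm M" "opb M f = - (\<rho> \<odot> f)"
  proof -
    have b: "opb M (\<pi> f) = - (\<rho> \<odot> \<pi> f)" using \<pi>b[OF f(1)] f(2) by (simp add: lin_simps[OF \<pi>l])
    have "e f = \<pi> f" unfolding e_def f(2) b by (simp add: fun_eq_iff \<rho>)
    then have "f = \<pi> f" using e1[OF f(1)] by simp
    then show ?thesis using \<pi>K by metis
  qed
  show "f = 0" if f: "f \<in> elm M" "opb M f = \<rho> \<odot> f" "opa M f = 0" "opd M f = 0"
  proof -
    have "e f = inverse 2 \<odot> (f + f) - f"
      unfolding e_def \<pi>id[OF f(1,3,4)] f(2) by (simp add: fun_eq_iff \<rho>)
    also have "\<dots> = 0" by (simp only: half_vec[OF two] diff_self)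
    finally show ?thesis using e1[OF f(1)] by simp
  qed
qed

text \<open>The element of the pencil that kills the generator of \<open>M\<^sub>1(r, \<eta>)\<close>.\<close>

definition opB :: "(nat \<Rightarrow> 'k) \<Rightarrow> nat \<Rightarrow> 'k" where
  "opB x = opd M x + \<eta> \<odot> opa M x"

definition top :: "(nat \<Rightarrow> 'k) set" where
  "top = {x \<in> elm M. opb M x = \<rho> \<odot> x}"

lemma lin_B: "lin opB"
  unfolding opB_def by (intro lin_plus lin_sm_fun lin_ap)

lemmas B_simps = lin_simps[OF lin_B]

lemma top_elm: "x \<in> top \<Longrightarrow> x \<in> elm M"
  by (simp add: top_def)

lemma subspace_top: "fv.subspace top"
  by (auto simp: top_def fv.subspace_def ap_simps fv.scale_right_distrib mult.commute)

lemma top_closed: "0 \<in> top" "x \<in> top \<Longrightarrow> y \<in> top \<Longrightarrow> x + y \<in> top" "x \<in> top \<Longrightarrow> c \<odot> x \<in> top"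
  using subspace_top by (auto simp: fv.subspace_def)

lemma top_sum: "(\<And>i. i \<in> I \<Longrightarrow> F i \<in> top) \<Longrightarrow> (\<Sum>i\<in>I. F i) \<in> top"
  using fv.subspace_sum[OF subspace_top] by blast

text \<open>The projection to weight \<rho>, with \<open>psoc\<close> the one to weight -\<rho>; by
  \<open>socle_cases\<close> they separate a complement of the socle from the socle.\<close>

definition ptop :: "(nat \<Rightarrow> 'k) \<Rightarrow> nat \<Rightarrow> 'k" where
  "ptop x = inverse 2 \<odot> (x + \<rho> \<odot> opb M x)"

definition psoc :: "(nat \<Rightarrow> 'k) \<Rightarrow> nat \<Rightarrow> 'k" where
  "psoc x = inverse 2 \<odot> (x - \<rho> \<odot> opb M x)"

lemma lin_psoc: "lin psoc"
  unfolding psoc_def by (intro lin_sm_fun lin_minus_fun lin_id lin_ap)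

lemma ptop_top: "x \<in> elm M \<Longrightarrow> ptop x \<in> top"
  by (simp add: ptop_def top_def ap_simps rules) (simp add: fun_eq_iff algebra_simps \<rho>2)

lemma psoc_b: "x \<in> elm M \<Longrightarrow> psoc (opb M x) = - (\<rho> \<odot> psoc x)"
  by (simp add: psoc_def rules) (simp add: fun_eq_iff algebra_simps \<rho>2)

lemma opb_psoc: "x \<in> elm M \<Longrightarrow> opb M (psoc x) = - (\<rho> \<odot> psoc x)"
  by (simp add: psoc_def ap_simps rules) (simp add: fun_eq_iff algebra_simps \<rho>2)

lemma ptop_psoc: "x = ptop x + psoc x"
  using half_half[OF two] by (simp add: ptop_def psoc_def fun_eq_iff algebra_simps)

lemma psoc_zero: "x \<in> elm M \<Longrightarrow> opa M (psoc x) = 0 \<and> opB (psoc x) = 0"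
  using socle_cases(1)[OF _ opb_psoc] by (simp add: psoc_def opB_def rules)

lemma a_ptop: "x \<in> elm M \<Longrightarrow> opa M (ptop x) = opa M x"
  and B_ptop: "x \<in> elm M \<Longrightarrow> opB (ptop x) = opB x"
  using psoc_zero[of x] ptop_psoc[of x] lin_add[OF lin_ap, of "act_a M" "ptop x" "psoc x"]
    lin_add[OF lin_B, of "ptop x" "psoc x"] by simp_all

lemma aB_zero: "x \<in> elm M \<Longrightarrow> opB (opa M x) = 0" "x \<in> elm M \<Longrightarrow> opa M (opB x) = 0"
  "x \<in> elm M \<Longrightarrow> opB (opB x) = 0" "x \<in> elm M \<Longrightarrow> opB (opd M x) = 0"
  by (simp_all add: opB_def ap_simps rules ad)

lemma b_aB: "x \<in> elm M \<Longrightarrow> opb M (opa M x) = - (\<rho> \<odot> opa M x)"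
  "x \<in> elm M \<Longrightarrow> opb M (opB x) = - (\<rho> \<odot> opB x)"
  "x \<in> elm M \<Longrightarrow> opb M (opd M x) = - (\<rho> \<odot> opd M x)"
proof -
  have d: "opd M y = opB y - \<eta> \<odot> opa M y" for y by (simp add: opB_def)
  have t: "opb M (opa M y) = - (\<rho> \<odot> opa M y)" "opb M (opd M y) = - (\<rho> \<odot> opd M y)" if "y \<in> top" for y
    using that by (auto simp: top_def rules ap_simps)
  assume x: "x \<in> elm M"
  show 1: "opb M (opa M x) = - (\<rho> \<odot> opa M x)"
    using t(1)[OF ptop_top[OF x]] a_ptop[OF x] by simp
  have "opd M (ptop x) = opd M x" unfolding d using a_ptop[OF x] B_ptop[OF x] by simp
  then show 2: "opb M (opd M x) = - (\<rho> \<odot> opd M x)" using t(2)[OF ptop_top[OF x]] by simp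
  show "opb M (opB x) = - (\<rho> \<odot> opB x)"
    by (simp add: opB_def ap_simps 1 2 fv.scale_right_distrib mult.commute)
qed

lemma psoc_id: "x \<in> elm M \<Longrightarrow> opb M x = - (\<rho> \<odot> x) \<Longrightarrow> psoc x = x"
  using half_half[OF two] by (simp add: psoc_def fun_eq_iff \<rho>2 algebra_simps)

lemma zero_top: "x \<in> top \<Longrightarrow> opa M x = 0 \<Longrightarrow> opB x = 0 \<Longrightarrow> x = 0"
  using socle_cases(2)[of x] by (simp add: top_def opB_def)

end

text \<open>For the largest index i with c i nonzero, row i of the system reduces to c i =
  0.\<close>

lemma unitriangular_zero:
  fixes t :: "nat \<Rightarrow> nat \<Rightarrow> 'k::field"
  assumes "\<And>i. i < n \<Longrightarrow> t i i = 1" "\<And>i j. j < i \<Longrightarrow> i < n \<Longrightarrow> t i j = 0"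
    "\<And>i. i < n \<Longrightarrow> (\<Sum>j<n. c j * t i j) = 0" "j < n"
  shows "c j = 0"
proof (rule ccontr)
  assume nz: "c j \<noteq> 0"
  let ?S = "{j. j < n \<and> c j \<noteq> 0}"
  define i where "i = Max ?S"
  have S: "finite ?S" "?S \<noteq> {}" using assms(4) nz by auto
  have i: "i < n" "c i \<noteq> 0" using Max_in[OF S] by (auto simp: i_def)
  have "c k * t i k = (if k = i then c i else 0)" if "k < n" for k
  proof (cases "k < i")
    case True
    then show ?thesis using assms(2) i by simp
  next
    case False
    have "c k = 0" if "k \<noteq> i"
      using Max_ge[OF S(1), of k] \<open>k < n\<close> that False by (fastforce simp flip: i_def)
    then show ?thesis using assms(1)[OF i(1)] by auto
  qed
  then have "(\<Sum>k<n. c k * t i k) = (\<Sum>k<n. if k = i then c i else 0)" by (intro sum.cong) auto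
  also have "\<dots> = c i" using i(1) by simp
  finally show False using assms(3)[OF i(1)] i(2) by simp
qed

text \<open>On basis vectors: \<open>a u\<^sub>i = w\<^sub>i\<close> and \<open>d u\<^sub>i = w\<^sub>i\<^sub>-\<^sub>1 - \<eta> w\<^sub>i\<close>, where \<open>w\<^sub>i = 0\<close> for \<open>i < 0\<close> or \<open>i \<ge> q\<close>.\<close>

definition KJ :: "nat \<Rightarrow> nat \<Rightarrow> 'k \<Rightarrow> 'k \<Rightarrow> 'k::field rep" where
  "KJ p q \<eta> \<rho> = KM p q (trunc q) (\<lambda>f i. if i < q then f (Suc i) - \<eta> * f i else 0) \<rho>"

lemma KJ_maps:
  "lin (\<lambda>f i. if i < q then f (Suc i) - \<eta> * f i else 0)"
  "(\<lambda>i. if i < q then f (Suc i) - \<eta> * f i else 0) \<in> fsp q"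
  for f :: "nat \<Rightarrow> 'k::field"
  by (auto intro!: linI simp: fsp_def algebra_simps)

lemma mdim_KJ [simp]: "mdim (KJ p q \<eta> \<rho>) = p + q"
  by (simp add: KJ_def)

lemma wf_KJ: "wf_rep (KJ p q \<eta> \<rho>)"
  by (simp add: KJ_def wf_KM)

section \<open>Strings of the pencil as direct summands\<close>

context ll2_module
begin

text \<open>Splitting off a string of the pencil \<open>(a, B)\<close>: by duality in the space of families, the string has a
  retraction \<open>\<Phi>\<close> (up to a unitriangular matrix) unless it is possible to prolong it by one step.\<close>

lemma chain_split:
  assumes q: "q \<ge> 1" and pq: "p = q \<or> p = Suc q"
    and u: "\<And>i. i < p \<Longrightarrow> u i \<in> top" "u 0 \<noteq> 0" "opB (u 0) = 0"
      "\<And>i. Suc i < p \<Longrightarrow> opB (u (Suc i)) = opa M (u i)" "p = Suc q \<Longrightarrow> opa M (u q) = 0"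
    and obs: "\<And>v. (\<And>i. i < q \<Longrightarrow> v i \<in> top) \<Longrightarrow> (p = Suc q \<Longrightarrow> v (q - 1) = 0) \<Longrightarrow>
      opB (v 0) = opa M (u 0) \<Longrightarrow> (\<And>i. Suc i < q \<Longrightarrow> opB (v (Suc i)) = opa M (v i)) \<Longrightarrow> False"
  shows "\<exists>h. fiso (KJ p q \<eta> \<rho>) M h"
proof -
  have ue: "u i \<in> elm M" if "i < p" for i using u(1)[OF that] by (rule top_elm)
  \<comment> \<open>Slot i holds the defect B v_i - a v_(i-1) of the family v as a string; pairs as
    indices pack all slots into one function. \<open>F0\<close> is the defect needed for prolonging
    u_0, and \<open>obs\<close> says that no admissible family has it.\<close>
  define F :: "(nat \<Rightarrow> nat \<Rightarrow> 'k) \<Rightarrow> nat \<times> nat \<Rightarrow> 'k" where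
    "F v = (\<lambda>(i, j). if i < q then (opB (v i) - (if i = 0 then 0 else opa M (v (i - 1)))) j else 0)" for v
  define F0 :: "nat \<times> nat \<Rightarrow> 'k" where "F0 = (\<lambda>(i, j). if i = 0 then opa M (u 0) j else 0)"
  let ?V = "{v. (\<forall>i. v i \<in> top) \<and> (p = Suc q \<longrightarrow> v (q - 1) = 0)}"
  have G: "fv.subspace (F ` ?V)"
    unfolding fv.subspace_def
  proof (intro conjI ballI allI)
    have "F (\<lambda>_. 0) = 0" by (auto simp: F_def fun_eq_iff ap_simps B_simps)
    moreover have "(\<lambda>_. 0) \<in> ?V" using top_closed(1) by simp
    ultimately show "0 \<in> F ` ?V" by (intro image_eqI[of _ F "\<lambda>_. 0"]) simp_all
    fix f assume "f \<in> F ` ?V"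
    then obtain v where v: "f = F v" "v \<in> ?V" by blast
    have "c \<odot> F v = F (\<lambda>i. c \<odot> v i)" for c
      by (auto simp: F_def fun_eq_iff ap_simps B_simps algebra_simps)
    moreover have "(\<lambda>i. c \<odot> v i) \<in> ?V" for c using v(2) top_closed(3) by auto
    ultimately show "c \<odot> f \<in> F ` ?V" for c using v(1) by blast
    fix g assume "g \<in> F ` ?V"
    then obtain w where w: "g = F w" "w \<in> ?V" by blast
    have "F v + F w = F (\<lambda>i. v i + w i)"
      by (auto simp: F_def fun_eq_iff ap_simps B_simps algebra_simps)
    moreover have "(\<lambda>i. v i + w i) \<in> ?V" using v(2) w(2) top_closed(2) by auto
    ultimately show "f + g \<in> F ` ?V" using v(1) w(1) by blast
  qed
  have F0: "F0 \<notin> F ` ?V"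
  proof
    assume "F0 \<in> F ` ?V"
    then obtain v where v: "F0 = F v" "v \<in> ?V" by blast
    have row: "opB (v i) - (if i = 0 then 0 else opa M (v (i - 1))) = (if i = 0 then opa M (u 0) else 0)"
      if "i < q" for i
    proof
      fix j
      show "(opB (v i) - (if i = 0 then 0 else opa M (v (i - 1)))) j = (if i = 0 then opa M (u 0) else 0) j"
        using fun_cong[OF v(1), of "(i, j)"] that by (auto simp: F_def F0_def)
    qed
    show False
    proof (rule obs[of v])
      show "opB (v 0) = opa M (u 0)" using row[of 0] q by simp
      show "opB (v (Suc i)) = opa M (v i)" if "Suc i < q" for i using row[of "Suc i"] that by simp
    qed (use v(2) in auto)
  qed
  \<comment> \<open>Separates \<open>F0\<close> from all attainable defects; its components \<psi> i
    in the single slots become the coordinates of the retraction.\<close>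
  obtain \<phi> where \<phi>: "\<And>x y. \<phi> (x + y) = \<phi> x + \<phi> y" "\<And>c x. \<phi> (c \<odot> x) = c * \<phi> x" "\<phi> F0 = 1" "\<And>x. x \<in> F ` ?V \<Longrightarrow> \<phi> x = 0"
    using functional_exists[OF G F0] by blast
  define sg :: "nat \<Rightarrow> (nat \<Rightarrow> 'k) \<Rightarrow> nat \<times> nat \<Rightarrow> 'k" where "sg i y = (\<lambda>(k, j). if k = i then y j else 0)" for i y
  define \<psi> where "\<psi> i y = \<phi> (sg i y)" for i y
  have \<psi>_add: "\<psi> i (x + y) = \<psi> i x + \<psi> i y" for i x y
    unfolding \<psi>_def \<phi>(1)[symmetric] by (rule arg_cong[of _ _ \<phi>]) (auto simp: sg_def fun_eq_iff)
  have \<psi>_sm: "\<psi> i (c \<odot> x) = c * \<psi> i x" for i c x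
    unfolding \<psi>_def \<phi>(2)[symmetric] by (rule arg_cong[of _ _ \<phi>]) (auto simp: sg_def fun_eq_iff)
  have \<psi>_0: "\<psi> i 0 = 0" for i using \<psi>_sm[of i 0 0] by simp
  have \<psi>_neg: "\<psi> i (- x) = - \<psi> i x" for i x using \<psi>_sm[of i "- 1" x] by simp
  have start: "\<psi> 0 (opa M (u 0)) = 1"
    unfolding \<psi>_def \<phi>(3)[symmetric] by (rule arg_cong[of _ _ \<phi>]) (auto simp: sg_def F0_def)
  \<comment> \<open>Evaluate \<phi> on a family supported in slot i. For p = q + 1 admissible
    families vanish in slot q - 1, so i = q - 1 is available only for p = q. Replacing x by
    \<open>ptop\<close> x puts it into the top and does not change its images under a and B.\<close>
  have rel: "\<psi> i (opB x) = (if Suc i < q then \<psi> (Suc i) (opa M x) else 0)"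
    if i: "i < q" "Suc i < q \<or> p = q" and x: "x \<in> elm M" for i x
  proof -
    let ?v = "\<lambda>k. if k = i then ptop x else 0"
    have "?v \<in> ?V" using i ptop_top[OF x] top_closed(1) by auto
    then have "\<phi> (F ?v) = 0" by (intro \<phi>(4) imageI)
    moreover have "F ?v = sg i (opB x) + (if Suc i < q then sg (Suc i) (- opa M x) else 0)"
    proof
      fix kj :: "nat \<times> nat"
      obtain k j where kj: "kj = (k, j)" by (cases kj)
      consider "k = i" | "k = Suc i" | "k \<noteq> i" "k \<noteq> Suc i" by blast
      then show "F ?v kj = (sg i (opB x) + (if Suc i < q then sg (Suc i) (- opa M x) else 0)) kj"
        using i(1) by cases (auto simp: kj F_def sg_def a_ptop[OF x] B_ptop[OF x] ap_simps B_simps)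
    qed
    moreover have "\<phi> 0 = 0" using \<phi>(2)[of 0 0] by simp
    ultimately have "\<psi> i (opB x) + (if Suc i < q then \<psi> (Suc i) (- opa M x) else 0) = 0"
      by (auto simp: \<phi>(1) \<psi>_def)
    then show ?thesis by (auto simp: \<psi>_neg)
  qed
  \<comment> \<open>The coordinate q, present only for p = q + 1, is forced: compatibility with d
    requires it to be \<psi> (q - 1) of B x.\<close>
  define up where "up x = (\<lambda>i. if i < q then \<psi> i (opa M x) else if i < p then \<psi> (q - 1) (opB x) else 0)" for x
  define wp where "wp x = (\<lambda>i. if i < q then \<psi> i (psoc x) else 0)" for x
  have up: "lin up" "lin wp"
    by (auto intro!: linI simp: up_def wp_def ap_simps B_simps lin_simps[OF lin_psoc] \<psi>_add \<psi>_sm)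
  have up_aB: "up (opa M x) = 0" "up (opd M x) = 0" if "x \<in> elm M" for x
    using that by (auto simp: up_def fun_eq_iff rules ad aB_zero \<psi>_0 ap_simps)
  have \<Phi>: "fhom M (KJ p q \<eta> \<rho>) (\<lambda>x. up x + emb p (wp x))"
    unfolding KJ_def
  proof (intro fhom_into_KM lin_trunc KJ_maps trunc_fsp up up_aB)
    fix x assume x: "x \<in> elm M"
    show "up x \<in> fsp p" using pq by (auto simp: up_def fsp_def)
    show "wp x \<in> fsp q" by (auto simp: wp_def fsp_def)
    have pa: "psoc (opa M x) = opa M x" using x b_aB(1) by (simp add: psoc_id rules)
    show "wp (opa M x) = trunc q (up x)"
      unfolding wp_def pa by (auto simp: up_def trunc_def)
    have pd: "psoc (opd M x) = opB x + (- \<eta>) \<odot> opa M x"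
      using psoc_id[OF _ b_aB(3)[OF x]] by (simp add: rules opB_def)
    have "\<psi> i (opB x) = up x (Suc i)" if "i < q" for i
    proof (cases "Suc i < q")
      case True
      then show ?thesis using rel[OF that _ x] by (simp add: up_def)
    next
      case False
      then have i: "Suc i = q" using that by simp
      show ?thesis
      proof (cases "p = q")
        case True
        then show ?thesis using rel[OF that _ x] i by (simp add: up_def)
      next
        case False
        then have "p = Suc q" using pq by simp
        then show ?thesis using i by (auto simp: up_def)
      qed
    qed
    then show "wp (opd M x) = (\<lambda>i. if i < q then up x (Suc i) - \<eta> * up x i else 0)"
      unfolding wp_def pd \<psi>_add \<psi>_sm by (auto simp: fun_eq_iff up_def)
    have ab: "opa M (opb M x) = \<rho> \<odot> opa M x" "opB (opb M x) = \<rho> \<odot> opB x"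
    proof -
      have 1: "opa M (opb M x) = - opb M (opa M x)" "opd M (opb M x) = - opb M (opd M x)"
        using x by (simp_all add: rules)
      then show "opa M (opb M x) = \<rho> \<odot> opa M x" "opB (opb M x) = \<rho> \<odot> opB x"
        using b_aB[OF x] by (simp_all add: opB_def fv.scale_right_distrib mult.commute)
    qed
    show 1: "up (opb M x) = \<rho> \<odot> up x" by (auto simp: up_def ab \<psi>_sm fun_eq_iff)
    show "up (opc M x) = \<rho> \<odot> up x" unfolding bc[OF x] by (rule 1)
    show 2: "wp (opb M x) = - (\<rho> \<odot> wp x)" by (auto simp: wp_def psoc_b[OF x] \<psi>_neg \<psi>_sm fun_eq_iff)
    show "wp (opc M x) = - (\<rho> \<odot> wp x)" unfolding bc[OF x] by (rule 2)
  qed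
  define uu where "uu f = (\<Sum>i<p. f i \<odot> u i)" for f
  define ww where "ww f = (\<Sum>i<q. f i \<odot> opa M (u i))" for f
  have qp: "q \<le> p" using pq by auto
  have uw: "lin uu" "lin ww" unfolding uu_def ww_def by (rule lin_combination)+
  have uut: "uu f \<in> top" for f unfolding uu_def by (intro top_sum top_closed(3) u(1)) auto
  have a_uu: "opa M (uu f) = ww f" for f
  proof -
    have "opa M (uu f) = (\<Sum>i<p. f i \<odot> opa M (u i))" by (simp add: uu_def ap_simps)
    also have "\<dots> = ww f" using pq u(5) by (auto simp: ww_def)
    finally show ?thesis .
  qed
  have B_uu: "opB (uu f) = ww (\<lambda>i. f (Suc i))" if "f \<in> fsp p" for f
  proof -
    obtain n where n: "p = Suc n" using q pq by (cases p) auto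
    have "opB (uu f) = (\<Sum>i<Suc n. f i \<odot> opB (u i))" by (simp add: uu_def B_simps n)
    also have "\<dots> = (\<Sum>i<n. f (Suc i) \<odot> opa M (u i))"
      unfolding sum.lessThan_Suc_shift using u(3,4) n by simp
    also have "\<dots> = ww (\<lambda>i. f (Suc i))"
    proof (cases "p = q")
      case True
      then have "q = Suc n" "f (Suc n) = 0" using n that by (auto simp: fsp_def)
      then show ?thesis by (simp add: ww_def)
    next
      case False
      then show ?thesis using n pq by (simp add: ww_def)
    qed
    finally show ?thesis .
  qed
  have wwt: "ww (trunc q f) = ww f" for f
    unfolding ww_def by (intro sum.cong) (auto simp: trunc_def)
  have wwe: "ww f \<in> elm M" for f unfolding ww_def by (intro fsp_sum) (auto simp: rules)
  have wwb: "opb M (ww f) = - (\<rho> \<odot> ww f)" for f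
    using b_aB(1)[OF top_elm[OF uut, of f]] by (simp add: a_uu)
  have ww0: "opa M (ww f) = 0" "opd M (ww f) = 0" for f
    using socle_cases(1)[OF wwe wwb] by auto
  let ?\<iota> = "\<lambda>f. uu (trunc p f) + ww (drp p f)"
  have \<iota>: "fhom (KJ p q \<eta> \<rho>) M ?\<iota>"
    unfolding KJ_def
  proof (intro fhom_from_KM lin_trunc KJ_maps trunc_fsp uw)
    fix f :: "nat \<Rightarrow> 'k" assume f: "f \<in> fsp p"
    show "uu f \<in> elm M" using uut by (rule top_elm)
    show "opa M (uu f) = ww (trunc q f)" by (simp add: a_uu wwt)
    have "opd M (uu f) = opB (uu f) - \<eta> \<odot> opa M (uu f)" by (simp add: opB_def)
    also have "\<dots> = ww ((\<lambda>i. f (Suc i)) - \<eta> \<odot> f)" by (simp add: a_uu B_uu[OF f] lin_simps[OF uw(2)])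
    also have "\<dots> = ww (\<lambda>i. if i < q then f (Suc i) - \<eta> * f i else 0)"
      unfolding ww_def by (intro sum.cong) auto
    finally show "opd M (uu f) = ww (\<lambda>i. if i < q then f (Suc i) - \<eta> * f i else 0)" .
    show "opb M (uu f) = \<rho> \<odot> uu f" using uut[of f] by (simp add: top_def)
    then show "opc M (uu f) = \<rho> \<odot> uu f" using bc[OF top_elm[OF uut]] by simp
  next
    fix f :: "nat \<Rightarrow> 'k" assume f: "f \<in> fsp q"
    show "ww f \<in> elm M" by (rule wwe)
    show "opa M (ww f) = 0" "opd M (ww f) = 0" using ww0 by auto
    show "opb M (ww f) = - (\<rho> \<odot> ww f)" using wwb .
    then show "opc M (ww f) = - (\<rho> \<odot> ww f)" using bc[OF wwe] by simp
  qed
  \<comment> \<open>By \<open>rel\<close>, a u_(j+1) in slot i may be traded for a u_j in slot i -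
    1. This ends at a u_0, which gives 1 in slot 0 by \<open>start\<close> and 0 in any later slot,
    because B u_0 = 0.\<close>
  have s: "\<psi> i (opa M (u j)) = (if i = j then 1 else 0)" if "j \<le> i" "i < q" for i j
    using that
  proof (induction j arbitrary: i)
    case 0
    show ?case
    proof (cases i)
      case (Suc k)
      have u0: "u 0 \<in> elm M" using ue 0 qp by simp
      show ?thesis using rel[of k "u 0", OF _ _ u0] Suc 0 u(3) by (simp add: \<psi>_0)
    qed (simp add: start)
  next
    case (Suc j)
    then obtain k where k: "i = Suc k" by (cases i) auto
    have uj: "u (Suc j) \<in> elm M" using ue Suc qp by simp
    have "\<psi> i (opa M (u (Suc j))) = \<psi> k (opB (u (Suc j)))"
      using rel[of k "u (Suc j)", OF _ _ uj] Suc.prems k by simp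
    also have "\<dots> = \<psi> k (opa M (u j))" using u(4)[of j] Suc.prems qp by simp
    finally show ?case using Suc.IH[of k] Suc.prems k by simp
  qed
  have t: "up (u j) i = (if i = j then 1 else 0)" if "j \<le> i" "i < p" for i j
  proof (cases "i < q")
    case True
    then show ?thesis using s[OF that(1)] by (simp add: up_def)
  next
    case False
    then have i: "i = q" "p = Suc q" using that pq by auto
    show ?thesis
    proof (cases j)
      case 0
      then show ?thesis using i u(3) q by (simp add: up_def \<psi>_0)
    next
      case (Suc k)
      then show ?thesis using i u(4)[of k] that s[of k "q - 1"] q by (auto simp: up_def)
    qed
  qed
  have T: "fhom (KJ p q \<eta> \<rho>) (KJ p q \<eta> \<rho>) (\<lambda>f. up (?\<iota> f) + emb p (wp (?\<iota> f)))"
    by (rule fhom_comp[OF wf_KJ \<iota> \<Phi>])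
  have inj: "inj_on (\<lambda>f. up (?\<iota> f) + emb p (wp (?\<iota> f))) (fsp (p + q))"
  proof (rule lin_inj_onI[OF fhomD(1)[OF T]])
    fix f :: "nat \<Rightarrow> 'k" assume f: "f \<in> fsp (p + q)" and 0: "up (?\<iota> f) + emb p (wp (?\<iota> f)) = 0"
    have upf: "up x \<in> fsp p" for x using pq by (auto simp: up_def fsp_def)
    have "up (?\<iota> f) = 0" using arg_cong[OF 0, of "trunc p"] by (simp add: trunc_id[OF upf] split_simps)
    moreover have "up (ww g) = 0" for g
      using ue qp by (simp add: ww_def lin_simps[OF up(1)] up_aB)
    ultimately have sum0: "(\<Sum>j<p. f j \<odot> up (u j)) = 0"
      by (simp add: lin_simps[OF up(1)] uu_def trunc_def)
    have 1: "(\<Sum>j<p. f j * up (u j) i) = 0" for i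
      using fun_cong[OF sum0, of i] by simp
    have "f j = 0" if "j < p" for j
      by (rule unitriangular_zero[of p "\<lambda>i j. up (u j) i" f j]) (use t 1 that in auto)
    then have a: "trunc p f = 0" by (auto simp: trunc_def)
    have "wp (?\<iota> f) = 0" using arg_cong[OF 0, of "drp p"] by (simp add: drp_eq_0[OF upf] split_simps)
    then have wp0: "wp (ww (drp p f)) = 0" by (simp add: a lin_zero[OF uw(1)])
    have "\<psi> i (ww (drp p f)) = 0" if "i < q" for i
      using that fun_cong[OF wp0, of i] psoc_id[OF wwe wwb] by (simp add: wp_def)
    moreover have "\<psi> i (\<Sum>j\<in>J. X j) = (\<Sum>j\<in>J. \<psi> i (X j))" for i J and X :: "nat \<Rightarrow> nat \<Rightarrow> 'k"
      by (induction J rule: infinite_finite_induct) (simp_all only: sum.infinite sum.empty sum.insert \<psi>_0 \<psi>_add not_False_eq_True simp_thms)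
    ultimately have 2: "(\<Sum>j<q. drp p f j * \<psi> i (opa M (u j))) = 0" if "i < q" for i
      using that by (simp add: ww_def \<psi>_sm)
    have "drp p f j = 0" if "j < q" for j
      by (rule unitriangular_zero[of q "\<lambda>i j. \<psi> i (opa M (u j))" "drp p f" j]) (use s 2 that in auto)
    then have "drp p f = 0" using drp_fsp[OF f] by (auto simp: fsp_def fun_eq_iff) (metis not_le)
    then show "f = 0" using split_fsp[of p f] a by (simp add: split_simps)
  qed
  have "fiso (KJ p q \<eta> \<rho>) (KJ p q \<eta> \<rho>) (\<lambda>f. up (?\<iota> f) + emb p (wp (?\<iota> f)))"
    using T inj lin_inj_surj[OF fhomD(1)[OF T], of "p + q"] fhomD(2)[OF T] by (simp add: fiso_def bij_betw_def)
  \<comment> \<open>Inclusion followed by \<Phi> is only unitriangular; its inverse corrects \<Phi>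
    to a retraction. The resulting idempotent of M fixes u_0, so by indecomposability it is the
    identity and the inclusion is onto.\<close>
  then obtain T' where T': "fiso (KJ p q \<eta> \<rho>) (KJ p q \<eta> \<rho>) T'"
    "\<And>f. f \<in> elm (KJ p q \<eta> \<rho>) \<Longrightarrow> T' (up (?\<iota> f) + emb p (wp (?\<iota> f))) = f"
    using fiso_inverse[OF wf_KJ wf_KJ] by blast
  have T'h: "fhom (KJ p q \<eta> \<rho>) (KJ p q \<eta> \<rho>) T'" using T'(1) by (simp add: fiso_def)
  have r: "fhom M (KJ p q \<eta> \<rho>) (\<lambda>x. T' (up x + emb p (wp x)))"
    by (rule fhom_comp[OF wf \<Phi> T'h])
  let ?e = "\<lambda>x. ?\<iota> (T' (up x + emb p (wp x)))"
  have e: "fhom M M ?e" by (rule fhom_comp[OF wf r \<iota>])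
  have e\<iota>: "?e (?\<iota> f) = ?\<iota> f" if "f \<in> elm (KJ p q \<eta> \<rho>)" for f
    using T'(2)[OF that] by simp
  have "?\<iota> (unit 0) = u 0"
  proof -
    have p0: "0 < p" using q qp by simp
    have "drp p (unit 0) = (0 :: nat \<Rightarrow> 'k)" using p0 by (auto simp: drp_def unit_def)
    moreover have "trunc p (unit 0) = (unit 0 :: nat \<Rightarrow> 'k)" using p0 by (intro trunc_id) simp
    ultimately show ?thesis using combination_unit[OF p0, of u] by (simp add: uu_def lin_zero[OF uw(2)])
  qed
  moreover have "unit 0 \<in> elm (KJ p q \<eta> \<rho>)" using q qp by simp
  ultimately have eu: "?e (u 0) = u 0" using e\<iota>[of "unit 0"] by simp
  have "?e x = x" if "x \<in> elm M" for x
  proof (rule indecomposable_idempotent[OF ind e _ _ _ that])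
    show "?e (?e y) = ?e y" if "y \<in> elm M" for y
      by (rule e\<iota>) (use fhomD(2)[OF r that] in simp)
    show "u 0 \<in> elm M" using ue q qp by simp
    show "?e (u 0) \<noteq> 0" using eu u(2) by simp
  qed
  then have "elm M \<subseteq> ?\<iota> ` elm (KJ p q \<eta> \<rho>)" using fhomD(2)[OF r] by (metis (no_types, lifting) image_eqI subsetI)
  then have "?\<iota> ` elm (KJ p q \<eta> \<rho>) = elm M" using fhomD(2)[OF \<iota>] by blast
  moreover have "inj_on ?\<iota> (elm (KJ p q \<eta> \<rho>))"
    by (rule inj_on_inverseI[of _ "\<lambda>x. T' (up x + emb p (wp x))"]) (rule T'(2))
  ultimately have "fiso (KJ p q \<eta> \<rho>) M ?\<iota>" using \<iota> by (simp add: fiso_def bij_betw_def)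
  then show ?thesis by blast
qed

text \<open>Equivalently, the polynomial \<Sum> x_i z^i has nonzero constant term and is killed by B
  - z a. The least possible l is a minimal index in the sense of Kronecker.\<close>

definition singular_chain :: "nat \<Rightarrow> (nat \<Rightarrow> nat \<Rightarrow> 'k) \<Rightarrow> bool" where
  "singular_chain l x \<longleftrightarrow> (\<forall>i\<le>l. x i \<in> top) \<and> x 0 \<noteq> 0 \<and> opB (x 0) = 0 \<and>
     (\<forall>i<l. opB (x (Suc i)) = opa M (x i)) \<and> opa M (x l) = 0"

text \<open>By \<open>chain_split\<close> a shortest singular chain accounts for all of M, whose
  dimension would be the odd number 2q + 1. The obstruction is met because x_0, v_0, ..., v_(q-2)
  would be a shorter singular chain.\<close>

lemma even_dim_no_singular_chain:
  assumes "mdim M = 2 * t"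
  shows "\<not> singular_chain l x"
proof
  assume sc: "singular_chain l x"
  define q where "q = (LEAST l. \<exists>x. singular_chain l x)"
  have least: "\<not> singular_chain l x" if "l < q" for l x
    using not_less_Least[OF that[unfolded q_def]] by blast
  obtain x where x: "singular_chain q x"
    using LeastI_ex[of "\<lambda>l. \<exists>x. singular_chain l x"] sc unfolding q_def by blast
  have q0: "q \<noteq> 0"
  proof
    assume "q = 0"
    then show False using x zero_top[of "x 0"] by (simp add: singular_chain_def)
  qed
  have "\<exists>h. fiso (KJ (Suc q) q \<eta> \<rho>) M h"
  proof (rule chain_split[of q "Suc q" x])
    fix v assume v: "\<And>i. i < q \<Longrightarrow> v i \<in> top" "Suc q = Suc q \<Longrightarrow> v (q - 1) = 0" "opB (v 0) = opa M (x 0)"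
      "\<And>i. Suc i < q \<Longrightarrow> opB (v (Suc i)) = opa M (v i)"
    define y where "y i = (case i of 0 \<Rightarrow> x 0 | Suc j \<Rightarrow> v j)" for i
    have "singular_chain (q - 1) y"
      unfolding singular_chain_def
    proof (intro conjI allI impI)
      show "y i \<in> top" if "i \<le> q - 1" for i
        using that v(1) x q0 by (cases i) (auto simp: y_def singular_chain_def)
      show "y 0 \<noteq> 0" "opB (y 0) = 0" using x by (auto simp: y_def singular_chain_def)
      show "opB (y (Suc i)) = opa M (y i)" if "i < q - 1" for i
        using that v(3,4) by (cases i) (auto simp: y_def)
      show "opa M (y (q - 1)) = 0"
      proof (cases "q - 1")
        case 0
        then show ?thesis using v(2,3) by (simp add: y_def B_simps)
      next
        case (Suc j)
        then have "opa M (v j) = opB (v (q - 1))" using v(4)[of j] by simp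
        then show ?thesis using Suc v(2) by (simp add: y_def B_simps)
      qed
    qed
    then show False using least[of "q - 1"] q0 by simp
  qed (use x q0 in \<open>auto simp: singular_chain_def\<close>)
  then obtain h where "fiso (KJ (Suc q) q \<eta> \<rho>) M h" by blast
  then have "Suc q + q = 2 * t" using fiso_dim[OF wf_KJ wf] assms by fastforce
  then show False by presburger
qed

text \<open>A linear relation between the members of a string would produce a singular
  chain.\<close>

lemma chain_bound:
  assumes dim: "mdim M = 2 * t" and u: "\<And>i. i < n \<Longrightarrow> u i \<in> top" "u 0 \<noteq> 0" "opB (u 0) = 0"
    "\<And>i. Suc i < n \<Longrightarrow> opB (u (Suc i)) = opa M (u i)"
  shows "n \<le> mdim M"
proof (rule ccontr)
  assume "\<not> n \<le> mdim M"
  then obtain c where c: "c \<in> fsp n" "c \<noteq> 0" "(\<Sum>j<n. c j \<odot> u j) = 0"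
    using linear_dependence[of n u "mdim M"] u(1) top_elm by (metis not_le)
  let ?S = "{j. c j \<noteq> 0}"
  have S: "finite ?S" "?S \<noteq> {}"
  proof -
    have "?S \<subseteq> {..<n}" using c(1) by (auto simp: fsp_def not_le[symmetric])
    then show "finite ?S" by (rule finite_subset) simp
    show "?S \<noteq> {}" using c(2) by (auto simp: fun_eq_iff)
  qed
  define m where "m = Max ?S"
  have m: "c m \<noteq> 0" "\<And>j. c j \<noteq> 0 \<Longrightarrow> j \<le> m" using Max_in[OF S] Max_ge[OF S(1)] by (auto simp: m_def)
  have mn: "m < n" using m(1) c(1) by (auto simp: fsp_def not_le[symmetric])
  \<comment> \<open>The relation \<Sum> c_j u_j = 0 with all indices lowered by m - i and terms of
    negative index dropped. So x_0 is c_m u_0, x_m is the relation itself, and a x_i = B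
    x_(i+1).\<close>
  define x where "x i = (\<Sum>l\<le>i. c (m - i + l) \<odot> u l)" for i
  have x0: "x 0 = c m \<odot> u 0" by (simp add: x_def)
  have xm: "x m = 0"
  proof -
    have "(\<Sum>l\<le>m. c l \<odot> u l) = (\<Sum>j<n. c j \<odot> u j)"
    proof (rule sum.mono_neutral_left)
      show "\<forall>i\<in>{..<n} - {..m}. c i \<odot> u i = 0" using m(2) by (auto simp: fun_eq_iff)
    qed (use mn in auto)
    then show ?thesis using c(3) by (simp add: x_def)
  qed
  have Bx: "opB (x (Suc i)) = opa M (x i)" if "i < m" for i
  proof -
    have "opB (x (Suc i)) = (\<Sum>l\<le>Suc i. c (m - Suc i + l) \<odot> opB (u l))" by (simp add: x_def B_simps)
    also have "\<dots> = (\<Sum>l\<le>i. c (m - Suc i + Suc l) \<odot> opB (u (Suc l)))"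
      unfolding sum.atMost_Suc_shift using u(3) by simp
    also have "\<dots> = (\<Sum>l\<le>i. c (m - i + l) \<odot> opa M (u l))"
    proof (rule sum.cong[OF refl])
      fix l assume "l \<in> {..i}"
      moreover have "m - Suc i + Suc l = m - i + l" using that by simp
      ultimately show "c (m - Suc i + Suc l) \<odot> opB (u (Suc l)) = c (m - i + l) \<odot> opa M (u l)"
        using u(4)[of l] that mn by simp
    qed
    also have "\<dots> = opa M (x i)" by (simp add: x_def ap_simps)
    finally show ?thesis .
  qed
  have m0: "m \<noteq> 0"
  proof
    assume "m = 0"
    then have "c m \<odot> u 0 = 0" using x0 xm by simp
    then show False using m(1) u(2) by (auto simp: fun_eq_iff)
  qed
  have "singular_chain (m - 1) x"
    unfolding singular_chain_def
  proof (intro conjI allI impI)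
    show "x i \<in> top" if "i \<le> m - 1" for i
      unfolding x_def by (intro top_sum top_closed(3) u(1)) (use that mn m0 in auto)
    show "x 0 \<noteq> 0" using x0 m(1) u(2) by (auto simp: fun_eq_iff)
    show "opB (x 0) = 0" using u(3) by (simp add: x0 B_simps)
    show "opB (x (Suc i)) = opa M (x i)" if "i < m - 1" for i using Bx[of i] that by simp
    show "opa M (x (m - 1)) = 0" using Bx[of "m - 1"] m0 xm by (simp add: B_simps)
  qed
  then show False using even_dim_no_singular_chain[OF dim] by blast
qed

text \<open>By \<open>chain_bound\<close> there is a longest string starting at w. It cannot be
  prolonged, so \<open>chain_split\<close> shows that it accounts for all of M, and the dimension
  gives its length.\<close>

lemma classification:
  assumes dim: "mdim M = 2 * t" and w: "w \<in> top" "opB w = 0" "opa M w \<noteq> 0"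
  shows "\<exists>h. fiso (KJ t t \<eta> \<rho>) M h"
proof -
  define C where "C n \<longleftrightarrow> (\<exists>u. (\<forall>i<n. u i \<in> top) \<and> u 0 = w \<and> (\<forall>i. Suc i < n \<longrightarrow> opB (u (Suc i)) = opa M (u i)))" for n
  have w0: "w \<noteq> 0" using w(3) by (auto simp: ap_simps)
  have C1: "C 1" using w(1) unfolding C_def by (intro exI[of _ "\<lambda>_. w"]) auto
  have bound: "n \<le> mdim M" if "C n" for n
    using that chain_bound[OF dim, of n] w(2) w0 unfolding C_def by metis
  define n where "n = (GREATEST n. C n)"
  have n: "C n" "\<And>l. C l \<Longrightarrow> l \<le> n"
    unfolding n_def using GreatestI_nat[of C, OF C1] Greatest_le_nat[of C] bound by blast+
  have n1: "n \<ge> 1" using n(2)[OF C1] .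
  obtain u where u: "\<forall>i<n. u i \<in> top" "u 0 = w" "\<forall>i. Suc i < n \<longrightarrow> opB (u (Suc i)) = opa M (u i)"
    using n(1) unfolding C_def by blast
  have "\<exists>h. fiso (KJ n n \<eta> \<rho>) M h"
  proof (rule chain_split[of n n u])
    fix v assume v: "\<And>i. i < n \<Longrightarrow> v i \<in> top" "opB (v 0) = opa M (u 0)" "\<And>i. Suc i < n \<Longrightarrow> opB (v (Suc i)) = opa M (v i)"
    define y where "y i = (case i of 0 \<Rightarrow> w | Suc j \<Rightarrow> v j)" for i
    have "C (Suc n)"
      unfolding C_def
    proof (intro exI[of _ y] conjI allI impI)
      show "y i \<in> top" if "i < Suc n" for i using that v(1) w(1) by (cases i) (auto simp: y_def)
      show "opB (y (Suc i)) = opa M (y i)" if "Suc i < Suc n" for i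
        using that v(2,3) u(2) by (cases i) (auto simp: y_def)
    qed (simp add: y_def)
    then show False using n(2) by fastforce
  qed (use u n1 w w0 in auto)
  moreover from this have "n = t" using fiso_dim[OF wf_KJ wf] dim by fastforce
  ultimately show ?thesis by simp
qed

end

section \<open>The modules M_t(r, \<eta>) as Jordan blocks\<close>

lemma rank_nullity:
  fixes i p :: "(nat \<Rightarrow> 'k::field) \<Rightarrow> nat \<Rightarrow> 'k"
  assumes "lin i" "inj_on i (fsp s)" "lin p" "p ` fsp m = fsp q" "i ` fsp s = {x \<in> fsp m. p x = 0}"
  shows "m = s + q"
proof -
  obtain g where g: "lin g" "\<And>f. g f \<in> fsp m" "\<And>f. f \<in> fsp q \<Longrightarrow> p (g f) = f"
    using lin_surj_section[OF assms(3,4)] by blast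
  let ?h = "\<lambda>f. i (trunc s f) + g (drp s f)"
  have h: "lin ?h" by (intro lin_plus lin_comp[OF assms(1) lin_trunc] lin_comp[OF g(1) lin_drp])
  have ik: "i x \<in> fsp m" "p (i x) = 0" if "x \<in> fsp s" for x
  proof -
    have "i x \<in> {x \<in> fsp m. p x = 0}" using that unfolding assms(5)[symmetric] by blast
    then show "i x \<in> fsp m" "p (i x) = 0" by auto
  qed
  have "inj_on ?h (fsp (s + q))"
  proof (rule lin_inj_onI[OF h])
    fix f assume f: "f \<in> fsp (s + q)" and 0: "?h f = 0"
    have "p (?h f) = drp s f" using ik(2)[OF trunc_fsp] g(3)[OF drp_fsp[OF f]] by (simp add: lin_add[OF assms(3)])
    then have d: "drp s f = 0" using 0 by (simp add: lin_zero[OF assms(3)])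
    then have "i (trunc s f) = i 0" using 0 by (simp add: lin_zero[OF g(1)] lin_zero[OF assms(1)])
    then have "trunc s f = 0" using assms(2) trunc_fsp by (meson fsp_closed(1) inj_onD)
    then show "f = 0" using d split_fsp[of s f] by (simp add: split_simps)
  qed
  moreover have he: "?h f \<in> fsp m" for f using ik(1)[OF trunc_fsp] g(2) by simp
  ultimately have 1: "s + q \<le> m" using lin_inj_dim[OF h] by blast
  have "?h ` fsp (s + q) = fsp m"
  proof
    show "?h ` fsp (s + q) \<subseteq> fsp m" using he by blast
    show "fsp m \<subseteq> ?h ` fsp (s + q)"
    proof
      fix x :: "nat \<Rightarrow> 'k" assume x: "x \<in> fsp m"
      have px: "p x \<in> fsp q" using x assms(4) by blast
      have "x - g (p x) \<in> i ` fsp s" unfolding assms(5) using x g px by (simp add: lin_diff[OF assms(3)])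
      moreover have "g (p x) \<in> g ` fsp q" using px by blast
      ultimately have "(x - g (p x)) + g (p x) \<in> ?h ` fsp (s + q)"
        unfolding dsum_image[OF assms(1) g(1)] by blast
      then show "x \<in> ?h ` fsp (s + q)" by simp
    qed
  qed
  then show ?thesis using lin_surj_dim[OF h] 1 by fastforce
qed

text \<open>The image v of the vector v_1 of M_1(r, \<eta>) supplies the data: its weight gives b =
  c and \<rho>, B kills it, and a does not. The lengths of socle and quotient, both t, are
  dimensions, so dim M = 2t.\<close>

lemma is_Ms_KJ:
  assumes "is_Ms t r (Fin \<eta>) M" and two: "(2 :: 'k::field) \<noteq> 0"
  shows "D4_module M \<and> (\<exists>h. fiso (KJ t t \<eta> (sgn2 (r + 1) :: 'k)) M h)"
proof -
  let ?\<rho> = "sgn2 (r + 1) :: 'k"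
  have ty: "has_type M t t" using assms by (simp add: is_Ms_def)
  have ind: "indecomposable M" and ll: "Loewy_length M = 2" using ty by (auto simp: has_type_def)
  have M: "D4_module M" using ind by (simp add: indecomposable_def)
  note w = D4_module_wf[OF M]
  obtain i where i: "D4_module (M1 r (Fin \<eta>))" "i \<in> D4_inj (M1 r (Fin \<eta>)) M"
    using assms by (auto simp: is_Ms_def is_submodule_rep_def)
  let ?N = "M1 r (Fin \<eta>)"
  note ih = D4_inj_fhom[OF D4_module_wf[OF i(1)] w i(2)]
  have dN: "mdim ?N = 2" by (simp add: M1_def Let_def)
  have ops: "opa ?N (unit 0) = unit 1" "opd ?N (unit 0) = - \<eta> \<odot> unit 1"
    "opb ?N (unit 0) = ?\<rho> \<odot> unit 0" "opc ?N (unit 0) = ?\<rho> \<odot> unit 0"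
    by (auto simp: fun_eq_iff ap_unit M1_def Let_def mat_of_rows_list_def less_Suc_eq)
      (auto simp: unit_def)
  let ?v = "ap i (unit 0)"
  have u0: "unit 0 \<in> elm ?N" "unit 1 \<in> elm ?N" by (simp_all add: dN)
  have v: "?v \<in> elm M" "opa M ?v = ap i (unit 1)" "opd M ?v = - \<eta> \<odot> ap i (unit 1)"
    "opb M ?v = ?\<rho> \<odot> ?v" "opc M ?v = ?\<rho> \<odot> ?v"
    subgoal using fhomD(2)[OF ih(1) u0(1)] .
    subgoal unfolding fhomD(3)[OF ih(1) u0(1), symmetric] ops ..
    subgoal unfolding fhomD(6)[OF ih(1) u0(1), symmetric] ops by (simp only: ap_simps)
    subgoal unfolding fhomD(4)[OF ih(1) u0(1), symmetric] ops by (simp only: ap_simps)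
    subgoal unfolding fhomD(5)[OF ih(1) u0(1), symmetric] ops by (simp only: ap_simps)
    done
  have "(unit 1 :: nat \<Rightarrow> 'k) \<noteq> 0" by (auto simp: unit_def fun_eq_iff)
  then have av: "opa M ?v \<noteq> 0" unfolding v(2) using fhom_zero_iff[OF ih(1,2) u0(2)] by simp
  then have "?v \<noteq> 0" by (auto simp: ap_simps)
  have bc: "opc M f = opb M f" if "f \<in> elm M" for f
    by (rule indecomposable_bc[OF ind two v(1) \<open>?v \<noteq> 0\<close> v(4,5) sgn2_square that])
  interpret bc_module M by unfold_locales (fact M two bc)+
  interpret ll2_module M ?\<rho> \<eta>
  proof unfold_locales
    show "\<exists>v. v \<in> elm M \<and> opb M v = ?\<rho> \<odot> v \<and> opa M v \<noteq> 0" using v av by blast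
  qed (fact ind Loewy_length_2[OF ll] sgn2_square)+
  obtain Q p where Q: "D4_module Q" "p \<in> D4_surj M Q" "mat_kernel p = soc M" "has_length Q t"
    using ty by (auto simp: has_type_def is_quotient_rep_def)
  obtain S j where S: "D4_module S" "j \<in> D4_inj S M" "(*\<^sub>v) j ` space S = soc M" "has_length S t"
    using ty by (auto simp: has_type_def is_submodule_rep_def)
  note ph = D4_surj_fhom[OF w D4_module_wf[OF Q(1)] Q(2)]
  note jh = D4_inj_fhom[OF D4_module_wf[OF S(1)] w S(2)]
  interpret Q: bc_module Q
  proof (unfold_locales; fact?)
    fix f assume "f \<in> elm Q"
    then obtain x where x: "x \<in> elm M" "f = ap p x" using ph(2) by blast
    then show "opc Q f = opb Q f" using fhomD(4,5)[OF ph(1) x(1)] bc by simp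
  qed
  interpret S: bc_module S
  proof (unfold_locales; fact?)
    fix f assume f: "f \<in> elm S"
    have "ap j (opc S f) = ap j (opb S f)" using fhomD(2,4,5)[OF jh(1) f] bc by simp
    then show "opc S f = opb S f" using jh(2) op_elm[OF D4_module_wf[OF S(1)]] by (meson inj_onD)
  qed
  have pc: "p \<in> carrier_mat (mdim Q) (mdim M)" using Q(2) by (auto simp: D4_surj_def D4_hom_def)
  have "ap j ` elm S = {x \<in> elm M. ap p x = 0}"
    unfolding jh(3)[symmetric] S(3) Q(3)[symmetric] by (rule toF_kernel[OF pc])
  then have "mdim M = mdim S + mdim Q"
    using rank_nullity[OF lin_ap jh(2) lin_ap ph(2)] by blast
  then have dim: "mdim M = 2 * t" using Q.length_eq_dim[OF Q(4)] S.length_eq_dim[OF S(4)] by simp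
  have "?v \<in> top" using v(1,4) unfolding top_def by blast
  moreover have "opB ?v = 0" using v(2,3) by (simp add: opB_def)
  ultimately show ?thesis using classification[OF dim _ _ av] M by blast
qed

section \<open>Tensor products\<close>

text \<open>With n the dimension of the second factor, the index p stands for the pair (p div n, p
  mod n), as in the Kronecker product.\<close>

definition tens :: "nat \<Rightarrow> (nat \<Rightarrow> 'k) \<Rightarrow> (nat \<Rightarrow> 'k) \<Rightarrow> nat \<Rightarrow> 'k::field" where
  "tens n v x = (\<lambda>p. v (p div n) * x (p mod n))"

lemma lin_tens: "lin (\<lambda>v. tens n v x)" "lin (tens n v)"
  by (auto intro!: linI simp: tens_def algebra_simps)

lemmas tens_simps = lin_simps[OF lin_tens(1)] lin_simps[OF lin_tens(2)]

lemma tens_fsp: "v \<in> fsp m \<Longrightarrow> x \<in> fsp n \<Longrightarrow> tens n v x \<in> fsp (m * n)"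
proof -
  assume v: "v \<in> fsp m" and x: "x \<in> fsp n"
  have "v (p div n) * x (p mod n) = 0" if "m * n \<le> p" for p
  proof (cases "n = 0")
    case True
    then show ?thesis using x by (simp add: fsp_def)
  next
    case False
    then have "m \<le> p div n" using that by (simp add: less_eq_div_iff_mult_less_eq)
    then show ?thesis using v by (simp add: fsp_def)
  qed
  then show ?thesis by (simp add: tens_def fsp_def)
qed

lemma sum_div_mod: "(\<Sum>p<m * n. g (p div n) (p mod n)) = (\<Sum>i<m. \<Sum>j<n. g i j)"
  for g :: "nat \<Rightarrow> nat \<Rightarrow> 'k::comm_monoid_add"
proof (induction m)
  case (Suc m)
  have s: "(\<Sum>p<k + l. h p) = (\<Sum>p<k. h p) + (\<Sum>j<l. h (k + j))" for h :: "nat \<Rightarrow> 'k" and k l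
    by (induction l) (auto simp: add.assoc)
  have "(\<Sum>p<m * n + n. g (p div n) (p mod n)) = (\<Sum>p<m * n. g (p div n) (p mod n)) + (\<Sum>j<n. g m j)"
    unfolding s by (intro arg_cong2[where f = "(+)"] refl sum.cong) auto
  then show ?case using Suc by (simp add: add.commute)
qed simp

lemma kronecker_carrier: "A \<in> carrier_mat m m \<Longrightarrow> B \<in> carrier_mat n n \<Longrightarrow> A \<otimes>\<^sub>K B \<in> carrier_mat (m * n) (m * n)"
  by (simp add: kronecker_def)

lemma ap_kronecker:
  assumes "A \<in> carrier_mat m m" "B \<in> carrier_mat n n"
  shows "ap (A \<otimes>\<^sub>K B) (tens n v x) = tens n (ap A v) (ap B x)"
proof
  fix p
  show "ap (A \<otimes>\<^sub>K B) (tens n v x) p = tens n (ap A v) (ap B x) p"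
  proof (cases "p < m * n")
    case True
    then have n: "n > 0" by (cases n) auto
    then have pm: "p div n < m" "p mod n < n" using True by (auto simp: less_mult_imp_div_less)
    define g where "g i j = (A $$ (p div n, i) * v i) * (B $$ (p mod n, j) * x j)" for i j
    have "ap (A \<otimes>\<^sub>K B) (tens n v x) p = (\<Sum>q<m * n. g (q div n) (q mod n))"
      using True assms by (auto simp: ap_def kronecker_def tens_def g_def ac_simps intro!: sum.cong)
    also have "\<dots> = (\<Sum>i<m. \<Sum>j<n. g i j)" by (rule sum_div_mod)
    also have "\<dots> = tens n (ap A v) (ap B x) p"
      using pm assms by (simp add: tens_def ap_def sum_product g_def)
    finally show ?thesis .
  next
    case False
    have "tens n (ap A v) (ap B x) \<in> fsp (m * n)"
      by (intro tens_fsp ap_fsp[OF assms(1)] ap_fsp[OF assms(2)])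
    then show ?thesis using False assms by (simp add: fsp_def ap_def kronecker_def)
  qed
qed

lemma mdim_tensor [simp]: "mdim (M \<otimes>\<^sub>D X) = mdim M * mdim X"
  by (simp add: tensor_def)

lemma wf_tensor: "wf_rep M \<Longrightarrow> wf_rep X \<Longrightarrow> wf_rep (M \<otimes>\<^sub>D X)"
  by (auto simp: wf_rep_def tensor_def kronecker_def)

lemma op_tensor:
  assumes "wf_rep M" "wf_rep X" "v \<in> elm M"
  shows "opa (M \<otimes>\<^sub>D X) (tens (mdim X) v x) = tens (mdim X) (opa M v) (opb X x) + tens (mdim X) v (opa X x)"
    "opb (M \<otimes>\<^sub>D X) (tens (mdim X) v x) = tens (mdim X) (opb M v) (opb X x)"
    "opc (M \<otimes>\<^sub>D X) (tens (mdim X) v x) = tens (mdim X) (opc M v) (opc X x)"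
    "opd (M \<otimes>\<^sub>D X) (tens (mdim X) v x) = tens (mdim X) (opd M v) (opc X x) + tens (mdim X) v (opd X x)"
proof -
  have *: "ap (A \<otimes>\<^sub>K B + 1\<^sub>m (mdim M) \<otimes>\<^sub>K C) (tens (mdim X) v x) = tens (mdim X) (ap A v) (ap B x) + tens (mdim X) v (ap C x)"
    if "A \<in> carrier_mat (mdim M) (mdim M)" "B \<in> carrier_mat (mdim X) (mdim X)" "C \<in> carrier_mat (mdim X) (mdim X)" for A B C
    using ap_plus[OF kronecker_carrier[OF that(1,2)] kronecker_carrier[OF one_carrier_mat that(3)]]
    by (simp add: ap_kronecker[OF that(1,2)] ap_kronecker[OF one_carrier_mat that(3)] ap_one[OF assms(3)])
  show "opa (M \<otimes>\<^sub>D X) (tens (mdim X) v x) = tens (mdim X) (opa M v) (opb X x) + tens (mdim X) v (opa X x)"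
    "opb (M \<otimes>\<^sub>D X) (tens (mdim X) v x) = tens (mdim X) (opb M v) (opb X x)"
    "opc (M \<otimes>\<^sub>D X) (tens (mdim X) v x) = tens (mdim X) (opc M v) (opc X x)"
    "opd (M \<otimes>\<^sub>D X) (tens (mdim X) v x) = tens (mdim X) (opd M v) (opc X x) + tens (mdim X) v (opd X x)"
    using assms(1,2) by (simp_all add: tensor_def wf_rep_def * ap_kronecker[where m = "mdim M" and n = "mdim X"])
qed

lemma tens_span:
  assumes "fv.subspace S" "\<And>v x. v \<in> fsp m \<Longrightarrow> x \<in> fsp n \<Longrightarrow> tens n v x \<in> S"
  shows "fsp (m * n) \<subseteq> S"
proof
  fix f :: "nat \<Rightarrow> 'a" assume f: "f \<in> fsp (m * n)"
  have "unit q \<in> S" if q: "q < m * n" for q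
  proof -
    have n: "n > 0" using q by (cases n) auto
    have "unit q = tens n (unit (q div n)) (unit (q mod n) :: nat \<Rightarrow> 'a)"
      by (auto simp: unit_def tens_def fun_eq_iff) (metis div_mult_mod_eq)+
    moreover have "q div n < m" "q mod n < n" using q n by (auto simp: less_mult_imp_div_less)
    ultimately show ?thesis using assms(2) by simp
  qed
  then have "(\<Sum>q<m * n. f q \<odot> unit q) \<in> S"
    using assms(1) by (intro fv.subspace_sum fv.subspace_scale) auto
  then show "f \<in> S" by (simp only: fsp_expand[OF f, symmetric])
qed

text \<open>The relations are linear conditions on a vector, so by \<open>tens_span\<close> they
  need only be verified on pure tensors.\<close>

lemma D4_module_tensor:
  assumes M: "D4_module M" and X: "D4_module X"
  shows "D4_module (M \<otimes>\<^sub>D X)"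
proof -
  note w = D4_module_wf[OF M] D4_module_wf[OF X]
  let ?Y = "M \<otimes>\<^sub>D X"
  have "fv.subspace {f. D4_relations ?Y f}"
    unfolding fv.subspace_def
  proof (intro conjI ballI allI)
    show "0 \<in> {f. D4_relations ?Y f}" by (simp add: D4_relations_def ap_simps)
    show "f + g \<in> {f. D4_relations ?Y f}" if "f \<in> {f. D4_relations ?Y f}" "g \<in> {f. D4_relations ?Y f}" for f g
      using that by (simp add: D4_relations_def ap_simps)
    show "c \<odot> f \<in> {f. D4_relations ?Y f}" if "f \<in> {f. D4_relations ?Y f}" for c f
      using that by (simp add: D4_relations_def ap_simps fv.scale_right_diff_distrib)
  qed
  moreover have "D4_relations ?Y (tens (mdim X) v x)" if "v \<in> elm M" "x \<in> elm X" for v x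
    unfolding D4_relations_def
    by (simp add: that w op_tensor[OF w] ap_simps tens_simps D4_rules[OF M] D4_rules[OF X])
  ultimately have "elm ?Y \<subseteq> {f. D4_relations ?Y f}"
    unfolding mdim_tensor by (intro tens_span) auto
  then show ?thesis using wf_tensor[OF w] by (auto simp: D4_module_iff)
qed

section \<open>Homomorphisms from copies of a projective cover\<close>

lemma wf_copies: "wf_rep P \<Longrightarrow> wf_rep (copies n P)"
  by (induction n) (auto simp: wf_dsum, simp add: zero_rep_def wf_rep_def)

lemma mdim_copies: "mdim (copies n P) = n * mdim P"
  by (induction n) (auto simp: zero_rep_def)

lemma fhom_zero_image:
  assumes "fhom M N h"
  shows "0 \<in> h ` elm M"
proof -
  have "h 0 \<in> h ` elm M" by (intro imageI fsp_closed(1))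
  then show ?thesis by (simp only: lin_zero[OF fhomD(1)[OF assms]])
qed

lemma fhom_from_copies:
  assumes P: "wf_rep P" "wf_rep Y" and h: "\<And>l. l < n \<Longrightarrow> \<exists>h. fhom P Y h \<and> g l \<in> h ` elm P"
  shows "\<exists>h. fhom (copies n P) Y h \<and> (\<forall>l<n. g l \<in> h ` elm (copies n P))"
  using h
proof (induction n arbitrary: g)
  case 0
  have z: "f = 0" if "f \<in> fsp 0" for f :: "nat \<Rightarrow> 'a" using that by (auto simp: fsp_def fun_eq_iff)
  have "fhom (copies 0 P) Y (\<lambda>_. 0)"
    by (auto simp: fhom_def lin_zero_fun ap_simps)
  then show ?case by auto
next
  case (Suc n)
  obtain h where h: "fhom P Y h" "g 0 \<in> h ` elm P" using Suc.prems[of 0] by auto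
  obtain k where k: "fhom (copies n P) Y k" "\<forall>l<n. g (Suc l) \<in> k ` elm (copies n P)"
    using Suc.IH[of "\<lambda>l. g (Suc l)"] Suc.prems by auto
  let ?H = "\<lambda>f. h (trunc (mdim P) f) + k (drp (mdim P) f)"
  have im: "?H ` elm (copies (Suc n) P) = {x + y |x y. x \<in> h ` elm P \<and> y \<in> k ` elm (copies n P)}"
    using dsum_image[OF fhomD(1)[OF h(1)] fhomD(1)[OF k(1)]] by simp
  have "g l \<in> ?H ` elm (copies (Suc n) P)" if "l < Suc n" for l
  proof (cases l)
    case 0
    have "0 \<in> k ` elm (copies n P)" using fhom_zero_image[OF k(1)] .
    then have "g 0 + 0 \<in> ?H ` elm (copies (Suc n) P)" unfolding im using h(2) by blast
    then show ?thesis using 0 by simp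
  next
    case (Suc i)
    have "0 \<in> h ` elm P" using fhom_zero_image[OF h(1)] .
    then have "0 + g (Suc i) \<in> ?H ` elm (copies (Suc n) P)" unfolding im using k(2) Suc that by blast
    then show ?thesis using Suc by simp
  qed
  moreover have "fhom (copies (Suc n) P) Y ?H"
    using fhom_dsum[OF P(1) wf_copies[OF P(1)] h(1) k(1)] by simp
  ultimately show ?case by blast
qed

text \<open>P is free on one generator of weight \<rho>, which may be sent to y.\<close>

lemma projective_generator:
  assumes P: "fiso (QM 1 \<rho>) P p" "wf_rep P" and Y: "D4_module Y" and \<rho>: "\<rho> * \<rho> = 1"
    and y: "y \<in> elm Y" "opb Y y = \<rho> \<odot> y" "opc Y y = \<rho> \<odot> y"
  shows "\<exists>h. fhom P Y h \<and> y \<in> h ` elm P"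
proof -
  obtain k where k: "fiso P (QM 1 \<rho>) k" "\<And>x. x \<in> elm (QM 1 \<rho>) \<Longrightarrow> k (p x) = x"
    "\<And>x. x \<in> elm P \<Longrightarrow> p (k x) = x"
    by (rule fiso_inverse[OF wf_QM P(2,1)]) (rule that)
  let ?y = "\<lambda>f :: nat \<Rightarrow> 'a. f 0 \<odot> y"
  have ly: "lin ?y" by (intro linI) (auto simp: algebra_simps)
  let ?h = "\<lambda>f. ?y (pcmp 1 0 f) + opa Y (?y (pcmp 1 1 f)) + opd Y (?y (pcmp 1 2 f)) + opa Y (opd Y (?y (pcmp 1 3 f)))"
  have h: "fhom (QM 1 \<rho>) Y ?h"
  proof (rule fhom_from_QM[OF Y ly _ _ _ \<rho>])
    fix x :: "nat \<Rightarrow> 'a"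
    show "x 0 \<odot> y \<in> elm Y" using y(1) by simp
    show "opb Y (x 0 \<odot> y) = \<rho> \<odot> x 0 \<odot> y" "opc Y (x 0 \<odot> y) = \<rho> \<odot> x 0 \<odot> y"
      by (simp_all only: ap_simps y(2,3) fv.scale_scale mult.commute)
  qed
  have u: "unit 0 \<in> elm (QM 1 \<rho>)" by simp
  have "pcmp 1 0 (unit 0) 0 = (1 :: 'a)" "pcmp 1 1 (unit 0) 0 = (0 :: 'a)" "pcmp 1 2 (unit 0) 0 = (0 :: 'a)"
    "pcmp 1 3 (unit 0) 0 = (0 :: 'a)" by (simp_all add: pcmp_def unit_def)
  then have "?h (unit 0) = y" by (simp add: ap_simps)
  then have "?h (k (p (unit 0))) = y" using k(2)[OF u] by simp
  moreover have "p (unit 0) \<in> elm P" using fhomD(2)[OF _ u] P(1) by (auto simp: fiso_def)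
  moreover have "fhom P Y (\<lambda>x. ?h (k x))" using k(1) by (intro fhom_comp[OF P(2) _ h]) (simp add: fiso_def)
  ultimately show ?thesis by (intro exI[of _ "\<lambda>x. ?h (k x)"] conjI image_eqI[of _ _ "p (unit 0)"]) simp_all
qed

text \<open>The sums differ only in boundary terms; in the application these vanish because y_0 =
  y_(s+1) = 0.\<close>

lemma shift_sum:
  fixes h :: "nat \<Rightarrow> 'b::comm_monoid_add"
  assumes "h 0 = 0" "h (Suc s) = 0"
  shows "(\<Sum>j\<le>s. h (Suc j)) = (\<Sum>j\<le>s. h j)"
  using sum.atMost_Suc_shift[of h s] assms by simp

text \<open>Both sides have dimension 2t(2s + 1), so a homomorphism from right to left has to be
  shown onto only. Its image I is proved to contain, one kind after another, all u \<otimes> x_i, w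
  \<otimes> x_i, u \<otimes> y_i and w \<otimes> y_i.\<close>

lemma tensor_decomposition:
  assumes M: "D4_module M" and X: "D4_module X"
    and \<theta>: "fiso (KJ t t \<eta> \<rho>) M \<theta>" and \<phi>: "fiso (Om s \<tau>) X \<phi>"
    and \<rho>: "\<rho> * \<rho> = 1" and \<tau>: "\<tau> * \<tau> = 1"
    and P: "fiso (QM 1 (\<rho> * \<tau>)) P p" "wf_rep P"
    and N: "fiso (KJ t t \<eta> (\<rho> * \<tau>)) N \<nu>" "wf_rep N"
  shows "M \<otimes>\<^sub>D X \<cong>\<^sub>D copies (s * t) P \<oplus>\<^sub>D N"
proof -
  note wM = D4_module_wf[OF M] and wX = D4_module_wf[OF X]
  let ?Y = "M \<otimes>\<^sub>D X" and ?n = "mdim X" and ?K = "KJ t t \<eta> \<rho>"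
  have Y: "D4_module ?Y" by (rule D4_module_tensor[OF M X])
  note wY = D4_module_wf[OF Y]
  have \<theta>h: "fhom ?K M \<theta>" "\<theta> ` elm ?K = elm M" and \<phi>h: "fhom (Om s \<tau>) X \<phi>" "\<phi> ` elm (Om s \<tau>) = elm X"
    using \<theta> \<phi> by (auto simp: fiso_def bij_betw_def)
  note \<theta>l = fhomD(1)[OF \<theta>h(1)] and \<phi>l = fhomD(1)[OF \<phi>h(1)]
  \<comment> \<open>The action of d once a identifies top and socle: a Jordan block for the
    eigenvalue -\<eta>. The truncations make it total with values in k^t.\<close>
  define J :: "(nat \<Rightarrow> 'a) \<Rightarrow> nat \<Rightarrow> 'a" where
    "J f = (\<lambda>i. if i < t then trunc t f (Suc i) - \<eta> * trunc t f i else 0)" for f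
  define u where "u f = \<theta> (trunc t f)" for f
  define w where "w f = \<theta> (emb t (trunc t f))" for f
  define x where "x i = \<phi> (unit i)" for i
  \<comment> \<open>With y_0 = y_(s+1) = 0 the rules a x_i = y_i and d x_i = y_(i+1) hold for all i
    \<le> s without boundary cases.\<close>
  define y where "y j = \<phi> (if 1 \<le> j \<and> j \<le> s then unit (s + j) else 0)" for j
  have lJ: "lin J" unfolding J_def by (auto intro!: linI simp: trunc_def algebra_simps)
  have lu: "lin u" unfolding u_def by (rule lin_comp[OF \<theta>l lin_trunc])
  have lw: "lin w" unfolding w_def by (rule lin_comp[OF \<theta>l lin_comp[OF lin_emb lin_trunc]])
  have te: "trunc t f \<in> elm ?K" "emb t (trunc t f) \<in> elm ?K" for f :: "nat \<Rightarrow> 'a"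
    by (auto simp: trunc_def emb_def fsp_def)
  have te': "trunc t f \<in> fsp (t + t)" "emb t (trunc t f) \<in> fsp (t + t)" for f :: "nat \<Rightarrow> 'a"
    using te by simp_all
  note opK = op_KM[OF lin_trunc KJ_maps(1) trunc_fsp KJ_maps(2), of _ t t \<eta> \<rho>, folded KJ_def]
  have ue: "u f \<in> elm M" and we: "w f \<in> elm M" for f
    unfolding u_def w_def by (rule fhomD(2)[OF \<theta>h(1) te(1)], rule fhomD(2)[OF \<theta>h(1) te(2)])
  have JJ: "(\<lambda>i. if i < t then trunc t (trunc t f) (Suc i) - \<eta> * trunc t (trunc t f) i else 0) = trunc t (J f)" for f
    by (auto simp: J_def trunc_def)
  have uop: "opa M (u f) = w f" "opd M (u f) = w (J f)" "opb M (u f) = \<rho> \<odot> u f" "opc M (u f) = \<rho> \<odot> u f" for f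
    unfolding u_def w_def fhomD(3-6)[OF \<theta>h(1) te(1), symmetric]
    by (simp_all add: opK[OF te'(1)] lin_simps[OF \<theta>l] split_simps JJ)
  have wop: "opa M (w f) = 0" "opd M (w f) = 0" "opb M (w f) = - (\<rho> \<odot> w f)" "opc M (w f) = - (\<rho> \<odot> w f)" for f
  proof -
    have z: "(\<lambda>i. if i < t then (0 :: nat \<Rightarrow> 'a) (Suc i) - \<eta> * (0 :: nat \<Rightarrow> 'a) i else 0) = 0" by auto
    show "opa M (w f) = 0" "opd M (w f) = 0" "opb M (w f) = - (\<rho> \<odot> w f)" "opc M (w f) = - (\<rho> \<odot> w f)"
      unfolding w_def fhomD(3-6)[OF \<theta>h(1) te(2), symmetric] opK[OF te'(2)] trunc_drp_emb
      by (simp_all add: lin_simps[OF \<theta>l] split_simps z)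
  qed
  have xm: "unit i \<in> elm (Om s \<tau>)" if "i \<le> s" for i using that by simp
  have ym: "(if 1 \<le> j \<and> j \<le> s then unit (s + j) else 0) \<in> elm (Om s \<tau>)" for j by simp
  have xe: "x i \<in> elm X" if "i \<le> s" for i unfolding x_def by (rule fhomD(2)[OF \<phi>h(1) xm[OF that]])
  have ye: "y j \<in> elm X" for j unfolding y_def by (rule fhomD(2)[OF \<phi>h(1) ym])
  have y0: "y 0 = 0" "y (Suc s) = 0" by (simp_all add: y_def lin_zero[OF \<phi>l])
  have xop: "opa X (x i) = y i" "opd X (x i) = y (Suc i)" "opb X (x i) = \<tau> \<odot> x i" "opc X (x i) = \<tau> \<odot> x i"
    if i: "i \<le> s" for i
  proof -
    have xm': "unit i \<in> fsp (Suc s + s)" using i by simp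
    have "opa (Om s \<tau>) (unit i) = (if 1 \<le> i \<and> i \<le> s then unit (s + i) else 0)"
      "opd (Om s \<tau>) (unit i) = (if 1 \<le> Suc i \<and> Suc i \<le> s then unit (s + Suc i) else 0)"
      "opb (Om s \<tau>) (unit i) = \<tau> \<odot> unit i" "opc (Om s \<tau>) (unit i) = \<tau> \<odot> unit i"
      unfolding op_Om[OF xm'] using i by (auto simp: fun_eq_iff unit_def)
    then show "opa X (x i) = y i" "opd X (x i) = y (Suc i)" "opb X (x i) = \<tau> \<odot> x i" "opc X (x i) = \<tau> \<odot> x i"
      unfolding x_def y_def fhomD(3-6)[OF \<phi>h(1) xm[OF i], symmetric] by (simp_all only: lin_sm[OF \<phi>l])
  qed
  have yop: "opa X (y j) = 0" "opd X (y j) = 0" "opb X (y j) = - (\<tau> \<odot> y j)" "opc X (y j) = - (\<tau> \<odot> y j)" for j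
  proof -
    let ?u = "(if 1 \<le> j \<and> j \<le> s then unit (s + j) else 0) :: nat \<Rightarrow> 'a"
    have ym': "?u \<in> fsp (Suc s + s)" by simp
    have "opa (Om s \<tau>) ?u = 0" "opd (Om s \<tau>) ?u = 0" "opb (Om s \<tau>) ?u = - (\<tau> \<odot> ?u)" "opc (Om s \<tau>) ?u = - (\<tau> \<odot> ?u)"
      unfolding op_Om[OF ym'] by (auto simp: fun_eq_iff unit_def)
    then show "opa X (y j) = 0" "opd X (y j) = 0" "opb X (y j) = - (\<tau> \<odot> y j)" "opc X (y j) = - (\<tau> \<odot> y j)"
      unfolding y_def fhomD(3-6)[OF \<phi>h(1) ym, symmetric] by (simp_all only: lin_simps[OF \<phi>l])
  qed
  note opT = op_tensor[OF wM wX]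
  have ux: "opa ?Y (tens ?n (u f) (x i)) = \<tau> \<odot> tens ?n (w f) (x i) + tens ?n (u f) (y i)"
      "opd ?Y (tens ?n (u f) (x i)) = \<tau> \<odot> tens ?n (w (J f)) (x i) + tens ?n (u f) (y (Suc i))"
      "opb ?Y (tens ?n (u f) (x i)) = (\<rho> * \<tau>) \<odot> tens ?n (u f) (x i)"
      "opc ?Y (tens ?n (u f) (x i)) = (\<rho> * \<tau>) \<odot> tens ?n (u f) (x i)"
    and wx: "opa ?Y (tens ?n (w f) (x i)) = tens ?n (w f) (y i)"
      "opd ?Y (tens ?n (w f) (x i)) = tens ?n (w f) (y (Suc i))"
      "opb ?Y (tens ?n (w f) (x i)) = - ((\<rho> * \<tau>) \<odot> tens ?n (w f) (x i))"
      "opc ?Y (tens ?n (w f) (x i)) = - ((\<rho> * \<tau>) \<odot> tens ?n (w f) (x i))" if "i \<le> s" for f i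
    by (simp_all add: opT[OF ue] opT[OF we] uop wop xop[OF that] tens_simps mult.commute)
  have uy: "opa ?Y (tens ?n (u f) (y j)) = - (\<tau> \<odot> tens ?n (w f) (y j))"
      "opd ?Y (tens ?n (u f) (y j)) = - (\<tau> \<odot> tens ?n (w (J f)) (y j))"
      "opb ?Y (tens ?n (u f) (y j)) = - ((\<rho> * \<tau>) \<odot> tens ?n (u f) (y j))"
      "opc ?Y (tens ?n (u f) (y j)) = - ((\<rho> * \<tau>) \<odot> tens ?n (u f) (y j))" for f j
    by (simp_all add: opT[OF ue] uop yop tens_simps mult.commute)
  have ty0: "tens ?n v (y 0) = 0" "tens ?n v (y (Suc s)) = 0" for v by (simp_all add: y0 tens_simps)
  \<comment> \<open>Since d raises the index of y by one, the exponent of J falls as j grows: after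
    reindexing both sums match, and d (k f) = a (k (J f)).\<close>
  define k where "k f = (\<Sum>j\<le>s. tens ?n (u ((J ^^ (s - j)) f)) (x j))" for f
  \<comment> \<open>Chosen as \<tau> times a (k f), with \<tau>^2 = 1; this is why the embedding of
    the pencil below carries a factor \<tau> on its socle.\<close>
  define z where "z f = (\<Sum>j\<le>s. tens ?n (w ((J ^^ (s - j)) f)) (x j)) + \<tau> \<odot> (\<Sum>j\<le>s. tens ?n (u ((J ^^ (s - j)) f)) (y j))" for f
  have tl: "lin (\<lambda>f. tens ?n (g ((J ^^ i) f)) a)" if "lin g" for g a i
    by (rule lin_comp[OF lin_tens(1) lin_comp[OF that lin_funpow[OF lJ]]])
  have lk: "lin k" "lin z" unfolding k_def z_def by (intro lin_plus lin_sm_fun lin_sum_fun tl lu lw)+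
  have shift: "(\<Sum>j\<le>s. tens ?n (g ((J ^^ (s - j)) f)) (y (Suc j))) = (\<Sum>j\<le>s. tens ?n (g ((J ^^ (s - j)) (J f))) (y j))" for g f
  proof -
    let ?h = "\<lambda>j. tens ?n (g ((J ^^ (Suc s - j)) f)) (y j)"
    have "(\<Sum>j\<le>s. ?h (Suc j)) = (\<Sum>j\<le>s. ?h j)" by (rule shift_sum[of ?h s]) (simp_all add: ty0)
    moreover have "(\<Sum>j\<le>s. ?h j) = (\<Sum>j\<le>s. tens ?n (g ((J ^^ (s - j)) (J f))) (y j))"
      by (intro sum.cong refl) (simp add: Suc_diff_le funpow_swap1)
    ultimately show ?thesis by simp
  qed
  have \<tau>s: "\<tau> \<odot> \<tau> \<odot> a = a" for a :: "nat \<Rightarrow> 'a" using \<tau> by simp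
  have ak: "opa ?Y (k f) = \<tau> \<odot> z f" for f
  proof -
    have "opa ?Y (k f) = (\<Sum>j\<le>s. \<tau> \<odot> tens ?n (w ((J ^^ (s - j)) f)) (x j) + tens ?n (u ((J ^^ (s - j)) f)) (y j))"
      by (simp add: k_def ap_simps ux)
    then show ?thesis
      by (simp only: z_def fv.scale_right_distrib \<tau>s sum.distrib fv.scale_sum_right)
  qed
  have dk: "opd ?Y (k f) = \<tau> \<odot> z (J f)" for f
  proof -
    have "opd ?Y (k f) = (\<Sum>j\<le>s. \<tau> \<odot> tens ?n (w ((J ^^ (s - j)) (J f))) (x j) + tens ?n (u ((J ^^ (s - j)) f)) (y (Suc j)))"
      by (simp add: k_def ap_simps ux funpow_swap1)
    then show ?thesis
      by (simp only: z_def fv.scale_right_distrib \<tau>s sum.distrib fv.scale_sum_right shift)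
  qed
  have az: "opa ?Y (z f) = 0" for f
    by (simp add: z_def ap_simps wx uy sum_negf fv.scale_sum_right[symmetric] \<tau>)
  have dz: "opd ?Y (z f) = 0" for f
  proof -
    have "opd ?Y (z f) = (\<Sum>j\<le>s. tens ?n (w ((J ^^ (s - j)) f)) (y (Suc j))) - (\<Sum>j\<le>s. tens ?n (w ((J ^^ (s - j)) (J f))) (y j))"
      by (simp add: z_def ap_simps wx uy sum_negf fv.scale_sum_right[symmetric] \<tau> funpow_swap1)
    then show ?thesis by (simp add: shift)
  qed
  have bk: "opb ?Y (k f) = (\<rho> * \<tau>) \<odot> k f" "opc ?Y (k f) = (\<rho> * \<tau>) \<odot> k f" for f
    by (simp_all add: k_def ap_simps ux fv.scale_sum_right)
  have bz: "opb ?Y (z f) = - ((\<rho> * \<tau>) \<odot> z f)" "opc ?Y (z f) = - ((\<rho> * \<tau>) \<odot> z f)" for f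
    by (simp_all add: z_def ap_simps wx uy fv.scale_sum_right fv.scale_right_distrib sum_negf mult.commute mult.left_commute)
  have uxe: "tens ?n (u f) (x i) \<in> elm ?Y" "tens ?n (w f) (x i) \<in> elm ?Y" if "i \<le> s" for f i
    using tens_fsp[OF ue xe[OF that]] tens_fsp[OF we xe[OF that]] by simp_all
  have uye: "tens ?n (u f) (y i) \<in> elm ?Y" for f i
    using tens_fsp[OF ue ye] by simp
  have kze: "k f \<in> elm ?Y" "z f \<in> elm ?Y" for f
    unfolding k_def z_def by (auto intro!: fsp_sum fsp_closed uxe uye simp del: mdim_tensor)
  have \<kappa>: "fhom (KJ t t \<eta> (\<rho> * \<tau>)) ?Y (\<lambda>f. k (trunc t f) + \<tau> \<odot> z (drp t f))" (is "fhom ?KN ?Y ?\<kappa>")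
    unfolding KJ_def
  proof (rule fhom_from_KM[OF lin_trunc KJ_maps(1) trunc_fsp KJ_maps(2) lk(1) lin_sm_fun[OF lk(2)]])
    fix f :: "nat \<Rightarrow> 'a" assume f: "f \<in> fsp t"
    show "k f \<in> elm ?Y" "\<tau> \<odot> z f \<in> elm ?Y" using kze by simp_all
    show "opa ?Y (k f) = \<tau> \<odot> z (trunc t f)" using ak trunc_id[OF f] by simp
    have "J f = (\<lambda>i. if i < t then f (Suc i) - \<eta> * f i else 0)" unfolding J_def trunc_id[OF f] ..
    then show "opd ?Y (k f) = \<tau> \<odot> z (\<lambda>i. if i < t then f (Suc i) - \<eta> * f i else 0)" using dk by simp
    show "opa ?Y (\<tau> \<odot> z f) = 0" "opd ?Y (\<tau> \<odot> z f) = 0" by (simp_all add: ap_simps az dz)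
    show "opb ?Y (k f) = (\<rho> * \<tau>) \<odot> k f" "opc ?Y (k f) = (\<rho> * \<tau>) \<odot> k f" by (rule bk)+
    show "opb ?Y (\<tau> \<odot> z f) = - ((\<rho> * \<tau>) \<odot> \<tau> \<odot> z f)" "opc ?Y (\<tau> \<odot> z f) = - ((\<rho> * \<tau>) \<odot> \<tau> \<odot> z f)"
      by (simp_all add: ap_simps bz mult.commute)
  qed
  obtain \<nu>' where \<nu>': "fiso N ?KN \<nu>'" by (rule fiso_inverse[OF wf_KJ N(2,1)])
  then have \<nu>h: "fhom N ?KN \<nu>'" "\<nu>' ` elm N = elm ?KN" by (auto simp: fiso_def bij_betw_def)
  have hN: "fhom N ?Y (\<lambda>f. ?\<kappa> (\<nu>' f))" by (rule fhom_comp[OF N(2) \<nu>h(1) \<kappa>])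
  have imN: "(\<lambda>f. ?\<kappa> (\<nu>' f)) ` elm N = ?\<kappa> ` elm ?KN" unfolding \<nu>h(2)[symmetric] by (simp add: image_image)
  \<comment> \<open>The number l = i t + m encodes the generator u_m \<otimes> x_i, where i < s and
    m < t.\<close>
  let ?g = "\<lambda>l. tens ?n (u (unit (l mod t))) (x (l div t))"
  have "\<exists>h. fhom P ?Y h \<and> ?g l \<in> h ` elm P" if "l < s * t" for l
  proof (rule projective_generator[OF P Y])
    have i: "l div t \<le> s" using less_mult_imp_div_less[OF that] by simp
    show "?g l \<in> elm ?Y" by (rule uxe(1)[OF i])
    show "opb ?Y (?g l) = (\<rho> * \<tau>) \<odot> ?g l" "opc ?Y (?g l) = (\<rho> * \<tau>) \<odot> ?g l" by (rule ux(3,4)[OF i])+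
    have "\<rho> * \<tau> * (\<rho> * \<tau>) = (\<rho> * \<rho>) * (\<tau> * \<tau>)" by (simp add: ac_simps)
    then show "\<rho> * \<tau> * (\<rho> * \<tau>) = 1" using \<rho> \<tau> by simp
  qed
  then obtain hP where hP: "fhom (copies (s * t) P) ?Y hP" "\<And>l. l < s * t \<Longrightarrow> ?g l \<in> hP ` elm (copies (s * t) P)"
    using fhom_from_copies[OF P(2) wY, of "s * t" ?g] by blast
  let ?C = "copies (s * t) P"
  note wC = wf_copies[OF P(2), of "s * t"]
  let ?H = "\<lambda>f. hP (trunc (mdim ?C) f) + ?\<kappa> (\<nu>' (drp (mdim ?C) f))"
  have H: "fhom (?C \<oplus>\<^sub>D N) ?Y ?H" by (rule fhom_dsum[OF wC N(2) hP(1) hN])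
  define I where "I = ?H ` elm (?C \<oplus>\<^sub>D N)"
  have I: "fsub ?Y I" unfolding I_def by (rule fsub_image[OF H fsub_elm[OF wf_dsum[OF wC N(2)]]])
  note Ic = fsubD[OF I]
  have Ieq: "I = {a + b |a b. a \<in> hP ` elm ?C \<and> b \<in> ?\<kappa> ` elm ?KN}"
    unfolding I_def mdim_dsum dsum_image[OF fhomD(1)[OF hP(1)] fhomD(1)[OF hN]] imN ..
  have Isum: "(\<Sum>i\<in>A. F i) \<in> I" if "\<And>i. i \<in> A \<Longrightarrow> F i \<in> I" for F and A :: "nat set"
    using fv.subspace_sum[OF Ic(1)] that by blast
  have IP: "?g l \<in> I" if "l < s * t" for l
  proof -
    have "0 \<in> ?\<kappa> ` elm ?KN" using fhom_zero_image[OF \<kappa>] .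
    then have "?g l + 0 \<in> I" unfolding Ieq using hP(2)[OF that] by blast
    then show ?thesis by simp
  qed
  have Ik: "k f \<in> I" if f: "f \<in> fsp t" for f
  proof -
    have "0 \<in> hP ` elm ?C" using fhom_zero_image[OF hP(1)] .
    moreover have "k f \<in> ?\<kappa> ` elm ?KN"
    proof (rule image_eqI)
      show "k f = ?\<kappa> f" using f by (simp add: trunc_id drp_eq_0 lin_zero[OF lk(2)])
      show "f \<in> elm ?KN" using f by (auto simp: fsp_def)
    qed
    ultimately have "0 + k f \<in> I" unfolding Ieq by blast
    then show ?thesis by simp
  qed
  have \<tau>c: "a \<in> I" if "\<tau> \<odot> a + b \<in> I" "b \<in> I" for a b
  proof -
    have "\<tau> \<odot> ((\<tau> \<odot> a + b) - b) \<in> I" using that Ic(9,10) by blast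
    then show ?thesis by (simp add: \<tau>)
  qed
  have 1: "tens ?n (u f) (x i) \<in> I" if i: "i < s" for f i
  proof -
    have "u (unit m) = \<theta> (unit m)" if "m < t" for m
      using that by (simp add: u_def trunc_id)
    have "u f = (\<Sum>m<t. f m \<odot> u (unit m))"
    proof -
      have "u f = u (trunc t f)" by (simp add: u_def)
      also have "\<dots> = (\<Sum>m<t. trunc t f m \<odot> u (unit m))" by (rule lin_expand[OF lu trunc_fsp])
      also have "\<dots> = (\<Sum>m<t. f m \<odot> u (unit m))" by (intro sum.cong) (auto simp: trunc_def)
      finally show ?thesis .
    qed
    then have "tens ?n (u f) (x i) = (\<Sum>m<t. f m \<odot> tens ?n (u (unit m)) (x i))" by (simp add: tens_simps)
    also have "\<dots> \<in> I"
    proof (intro Isum Ic(10))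
      fix m assume "m \<in> {..<t}"
      then have m: "m < t" by simp
      have "i * t + m < s * t"
      proof -
        have "i * t + m < Suc i * t" using m by simp
        also have "\<dots> \<le> s * t" using i by (intro mult_le_mono1) simp
        finally show ?thesis .
      qed
      from IP[OF this] show "tens ?n (u (unit m)) (x i) \<in> I" using m by simp
    qed
    finally show ?thesis .
  qed
  \<comment> \<open>Solve a d (u f \<otimes> x_j) = \<tau> (w (J f) \<otimes> y_j - w f \<otimes>
    y_(j+1)) for its last term, starting from y_0 = 0.\<close>
  have 4: "tens ?n (w f) (y j) \<in> I" if "j \<le> s" for f j
    using that
  proof (induction j arbitrary: f)
    case 0
    show ?case unfolding ty0 by (rule Ic(7))
  next
    case (Suc j)
    have "opa ?Y (opd ?Y (tens ?n (u f) (x j))) \<in> I" using Ic(3,6) 1 Suc.prems by simp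
    then have "- (\<tau> \<odot> tens ?n (w f) (y (Suc j))) + \<tau> \<odot> tens ?n (w (J f)) (y j) \<in> I"
      using Suc.prems by (simp add: ux wx uy ap_simps)
    moreover have "\<tau> \<odot> tens ?n (w (J f)) (y j) \<in> I" using Suc Ic(10) by simp
    ultimately have "- (- (\<tau> \<odot> tens ?n (w f) (y (Suc j))) + \<tau> \<odot> tens ?n (w (J f)) (y j)) + \<tau> \<odot> tens ?n (w (J f)) (y j) \<in> I"
      using Ic(8,11) by blast
    then have "\<tau> \<odot> tens ?n (w f) (y (Suc j)) + 0 \<in> I" by simp
    then show ?case using \<tau>c Ic(7) by blast
  qed
  \<comment> \<open>Alternation of a and d: a (u \<otimes> x_i) yields w \<otimes> x_i once u
    \<otimes> y_i is available, and then d (u \<otimes> x_i) yields u \<otimes> y_(i+1).\<close>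
  have 23: "(\<forall>f. tens ?n (u f) (y i) \<in> I) \<and> (i < s \<longrightarrow> (\<forall>f. tens ?n (w f) (x i) \<in> I))" if "i \<le> s" for i
  proof -
    have step: "tens ?n (w f) (x i) \<in> I" if "i < s" "\<And>f. tens ?n (u f) (y i) \<in> I" for i f
    proof -
      have "opa ?Y (tens ?n (u f) (x i)) \<in> I" using Ic(3) 1 that by simp
      then have "\<tau> \<odot> tens ?n (w f) (x i) + tens ?n (u f) (y i) \<in> I" using that(1) by (simp add: ux)
      then show ?thesis using \<tau>c that(2) by blast
    qed
    have "\<forall>f. tens ?n (u f) (y i) \<in> I" using that
    proof (induction i)
      case 0
      show ?case by (simp only: ty0 Ic(7) simp_thms)
    next
      case (Suc i)
      show ?case
      proof
        fix f
        have "opd ?Y (tens ?n (u f) (x i)) \<in> I" using Ic(6) 1 Suc.prems by simp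
        then have "\<tau> \<odot> tens ?n (w (J f)) (x i) + tens ?n (u f) (y (Suc i)) \<in> I"
          using Suc.prems by (simp add: ux)
        moreover have "\<tau> \<odot> tens ?n (w (J f)) (x i) \<in> I" using step Suc Ic(10) by simp
        ultimately have "(\<tau> \<odot> tens ?n (w (J f)) (x i) + tens ?n (u f) (y (Suc i))) - \<tau> \<odot> tens ?n (w (J f)) (x i) \<in> I"
          using Ic(9) by blast
        then show "tens ?n (u f) (y (Suc i)) \<in> I" by simp
      qed
    qed
    then show ?thesis using step by blast
  qed
  \<comment> \<open>The free part stops before x_s. The missing vectors come from k f, whose term
    for j = s is u f \<otimes> x_s and whose other terms have j < s.\<close>
  have Iux: "tens ?n (u f) (x i) \<in> I" if i: "i \<le> s" for f i
  proof (cases "i = s")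
    case True
    let ?S = "\<Sum>j<s. tens ?n (u ((J ^^ (s - j)) (trunc t f))) (x j)"
    have "?S \<in> I" using 1 by (intro Isum) simp
    then have "k (trunc t f) - ?S \<in> I" by (rule Ic(9)[OF Ik[OF trunc_fsp]])
    moreover have "k (trunc t f) = tens ?n (u f) (x s) + ?S"
      by (simp add: k_def lessThan_Suc_atMost[symmetric] add.commute u_def)
    ultimately have "tens ?n (u f) (x s) \<in> I" by simp
    then show ?thesis using True by simp
  qed (use 1 i in simp)
  have Iwx: "tens ?n (w f) (x i) \<in> I" if i: "i \<le> s" for f i
  proof -
    have "opa ?Y (tens ?n (u f) (x i)) \<in> I" using Ic(3) Iux[OF i] by simp
    then have "\<tau> \<odot> tens ?n (w f) (x i) + tens ?n (u f) (y i) \<in> I" using i by (simp add: ux)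
    then show ?thesis using \<tau>c 23[OF i] by blast
  qed
  have "elm ?Y \<subseteq> I"
    unfolding mdim_tensor
  proof (rule tens_span[OF Ic(1)])
    fix v a assume v: "v \<in> elm M" and a: "a \<in> elm X"
    obtain f where f: "f \<in> elm ?K" "v = \<theta> f" using v \<theta>h(2) by blast
    have d: "drp t f \<in> fsp t" using f(1) by (intro drp_fsp) simp
    have vu: "v = u f + w (drp t f)"
      using lin_add[OF \<theta>l, of "trunc t f" "emb t (drp t f)"]
      by (simp add: f(2) split_fsp u_def w_def trunc_id[OF d])
    obtain b where b: "b \<in> elm (Om s \<tau>)" "a = \<phi> b" using a \<phi>h(2) by blast
    have basis: "tens ?n v (\<phi> (unit j)) \<in> I" if j: "j < Suc s + s" for j
    proof (cases "j \<le> s")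
      case True
      then have "tens ?n (u f) (x j) + tens ?n (w (drp t f)) (x j) \<in> I" using Iux Iwx Ic(8) by blast
      then show ?thesis by (simp add: vu tens_simps x_def)
    next
      case False
      define i where "i = j - s"
      have i: "1 \<le> i" "i \<le> s" "j = s + i" using False j by (auto simp: i_def)
      then have "tens ?n (u f) (y i) + tens ?n (w (drp t f)) (y i) \<in> I" using 4 23 Ic(8) by blast
      then show ?thesis using i by (simp add: vu tens_simps y_def)
    qed
    have "a = (\<Sum>j<Suc s + s. b j \<odot> \<phi> (unit j))" using lin_expand[OF \<phi>l, of b "Suc s + s"] b by simp
    then have "tens ?n v a = (\<Sum>j<Suc s + s. b j \<odot> tens ?n v (\<phi> (unit j)))" by (simp only: tens_simps)
    also have "\<dots> \<in> I" by (intro Isum Ic(10) basis) simp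
    finally show "tens ?n v a \<in> I" .
  qed
  moreover have "mdim (?C \<oplus>\<^sub>D N) = mdim ?Y"
  proof -
    have "mdim M = t + t" "mdim N = t + t" "mdim X = Suc s + s" "mdim P = 4"
      using fiso_dim[OF wf_KJ wM \<theta>] fiso_dim[OF wf_Om wX \<phi>] fiso_dim[OF wf_QM P(2,1)] fiso_dim[OF wf_KJ N(2,1)]
      by simp_all
    then show ?thesis by (simp only: mdim_dsum mdim_copies mdim_tensor) (simp add: algebra_simps)
  qed
  ultimately have "fiso (?C \<oplus>\<^sub>D N) ?Y ?H" using fhom_surj_fiso[OF H] by (simp add: I_def)
  then obtain g where "fiso ?Y (?C \<oplus>\<^sub>D N) g" by (rule fiso_inverse[OF wf_dsum[OF wC N(2)] wY])
  then show ?thesis using D4_iso_iff[OF wY wf_dsum[OF wC N(2)]] by blast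
qed

section \<open>The symmetry exchanging \<open>a, b\<close> with \<open>d, c\<close>\<close>

text \<open>The twist of a module by a Hopf algebra automorphism: the relation d a + a d = 1 - b c
  is symmetric, and the coproducts of a and d correspond to each other, so the exchange respects
  tensor products as well.\<close>

definition swp :: "'k::field rep \<Rightarrow> 'k rep" where
  "swp M = \<lparr>mdim = mdim M, act_a = act_d M, act_b = act_c M, act_c = act_b M, act_d = act_a M\<rparr>"

lemma swp_simps [simp]: "mdim (swp M) = mdim M" "act_a (swp M) = act_d M" "act_b (swp M) = act_c M"
  "act_c (swp M) = act_b M" "act_d (swp M) = act_a M" "swp (swp M) = M"
  by (simp_all add: swp_def)

lemma wf_swp: "wf_rep (swp M) = wf_rep M"
  by (auto simp: wf_rep_def)

lemma D4_module_swp: "D4_module (swp M) \<longleftrightarrow> D4_module M"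
proof -
  have "D4_module (swp M)" if "D4_module M" for M :: "'a rep"
    using that by (auto simp: D4_module_iff wf_swp D4_relations_def)
  from this[of M] this[of "swp M"] show ?thesis by auto
qed

lemma D4_hom_swp: "D4_hom (swp M) N = D4_hom M (swp N)"
  by (auto simp: D4_hom_def)

lemma D4_iso_swp: "swp M \<cong>\<^sub>D N \<longleftrightarrow> M \<cong>\<^sub>D swp N"
  by (simp add: D4_iso_def D4_hom_swp)

lemma D4_surj_swp: "D4_surj (swp M) N = D4_surj M (swp N)"
  by (simp add: D4_surj_def D4_hom_swp)

lemma D4_inj_swp: "D4_inj (swp M) N = D4_inj M (swp N)"
  by (simp add: D4_inj_def D4_hom_swp)

lemma dsum_swp: "swp (M \<oplus>\<^sub>D N) = swp M \<oplus>\<^sub>D swp N"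
  by (simp add: dsum_def swp_def)

lemma tensor_swp: "swp (M \<otimes>\<^sub>D N) = swp M \<otimes>\<^sub>D swp N"
  by (simp add: tensor_def swp_def)

lemma copies_swp: "swp (copies n M) = copies n (swp M)"
  by (induction n) (simp_all add: dsum_swp, simp add: swp_def zero_rep_def)

lemma D4_submodule_swp: "D4_submodule (swp M) W \<longleftrightarrow> D4_submodule M W"
  by (auto simp: D4_submodule_def)

lemma maximal_in_swp: "maximal_in (swp M) = maximal_in M"
  by (simp add: maximal_in_def D4_submodule_swp fun_eq_iff)

lemma soc_swp: "soc (swp M) = soc M"
  by (simp add: soc_def simple_submodule_def D4_submodule_swp maximal_in_swp)

lemma Loewy_length_swp: "Loewy_length (swp M) = Loewy_length M"
proof -
  have "rad (swp M) = rad M" by (simp add: rad_def maximal_in_swp fun_eq_iff)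
  then show ?thesis by (simp add: Loewy_length_def)
qed

lemma has_length_swp: "has_length (swp M) n \<longleftrightarrow> has_length M n"
  by (simp add: has_length_def maximal_in_swp)

lemma is_submodule_rep_swp: "is_submodule_rep (swp M) W N \<longleftrightarrow> is_submodule_rep M W (swp N)"
  by (simp add: is_submodule_rep_def D4_module_swp D4_inj_swp[of N, symmetric])

lemma is_quotient_rep_swp: "is_quotient_rep (swp M) W N \<longleftrightarrow> is_quotient_rep M W (swp N)"
  by (simp add: is_quotient_rep_def D4_module_swp D4_surj_swp)

lemma indecomposable_swp: "indecomposable M \<Longrightarrow> indecomposable (swp M)"
  unfolding indecomposable_def
proof (intro conjI allI impI)
  fix N N' :: "'a rep"
  assume M: "D4_module M \<and> mdim M \<noteq> 0 \<and>
    (\<forall>N N'. D4_module N \<longrightarrow> D4_module N' \<longrightarrow> M \<cong>\<^sub>D N \<oplus>\<^sub>D N' \<longrightarrow> mdim N = 0 \<or> mdim N' = 0)"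
    and N: "D4_module N" "D4_module N'" "swp M \<cong>\<^sub>D N \<oplus>\<^sub>D N'"
  have iso: "M \<cong>\<^sub>D swp N \<oplus>\<^sub>D swp N'" using N(3) by (simp add: D4_iso_swp dsum_swp)
  have sN: "D4_module (swp N)" "D4_module (swp N')" using N(1,2) by (simp_all add: D4_module_swp)
  have "mdim (swp N) = 0 \<or> mdim (swp N') = 0"
    by (rule M[THEN conjunct2, THEN conjunct2, rule_format, OF sN iso])
  then show "mdim N = 0 \<or> mdim N' = 0" by simp
qed (simp_all add: D4_module_swp)

lemma has_type_swp:
  assumes "has_type M s t"
  shows "has_type (swp M) s t"
proof -
  obtain Q S where Q: "is_quotient_rep M (soc M) Q" "has_length Q s"
    and S: "is_submodule_rep M (soc M) S" "has_length S t"
    using assms by (auto simp: has_type_def)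
  have "is_quotient_rep (swp M) (soc (swp M)) (swp Q)" "is_submodule_rep (swp M) (soc (swp M)) (swp S)"
    using Q(1) S(1) by (simp_all add: soc_swp is_quotient_rep_swp is_submodule_rep_swp)
  moreover have "has_length (swp Q) s" "has_length (swp S) t"
    using Q(2) S(2) by (simp_all add: has_length_swp)
  ultimately show ?thesis
    using assms indecomposable_swp[of M] by (auto simp: has_type_def Loewy_length_swp)
qed

lemma superfluous_swp: "superfluous (swp M) K \<longleftrightarrow> superfluous M K"
  by (simp add: superfluous_def D4_submodule_swp)

lemma D4_projective_swp: "D4_projective P \<Longrightarrow> D4_projective (swp P)"
  unfolding D4_projective_def
proof (intro conjI allI ballI impI)
  fix X Y :: "'a rep" and g f
  assume P: "D4_module P \<and> (\<forall>X Y. \<forall>g\<in>D4_surj X Y. \<forall>f\<in>D4_hom P Y. D4_module X \<longrightarrow> D4_module Y \<longrightarrow>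
      (\<exists>h\<in>D4_hom P X. g * h = f))"
    and g: "g \<in> D4_surj X Y" and f: "f \<in> D4_hom (swp P) Y" and X: "D4_module X" and Y: "D4_module Y"
  have g': "g \<in> D4_surj (swp X) (swp Y)" and f': "f \<in> D4_hom P (swp Y)"
    using g f by (simp_all add: D4_surj_swp D4_hom_swp)
  have XY: "D4_module (swp X)" "D4_module (swp Y)" using X Y by (simp_all add: D4_module_swp)
  show "\<exists>h\<in>D4_hom (swp P) X. g * h = f"
    unfolding D4_hom_swp by (rule P[THEN conjunct2, rule_format, OF g' f' XY])
qed (simp add: D4_module_swp)

lemma projective_cover_swp: "projective_cover P f M \<Longrightarrow> projective_cover (swp P) f (swp M)"
  by (simp add: projective_cover_def D4_projective_swp D4_module_swp D4_surj_swp superfluous_swp)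

lemma V_swp: "swp (V r) = V r"
  by (simp add: swp_def V_def)

lemma is_P_swp: "is_P r P \<Longrightarrow> is_P r (swp P)"
  unfolding is_P_def using projective_cover_swp V_swp by metis

lemma is_Omega_swp: "is_Omega s M X \<Longrightarrow> is_Omega s (swp M) (swp X)"
proof (induction rule: is_Omega.induct)
  case (zero M N)
  then show ?case by (intro is_Omega.zero) (simp_all add: D4_module_swp D4_iso_swp)
next
  case (Suc s M N P f K)
  then show ?case
    by (intro is_Omega.Suc[OF _ projective_cover_swp]) (simp_all add: is_submodule_rep_swp)
qed

text \<open>At infinity a kills v_1 and d sends it to v_2; after the exchange this is the point
  0.\<close>

lemma M1_swp: "swp (M1 r Infty) = M1 r (Fin 0)"
  by (simp add: swp_def M1_def Let_def)

lemma is_Ms_swp: "is_Ms s r Infty M \<Longrightarrow> is_Ms s r (Fin 0) (swp M)"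
  unfolding is_Ms_def M1_swp[symmetric] by (auto simp: has_type_swp D4_submodule_swp is_submodule_rep_swp)

section \<open>The tensor product formula\<close>

lemma two_nonzero:
  assumes "CHAR('k::field) \<noteq> 2"
  shows "(2 :: 'k) \<noteq> 0"
proof
  assume "(2 :: 'k) = 0"
  then have "of_nat 2 = (0 :: 'k)" by simp
  then have "CHAR('k) dvd 2" by (simp only: of_nat_eq_0_iff_char_dvd)
  then have "CHAR('k) \<le> 2" by (rule dvd_imp_le) simp
  moreover have "CHAR('k) \<noteq> 0"
  proof
    assume "CHAR('k) = 0"
    then show False using \<open>CHAR('k) dvd 2\<close> by simp
  qed
  moreover have "CHAR('k) \<noteq> 1" by (simp add: CHAR_not_1')
  ultimately show False using assms by linarith
qed

lemma sgn2_add: "sgn2 (x + y) = sgn2 x * (sgn2 y :: 'k::field)"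
  by (cases x; cases y) (auto simp: sgn2_def)

text \<open>The top of M has weight (-1)^(r+1) and that of X has (-1)^(r'+s). Their product is the
  weight of the generator of P(r+1+r'+s), and also that of the top of M_t(q, \<eta>) for q = r + r'
  + s, as this weight is (-1)^(q+1).\<close>

lemma tensor_formula:
  assumes two: "(2 :: 'k::field) \<noteq> 0" and M: "is_Ms t r (Fin (\<eta> :: 'k)) M" and X: "is_Omega s (V r') X"
    and P: "is_P (r + 1 + r' + of_nat s) P" and N: "is_Ms t (r + r' + of_nat s) (Fin \<eta>) N"
  shows "M \<otimes>\<^sub>D X \<cong>\<^sub>D copies (s * t) P \<oplus>\<^sub>D N"
proof -
  let ?\<rho> = "sgn2 (r + 1) :: 'k" and ?\<tau> = "sgn2 (r' + of_nat s) :: 'k"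
  have \<rho>\<tau>: "sgn2 (r + 1 + r' + of_nat s) = ?\<rho> * ?\<tau>" "sgn2 (r + r' + of_nat s + 1) = ?\<rho> * ?\<tau>"
    by (simp_all only: sgn2_add mult.assoc mult.commute mult.left_commute)
  obtain \<theta> where \<theta>: "D4_module M" "fiso (KJ t t \<eta> ?\<rho>) M \<theta>" using is_Ms_KJ[OF M two] by blast
  obtain \<nu> where \<nu>: "D4_module N" "fiso (KJ t t \<eta> (?\<rho> * ?\<tau>)) N \<nu>" using is_Ms_KJ[OF N two] unfolding \<rho>\<tau> by blast
  obtain \<phi> where \<phi>: "D4_module X" "fiso (Om s ?\<tau>) X \<phi>" using is_Omega_Om[OF X two] by blast
  obtain p where p: "fiso (QM 1 (?\<rho> * ?\<tau>)) P p" "D4_module P" using is_P_QM[OF P two] unfolding \<rho>\<tau> by blast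
  show ?thesis
    by (rule tensor_decomposition[OF \<theta>(1) \<phi>(1) \<theta>(2) \<phi>(2) sgn2_square sgn2_square p(1) D4_module_wf[OF p(2)]
      \<nu>(2) D4_module_wf[OF \<nu>(1)]])
qed

lemma tensor_formula_P1:
  assumes two: "(2 :: 'k::field) \<noteq> 0" and M: "is_Ms t r (\<eta> :: 'k P1) M" and X: "is_Omega s (V r') X"
    and P: "is_P (r + 1 + r' + of_nat s) P" and N: "is_Ms t (r + r' + of_nat s) \<eta> N"
  shows "M \<otimes>\<^sub>D X \<cong>\<^sub>D copies (s * t) P \<oplus>\<^sub>D N"
proof (cases \<eta>)
  case (Fin x)
  then show ?thesis using tensor_formula[OF two _ X P] M N by simp
next
  case Infty
  have "is_Omega s (V r') (swp X)" using is_Omega_swp[OF X] by (simp add: V_swp)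
  from tensor_formula[OF two is_Ms_swp this is_P_swp[OF P] is_Ms_swp]
  have "swp M \<otimes>\<^sub>D swp X \<cong>\<^sub>D copies (s * t) (swp P) \<oplus>\<^sub>D swp N" using M N Infty by simp
  then show ?thesis by (simp add: tensor_swp[symmetric] dsum_swp[symmetric] copies_swp[symmetric] D4_iso_swp)
qed

theorem corollary2p22:
  fixes s t :: nat and r r' :: bit and \<eta> :: "'k::alg_closed_field P1"
    and M X :: "'k rep"
  assumes "CHAR('k) \<noteq> 2"
    and "s \<ge> 1" and "t \<ge> 1"
    and "is_Ms t r \<eta> M"
    and "is_Omega s (V r') X"
  shows "(odd s \<longrightarrow> (\<forall>P N. is_P (r + r') P \<longrightarrow> is_Ms t (r + r' + 1) \<eta> N \<longrightarrow>
            M \<otimes>\<^sub>D X \<cong>\<^sub>D copies (s * t) P \<oplus>\<^sub>D N)) \<and>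
         (even s \<longrightarrow> (\<forall>P N. is_P (r + r' + 1) P \<longrightarrow> is_Ms t (r + r') \<eta> N \<longrightarrow>
            M \<otimes>\<^sub>D X \<cong>\<^sub>D copies (s * t) P \<oplus>\<^sub>D N))"
proof (intro conjI impI allI)
  note formula = tensor_formula_P1[OF two_nonzero[OF assms(1)] assms(4,5)]
  \<comment> \<open>In \<open>bit\<close> the number s is its own parity, so the two cases of the
    theorem are the two values of a single formula.\<close>
  have s: "(of_nat s :: bit) = of_bool (odd s)"
    by (induction s) auto
  fix P N :: "'k rep"
  {
    assume "odd s" and P: "is_P (r + r') P" and N: "is_Ms t (r + r' + 1) \<eta> N"
    moreover have "r + 1 + r' + 1 = r + r'" by (cases r; cases r') auto
    ultimately show "M \<otimes>\<^sub>D X \<cong>\<^sub>D copies (s * t) P \<oplus>\<^sub>D N" by (intro formula) (simp_all add: s)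
  next
    assume "even s" and P: "is_P (r + r' + 1) P" and N: "is_Ms t (r + r') \<eta> N"
    moreover have "r + 1 + r' = r + r' + 1" by (cases r; cases r') auto
    ultimately show "M \<otimes>\<^sub>D X \<cong>\<^sub>D copies (s * t) P \<oplus>\<^sub>D N" by (intro formula) (simp_all add: s)
  }
qed

end
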